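(* Let $\varepsilon:G\times G\to\mathbb C$ be an admissible graded contraction of $\Gamma_{\mathfrak g_2}$ with support $T=S^{\eta^\varepsilon}$ equal to one of the sets $T_i$ ($1\le i\le 24$) below. Write $\mathfrak M=\mathfrak L^\varepsilon$. (1) If $T=T_1=\emptyset$, then $\mathfrak M$ is abelian. (2) If $T=T_2=\{\{1,2\}\}$, then $\mathfrak z(\mathfrak M)=\mathfrak L_3\oplus\mathfrak L_4\oplus\mathfrak L_5\oplus\mathfrak L_6\oplus\mathfrak L_7$, of dimension $10$; $\mathfrak M'=\mathfrak L_5$, of dimension $2$; $\mathfrak M^{(2)}=\mathfrak M^2=0$, so $\mathfrak M$ is 2-step nilpotent. (3) If $T=T_3=\{\{1,2\},\{1,3\}\}$, then $\mathfrak z(\mathfrak M)=\mathfrak L_4\oplus\mathfrak L_5\oplus\mathfrak L_6\oplus\mathfrak L_7$, of dimension $8$; $\mathfrak M'=\mathfrak L_5\oplus\mathfrak L_6$, of dimension $4$; $\mathfrak M^{(2)}=\mathfrak M^2=0$, so $\mathfrak M$ is 2-step nilpotent. (4) If $T=T_4=\{\{1,2\},\{1,5\}\}$, then $\mathfrak z(\mathfrak M)=\mathfrak L_3\oplus\mathfrak L_4\oplus\mathfrak L_6\oplus\mathfrak L_7$, of dimension $8$; $\mathfrak M'=\mathfrak M^n=\mathfrak L_2\oplus\mathfrak L_5$ for all $n\ge1$, $\dim\mathfrak M'=4$, and $\mathfrak M$ is not nilpotent; $\mathfrak M^{(2)}=0$, so $\mathfrak M$ is 2-step solvable. (5) If $T=T_5=\{\{1,2\},\{6,7\}\}$,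 then $\mathfrak z(\mathfrak M)=\mathfrak L_3\oplus\mathfrak L_4\oplus\mathfrak L_5$, of dimension $6$; $\mathfrak M'=\mathfrak L_5$, of dimension $2$; $\mathfrak M^{(2)}=\mathfrak M^2=0$, so $\mathfrak M$ is 2-step nilpotent. (6) If $T=T_6=\{\{1,2\},\{1,5\},\{2,5\}\}$, then $\mathfrak z(\mathfrak M)=\mathfrak r(\mathfrak M)=\mathfrak L_3\oplus\mathfrak L_4\oplus\mathfrak L_6\oplus\mathfrak L_7$, of dimension $8$, and $\mathfrak M$ is reductive; $\mathfrak M'=\mathfrak M^{(n)}=\mathfrak M^n=\mathfrak L_1\oplus\mathfrak L_2\oplus\mathfrak L_5$ for all $n\ge1$, and $\mathfrak M$ is neither nilpotent nor solvable; $\mathfrak M'\cong\mathfrak{sl}(2,\mathbb C)\oplus\mathfrak{sl}(2,\mathbb C)$ is the Levi subalgebra of $\mathfrak M$; $\mathfrak M=\mathfrak z(\mathfrak M)\oplus\mathfrak M'$ is the Levi decomposition of $\mathfrak M$. (7) If $T=T_7=\{\{2,5\},\{3,6\},\{4,7\}\}$, then $\mathfrak z(\mathfrak M)=\mathfrak L_1=\mathfrak M'$, of dimension $2$; $\mathfrak M^{(2)}=\mathfrak M^2=0$, so $\mathfrak M$ is 2-step nilpotent. (8) If $T=T_8=\{\{1,2\},\{1,3\},\{1,4\}\}$, then $\mathfrak z(\mathfrak M)=\mathfrak M'=\mathfrak L_5\oplus\mathfrak L_6\oplus\mathfrak L_7$, of dimension $6$; $\mathfrak M^{(2)}=\mathfrak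 M^2=0$, so $\mathfrak M$ is 2-step nilpotent. (9) If $T=T_9=\{\{1,2\},\{1,3\},\{1,5\}\}$, then $\mathfrak z(\mathfrak M)=\mathfrak L_4\oplus\mathfrak L_6\oplus\mathfrak L_7$, of dimension $6$; $\mathfrak M'=\mathfrak L_2\oplus\mathfrak L_5\oplus\mathfrak L_6$, of dimension $6$; $\mathfrak M^{(2)}=0$, so $\mathfrak M$ is 2-step solvable; $\mathfrak M^n=\mathfrak L_2\oplus\mathfrak L_5$ for all $n\ge2$, and $\mathfrak M$ is not nilpotent. (11) If $T=T_{11}=\{\{1,2\},\{1,6\},\{2,6\}\}$, then $\mathfrak z(\mathfrak M)=\mathfrak L_3\oplus\mathfrak L_4\oplus\mathfrak L_5\oplus\mathfrak L_7$, of dimension $8$; $\mathfrak M'=\mathfrak L_3\oplus\mathfrak L_4\oplus\mathfrak L_5$, of dimension $6$; $\mathfrak M^{(2)}=\mathfrak M^2=0$, so $\mathfrak M$ is 2-step nilpotent. (12) If $T=T_{12}=\{\{1,2\},\{1,6\},\{6,7\}\}$, then $\mathfrak z(\mathfrak M)=\mathfrak L_3\oplus\mathfrak L_4\oplus\mathfrak L_5$, of dimension $6$; $\mathfrak M'=\mathfrak L_3\oplus\mathfrak L_5$, of dimension $4$; $\mathfrak M^{(2)}=\mathfrak M^2=0$, so $\mathfrak M$ is 2-step nilpotent. (13) If $T=T_{13}=\{\{1,2\},\{1,3\},\{1,4\},\{1,5\}\}$, then $\mathfrak z(\mathfrak M)=\mathfrak L_6\oplus\mathfrak L_7$, of dimension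 $4$; $\mathfrak M'=\mathfrak L_2\oplus\mathfrak L_5\oplus\mathfrak L_6\oplus\mathfrak L_7$, of dimension $8$; $\mathfrak M^{(2)}=0$, so $\mathfrak M$ is 2-step solvable; $\mathfrak M^n=\mathfrak L_2\oplus\mathfrak L_5$ for all $n\ge2$, and $\mathfrak M$ is not nilpotent. (14) If $T=T_{14}=\{\{1,2\},\{1,3\},\{1,5\},\{1,6\}\}$, then $\mathfrak z(\mathfrak M)=\mathfrak L_4\oplus\mathfrak L_7$, of dimension $4$; $\mathfrak M'=\mathfrak L_2\oplus\mathfrak L_3\oplus\mathfrak L_5\oplus\mathfrak L_6=\mathfrak M^n$ for all $n\ge1$, $\dim\mathfrak M'=8$, and $\mathfrak M$ is not nilpotent; $\mathfrak M^{(2)}=0$, so $\mathfrak M$ is 2-step solvable. (15) If $T=T_{15}=\{\{1,2\},\{1,6\},\{1,7\},\{2,6\}\}$, then $\mathfrak z(\mathfrak M)=\mathfrak M'=\mathfrak L_3\oplus\mathfrak L_4\oplus\mathfrak L_5$, of dimension $6$; $\mathfrak M^{(2)}=\mathfrak M^2=0$, so $\mathfrak M$ is 2-step nilpotent. (16) If $T=T_{16}=\{\{1,2\},\{1,6\},\{2,7\},\{6,7\}\}$, then $\mathfrak z(\mathfrak M)=\mathfrak L_3\oplus\mathfrak L_4\oplus\mathfrak L_5$, of dimension $6$; $\mathfrak M'=\mathfrak L_3\oplus\mathfrak L_5$, of dimension $4$; $\mathfrak M^{(2)}=\mathfrak M^2=0$, so $\mathfrak M$ is 2-step nilpotent. (17)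 If $T=T_{17}=\{\{1,2\},\{1,3\},\{1,4\},\{1,5\},\{1,6\}\}$, then $\mathfrak z(\mathfrak M)=\mathfrak L_7$, of dimension $2$; $\mathfrak M'=\mathfrak L_2\oplus\mathfrak L_3\oplus\mathfrak L_5\oplus\mathfrak L_6\oplus\mathfrak L_7$, of dimension $10$; $\mathfrak M^{(2)}=0$, so $\mathfrak M$ is 2-step solvable; $\mathfrak M^n=\mathfrak L_2\oplus\mathfrak L_3\oplus\mathfrak L_5\oplus\mathfrak L_6$ for all $n\ge2$, and $\mathfrak M$ is not nilpotent. (18) If $T=T_{18}=\{\{1,2\},\{1,6\},\{1,7\},\{2,6\},\{2,7\}\}$, then $\mathfrak z(\mathfrak M)=\mathfrak M'=\mathfrak L_3\oplus\mathfrak L_4\oplus\mathfrak L_5$, of dimension $6$; $\mathfrak M^{(2)}=\mathfrak M^2=0$, so $\mathfrak M$ is 2-step nilpotent. (19) If $T=T_{19}=\{\{3,4\},\{3,6\},\{3,7\},\{4,6\},\{4,7\},\{6,7\}\}$, then $\mathfrak z(\mathfrak M)=\mathfrak M'=\mathfrak L_1\oplus\mathfrak L_2\oplus\mathfrak L_5$, of dimension $6$; $\mathfrak M^{(2)}=\mathfrak M^2=0$, so $\mathfrak M$ is 2-step nilpotent. (20) If $T=T_{20}=\{\{1,2\},\{1,3\},\{1,4\},\{1,5\},\{1,6\},\{1,7\}\}$, then $\mathfrak z(\mathfrak M)=0$; $\mathfrak M'=\mathfrak L_2\oplus\mathfrak L_3\oplus\mathfrak L_4\oplus\mathfrak L_5\oplus\mathfrak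 L_6\oplus\mathfrak L_7$, of dimension $12$; $\mathfrak M^{(2)}=0$, so $\mathfrak M$ is 2-step solvable; $\mathfrak M^n=\mathfrak M'$ for all $n\ge2$, and $\mathfrak M$ is not nilpotent. (21) If $T=T_{21}=\{\{1,2\},\{1,3\},\{1,7\},\{2,3\},\{2,6\},\{3,5\}\}$, then $\mathfrak z(\mathfrak M)=\mathfrak L_4$, of dimension $2$; $\mathfrak M'=\mathfrak L_4\oplus\mathfrak L_5\oplus\mathfrak L_6\oplus\mathfrak L_7$, of dimension $8$; $\mathfrak M^{(2)}=0$, so $\mathfrak M$ is 2-step solvable; $\mathfrak M^2=\mathfrak z(\mathfrak M)$ and $\mathfrak M$ is 3-step nilpotent. (22) If $T=T_{22}=\{\{1,2\},\{1,3\},\{1,4\},\{1,5\},\{1,6\},\{1,7\},\{2,3\},\{2,6\},\{3,5\},\{5,6\}\}$, then $\mathfrak z(\mathfrak M)=0$; $\mathfrak M^n=\mathfrak L_2\oplus\mathfrak L_3\oplus\mathfrak L_4\oplus\mathfrak L_5\oplus\mathfrak L_6\oplus\mathfrak L_7$ for all $n\ge1$, $\dim\mathfrak M'=12$, and $\mathfrak M$ is not nilpotent; $\mathfrak M^{(2)}=\mathfrak L_4\oplus\mathfrak L_7$, $\mathfrak M^{(3)}=0$ and $\mathfrak M$ is 3-step solvable. (23) If $T=T_{23}=X\setminus T_{19}$, then $\mathfrak z(\mathfrak M)=0$; $\mathfrak M^n=\mathfrak M^{(n)}=\mathfrak M$ for all $n\ge1$, and $\mathfrak M$ is neither nilpotent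 nor solvable; $\mathfrak r(\mathfrak M)=\mathfrak L_3\oplus\mathfrak L_4\oplus\mathfrak L_6\oplus\mathfrak L_7$ is an abelian ideal of dimension $8$, and $\mathfrak M$ is not reductive; $\mathfrak h=\mathfrak L_1\oplus\mathfrak L_2\oplus\mathfrak L_5\cong\mathfrak{sl}(2,\mathbb C)\oplus\mathfrak{sl}(2,\mathbb C)$ is the Levi subalgebra of $\mathfrak M$; $\mathfrak M=\mathfrak r(\mathfrak M)\oplus\mathfrak h$ is the Levi decomposition of $\mathfrak M$. (24) If $T=T_{24}=X$, then $\mathfrak M$ is simple.
   Context: Let $I=\{1,\dots,7\}$ and write the elements of $G=\mathbb{Z}_2^3$ as $e=g_0=(0,0,0)$, $g_1=(1,0,0)$, $g_2=(0,1,0)$, $g_3=(0,0,1)$, $g_4=(1,1,1)$, $g_5=(1,1,0)$, $g_6=(1,0,1)$, $g_7=(0,1,1)$. For $i\ne j$ in $I$, $i\ast j\in I$ is the index with $g_{i\ast j}=g_i+g_j$. Let $X=\{\{i,j\}: i,j\in I,\ i\neq j\}$. The complex octonion algebra $\mathcal O$ has basis $1,e_1,\dots,e_7$, with identity $1$, $e_i^2=-1$, and for $i\neq j$: $e_ie_j=e_{i\ast j}$ if some cyclic permutation of $(i,j,i\ast j)$ belongs to $\{(1,2,5),(5,6,7),(7,4,1),(1,3,6),(6,4,2),(2,7,3),(3,4,5)\}$, and $e_ie_j=-e_{i\ast j}$ otherwise. It is $G$-graded by $\mathcal O_{g_0}=\mathbb C1$, $\mathcal O_{g_i}=\mathbb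 Ce_i$. Let $\mathfrak L=\mathfrak g_2=\mathrm{Der}(\mathcal O)$ (dimension 14), with the induced $G$-grading $\Gamma_{\mathfrak g_2}$: $\mathfrak L=\bigoplus_{g\in G}\mathfrak L_g$, $\mathfrak L_g=\{d\in\mathfrak L: d(\mathcal O_h)\subseteq\mathcal O_{g+h}\ \forall h\in G\}$; write $\mathfrak L_i=\mathfrak L_{g_i}$ for $i\in I$ (each 2-dimensional; $\mathfrak L_{e}=0$). A graded contraction of $\Gamma_{\mathfrak g_2}$ is a map $\varepsilon:G\times G\to\mathbb C$ such that the vector space $\mathfrak L$ with product $[x,y]^\varepsilon:=\varepsilon(g,h)[x,y]$ for $x\in\mathfrak L_g,y\in\mathfrak L_h$ (extended bilinearly) is a Lie algebra, denoted $\mathfrak L^\varepsilon$. It is admissible if $\varepsilon(g,g)=\varepsilon(e,g)=\varepsilon(g,e)=0$ for all $g\in G$; an admissible graded contraction is symmetric, and one puts $\eta^\varepsilon:X\to\mathbb C$, $\eta^\varepsilon(\{i,j\})=\varepsilon(g_i,g_j)$, with support $S^{\eta^\varepsilon}=\{t\in X:\eta^\varepsilon(t)\ne0\}$. For a Lie algebra $\mathfrak g$: $\mathfrak g'=[\mathfrak g,\mathfrak g]$; lower central series $\mathfrak g^0=\mathfrak g$, $\mathfrak g^1=\mathfrak g'$, $\mathfrak g^n=[\mathfrak g,\mathfrak g^{n-1}]$ for $n\ge2$; derived series $\mathfrak g^{(1)}=\mathfrak g'$, $\mathfrak g^{(n)}=[\mathfrak g^{(n-1)},\mathfrak g^{(n-1)}]$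 for $n\ge2$. $\mathfrak g$ is $m$-step nilpotent (resp. $m$-step solvable) if $m$ is the least natural number with $\mathfrak g^m=0$ (resp. $\mathfrak g^{(m)}=0$). $\mathfrak z(\mathfrak g)$ is the center, $\mathfrak r(\mathfrak g)$ the radical (largest solvable ideal); $\mathfrak g$ is reductive if $\mathfrak r(\mathfrak g)=\mathfrak z(\mathfrak g)$; a Levi subalgebra is a semisimple subalgebra complementing $\mathfrak r(\mathfrak g)$, and the Levi decomposition is the resulting vector space direct sum. In the statement, for $\mathfrak M=\mathfrak L^\varepsilon$ all these notions refer to the bracket $[\cdot,\cdot]^\varepsilon$. The set $T_{10}=\{\{1,2\},\{1,3\},\{1,7\}\}$ is also in the paper's list of the $T_i$, but no assertion is made for it (there is no item (10)). *)

theory Defs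
  imports "HOL-Analysis.Analysis" "HOL-Library.Z2" "HOL-Library.Function_Algebras"
begin

section \<open>Complex Lie algebras\<close>

text \<open>A Lie algebra lives on a complex subspace \<open>lie_carrier M\<close> of an ambient vector space, given
  by the additive group of the type together with \<open>lie_scale M\<close>. The bracket is only relevant on
  the carrier.\<close>

record 'v lie_alg =
  lie_carrier :: "'v set"
  lie_scale :: "complex \<Rightarrow> 'v \<Rightarrow> 'v"
  lie_br :: "'v \<Rightarrow> 'v \<Rightarrow> 'v"

definition lie_algebra :: "'v::ab_group_add lie_alg \<Rightarrow> bool" where
  "lie_algebra M \<longleftrightarrow>
     vector_space (lie_scale M) \<and> module.subspace (lie_scale M) (lie_carrier M) \<and>
     (\<forall>x\<in>lie_carrier M. \<forall>y\<in>lie_carrier M. lie_br M x y \<in> lie_carrier M) \<and>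
     (\<forall>x\<in>lie_carrier M. \<forall>y\<in>lie_carrier M. \<forall>z\<in>lie_carrier M.
        lie_br M (x + y) z = lie_br M x z + lie_br M y z \<and>
        lie_br M z (x + y) = lie_br M z x + lie_br M z y) \<and>
     (\<forall>c. \<forall>x\<in>lie_carrier M. \<forall>y\<in>lie_carrier M.
        lie_br M (lie_scale M c x) y = lie_scale M c (lie_br M x y) \<and>
        lie_br M x (lie_scale M c y) = lie_scale M c (lie_br M x y)) \<and>
     (\<forall>x\<in>lie_carrier M. lie_br M x x = 0) \<and>
     (\<forall>x\<in>lie_carrier M. \<forall>y\<in>lie_carrier M. \<forall>z\<in>lie_carrier M.
        lie_br M x (lie_br M y z) + lie_br M y (lie_br M z x) + lie_br M z (lie_br M x y) = 0)"

definition lie_dim :: "'v::ab_group_add lie_alg \<Rightarrow> 'v set \<Rightarrow> nat" where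
  "lie_dim M S = vector_space.dim (lie_scale M) S"

definition lie_restrict :: "'v lie_alg \<Rightarrow> 'v set \<Rightarrow> 'v lie_alg" where
  "lie_restrict M S = M\<lparr>lie_carrier := S\<rparr>"

definition lie_prod :: "'v::ab_group_add lie_alg \<Rightarrow> 'v set \<Rightarrow> 'v set \<Rightarrow> 'v set" where
  "lie_prod M A B = module.span (lie_scale M) {lie_br M x y | x y. x \<in> A \<and> y \<in> B}"

definition lie_subalgebra :: "'v::ab_group_add lie_alg \<Rightarrow> 'v set \<Rightarrow> bool" where
  "lie_subalgebra M S \<longleftrightarrow> S \<subseteq> lie_carrier M \<and> module.subspace (lie_scale M) S \<and>
     (\<forall>x\<in>S. \<forall>y\<in>S. lie_br M x y \<in> S)"

definition lie_ideal :: "'v::ab_group_add lie_alg \<Rightarrow> 'v set \<Rightarrow> bool" where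
  "lie_ideal M J \<longleftrightarrow> J \<subseteq> lie_carrier M \<and> module.subspace (lie_scale M) J \<and>
     (\<forall>x\<in>lie_carrier M. \<forall>y\<in>J. lie_br M x y \<in> J)"

definition lie_abelian :: "'v::ab_group_add lie_alg \<Rightarrow> bool" where
  "lie_abelian M \<longleftrightarrow> (\<forall>x\<in>lie_carrier M. \<forall>y\<in>lie_carrier M. lie_br M x y = 0)"

definition lie_center :: "'v::ab_group_add lie_alg \<Rightarrow> 'v set" where
  "lie_center M = {x \<in> lie_carrier M. \<forall>y\<in>lie_carrier M. lie_br M x y = 0}"

fun lie_lower :: "'v::ab_group_add lie_alg \<Rightarrow> nat \<Rightarrow> 'v set" where
  "lie_lower M 0 = lie_carrier M"
| "lie_lower M (Suc n) = lie_prod M (lie_carrier M) (lie_lower M n)"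

fun lie_der :: "'v::ab_group_add lie_alg \<Rightarrow> nat \<Rightarrow> 'v set" where
  "lie_der M 0 = lie_carrier M"
| "lie_der M (Suc n) = lie_prod M (lie_der M n) (lie_der M n)"

abbreviation lie_derived :: "'v::ab_group_add lie_alg \<Rightarrow> 'v set" where
  "lie_derived M \<equiv> lie_prod M (lie_carrier M) (lie_carrier M)"

definition lie_nilpotent :: "'v::ab_group_add lie_alg \<Rightarrow> bool" where
  "lie_nilpotent M \<longleftrightarrow> (\<exists>m. lie_lower M m = {0})"

definition lie_solvable :: "'v::ab_group_add lie_alg \<Rightarrow> bool" where
  "lie_solvable M \<longleftrightarrow> (\<exists>m. lie_der M m = {0})"

definition step_nilpotent :: "nat \<Rightarrow> 'v::ab_group_add lie_alg \<Rightarrow> bool" where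
  "step_nilpotent m M \<longleftrightarrow> lie_lower M m = {0} \<and> (\<forall>k<m. lie_lower M k \<noteq> {0})"

definition step_solvable :: "nat \<Rightarrow> 'v::ab_group_add lie_alg \<Rightarrow> bool" where
  "step_solvable m M \<longleftrightarrow> lie_der M m = {0} \<and> (\<forall>k<m. lie_der M k \<noteq> {0})"

text \<open>\<open>GREATEST\<close> refers to the inclusion order on sets.\<close>

definition lie_radical :: "'v::ab_group_add lie_alg \<Rightarrow> 'v set" where
  "lie_radical M = (GREATEST J. lie_ideal M J \<and> lie_solvable (lie_restrict M J))"

definition lie_reductive :: "'v::ab_group_add lie_alg \<Rightarrow> bool" where
  "lie_reductive M \<longleftrightarrow> lie_radical M = lie_center M"

definition lie_semisimple :: "'v::ab_group_add lie_alg \<Rightarrow> bool" where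
  "lie_semisimple M \<longleftrightarrow> lie_radical M = {0}"

definition lie_simple :: "'v::ab_group_add lie_alg \<Rightarrow> bool" where
  "lie_simple M \<longleftrightarrow> \<not> lie_abelian M \<and>
     (\<forall>J. lie_ideal M J \<longrightarrow> J = {0} \<or> J = lie_carrier M)"

definition internal_direct_sum :: "'v::ab_group_add set \<Rightarrow> 'v set \<Rightarrow> 'v set \<Rightarrow> bool" where
  "internal_direct_sum W U V \<longleftrightarrow> W = {u + v | u v. u \<in> U \<and> v \<in> V} \<and> U \<inter> V = {0}"

definition levi_subalgebra :: "'v::ab_group_add lie_alg \<Rightarrow> 'v set \<Rightarrow> bool" where
  "levi_subalgebra M S \<longleftrightarrow> lie_subalgebra M S \<and> lie_semisimple (lie_restrict M S) \<and>
     internal_direct_sum (lie_carrier M) (lie_radical M) S"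

definition levi_decomposition :: "'v::ab_group_add lie_alg \<Rightarrow> 'v set \<Rightarrow> 'v set \<Rightarrow> bool" where
  "levi_decomposition M R S \<longleftrightarrow> R = lie_radical M \<and> levi_subalgebra M S \<and>
     internal_direct_sum (lie_carrier M) R S"

definition lie_isomorphic ::
    "'v::ab_group_add lie_alg \<Rightarrow> 'w::ab_group_add lie_alg \<Rightarrow> bool" where
  "lie_isomorphic M N \<longleftrightarrow> (\<exists>f. bij_betw f (lie_carrier M) (lie_carrier N) \<and>
     (\<forall>x\<in>lie_carrier M. \<forall>y\<in>lie_carrier M. f (x + y) = f x + f y) \<and>
     (\<forall>c. \<forall>x\<in>lie_carrier M. f (lie_scale M c x) = lie_scale N c (f x)) \<and>
     (\<forall>x\<in>lie_carrier M. \<forall>y\<in>lie_carrier M. f (lie_br M x y) = lie_br N (f x) (f y)))"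

definition lie_sum :: "'v lie_alg \<Rightarrow> 'w lie_alg \<Rightarrow> ('v \<times> 'w) lie_alg" where
  "lie_sum M N = \<lparr>lie_carrier = lie_carrier M \<times> lie_carrier N,
     lie_scale = (\<lambda>c (x, y). (lie_scale M c x, lie_scale N c y)),
     lie_br = (\<lambda>(x, y) (x', y'). (lie_br M x x', lie_br N y y'))\<rparr>"

definition sl2 :: "(complex ^ 2 ^ 2) lie_alg" where
  "sl2 = \<lparr>lie_carrier = {A. trace A = 0},
     lie_scale = (\<lambda>c A. \<chi> i j. c * A $ i $ j),
     lie_br = (\<lambda>A B. A ** B - B ** A)\<rparr>"


section \<open>The group and the octonions\<close>

instance bit :: finite
proof
  have "(UNIV :: bit set) = {0, 1}" by (auto intro: bit_not_one_iff)
  then show "finite (UNIV :: bit set)" by (metis finite.emptyI finite_insert)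
qed

type_synonym grp = "bit \<times> bit \<times> bit"

definition gr :: "nat \<Rightarrow> grp" where
  "gr i = [(0,0,0), (1,0,0), (0,1,0), (0,0,1), (1,1,1), (1,1,0), (1,0,1), (0,1,1)] ! i"

definition idx :: "nat set" where
  "idx = {1..7}"

definition istar :: "nat \<Rightarrow> nat \<Rightarrow> nat" where
  "istar i j = (THE k. k \<in> idx \<and> gr k = gr i + gr j)"

definition edges :: "nat set set" where
  "edges = {{i, j} | i j. i \<in> idx \<and> j \<in> idx \<and> i \<noteq> j}"

text \<open>The coordinate at \<open>gr i\<close> is the coefficient of \<open>e\<^sub>i\<close>, where \<open>e\<^sub>0\<close> is the identity of the algebra;
  so the indexing of the basis already carries the grading.\<close>

type_synonym oct = "complex ^ grp"

definition oct_basis :: "nat \<Rightarrow> oct" where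
  "oct_basis i = axis (gr i) 1"

definition oct_lines :: "(nat \<times> nat \<times> nat) set" where
  "oct_lines = {(1,2,5), (5,6,7), (7,4,1), (1,3,6), (6,4,2), (2,7,3), (3,4,5)}"

definition oct_basis_mult :: "nat \<Rightarrow> nat \<Rightarrow> oct" where
  "oct_basis_mult i j =
     (if i = 0 then oct_basis j
      else if j = 0 then oct_basis i
      else if i = j then - oct_basis 0
      else let k = istar i j in
        if (i, j, k) \<in> oct_lines \<or> (j, k, i) \<in> oct_lines \<or> (k, i, j) \<in> oct_lines
        then oct_basis k else - oct_basis k)"

definition oct_mult :: "oct \<Rightarrow> oct \<Rightarrow> oct" where
  "oct_mult x y = (\<Sum>i\<in>{0..7}. \<Sum>j\<in>{0..7}. (x $ gr i * y $ gr j) *s oct_basis_mult i j)"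

definition oct_comp :: "grp \<Rightarrow> oct set" where
  "oct_comp g = {c *s axis g 1 | c. True}"


section \<open>The Lie algebra of derivations, its grading and graded contractions\<close>

type_synonym oct_map = "oct \<Rightarrow> oct"

definition g2_carrier :: "oct_map set" where
  "g2_carrier = {d. Vector_Spaces.linear (*s) (*s) d \<and>
     (\<forall>x y. d (oct_mult x y) = oct_mult (d x) y + oct_mult x (d y))}"

definition map_scale :: "complex \<Rightarrow> oct_map \<Rightarrow> oct_map" where
  "map_scale c d = (\<lambda>x. c *s d x)"

definition map_br :: "oct_map \<Rightarrow> oct_map \<Rightarrow> oct_map" where
  "map_br d d' = (\<lambda>x. d (d' x) - d' (d x))"

definition g2 :: "oct_map lie_alg" where
  "g2 = \<lparr>lie_carrier = g2_carrier, lie_scale = map_scale, lie_br = map_br\<rparr>"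

definition g2_comp :: "grp \<Rightarrow> oct_map set" where
  "g2_comp g = {d \<in> g2_carrier. \<forall>h. \<forall>x\<in>oct_comp h. d x \<in> oct_comp (g + h)}"

definition g2_sum :: "nat set \<Rightarrow> oct_map set" where
  "g2_sum J = {\<Sum>i\<in>J. x i | x. \<forall>i\<in>J. x i \<in> g2_comp (gr i)}"

definition oct_proj :: "grp \<Rightarrow> oct \<Rightarrow> oct" where
  "oct_proj g x = (x $ g) *s axis g 1"

text \<open>The homogeneous component of degree \<open>g\<close> of a linear map on the octonions.\<close>

definition map_proj :: "grp \<Rightarrow> oct_map \<Rightarrow> oct_map" where
  "map_proj g d = (\<lambda>x. \<Sum>h\<in>UNIV. oct_proj (g + h) (d (oct_proj h x)))"

definition contr_br :: "(grp \<Rightarrow> grp \<Rightarrow> complex) \<Rightarrow> oct_map \<Rightarrow> oct_map \<Rightarrow> oct_map" where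
  "contr_br \<epsilon> x y =
     (\<Sum>g\<in>UNIV. \<Sum>h\<in>UNIV. map_scale (\<epsilon> g h) (map_br (map_proj g x) (map_proj h y)))"

definition g2_contr :: "(grp \<Rightarrow> grp \<Rightarrow> complex) \<Rightarrow> oct_map lie_alg" where
  "g2_contr \<epsilon> = g2\<lparr>lie_br := contr_br \<epsilon>\<rparr>"

definition graded_contraction :: "(grp \<Rightarrow> grp \<Rightarrow> complex) \<Rightarrow> bool" where
  "graded_contraction \<epsilon> \<longleftrightarrow> lie_algebra (g2_contr \<epsilon>)"

definition admissible :: "(grp \<Rightarrow> grp \<Rightarrow> complex) \<Rightarrow> bool" where
  "admissible \<epsilon> \<longleftrightarrow> (\<forall>g. \<epsilon> g g = 0 \<and> \<epsilon> 0 g = 0 \<and> \<epsilon> g 0 = 0)"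

text \<open>The next facts confirm that \<open>map_proj\<close> extracts the homogeneous components and that \<open>contr_br\<close>
  is the bilinear extension of \<open>\<epsilon> g h [x, y]\<close> from homogeneous \<open>x\<close>, \<open>y\<close>.\<close>

lemma sum_fun_apply: "(\<Sum>a\<in>A. f a) x = (\<Sum>a\<in>A. f a x)"
  for f :: "'a \<Rightarrow> 'b \<Rightarrow> 'c::comm_monoid_add"
  by (induction A rule: infinite_finite_induct) auto

lemma grp_add_self: "g + g = (0 :: grp)"
  by (cases g) (auto simp: zero_prod_def)

lemma sum_oct_proj: "(\<Sum>h\<in>UNIV. oct_proj h x) = x"
  by (simp add: vec_eq_iff oct_proj_def axis_def if_distrib cong: if_cong)

lemma oct_proj_in: "oct_proj h x \<in> oct_comp h"
  by (auto simp: oct_proj_def oct_comp_def)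

lemma oct_proj_comp: "x \<in> oct_comp h \<Longrightarrow> oct_proj g x = (if g = h then x else 0)"
  by (auto simp: oct_proj_def oct_comp_def axis_def vec_eq_iff)

lemma map_proj_sum:
  assumes "Vector_Spaces.linear (*s) (*s) (d :: oct_map)"
  shows "(\<Sum>g\<in>UNIV. map_proj g d) = d"
proof
  fix x
  interpret Vector_Spaces.linear "(*s)" "(*s)" d by fact
  have inv: "(\<Sum>g\<in>UNIV. oct_proj (g + h) y) = y" for h y
  proof -
    have "(\<Sum>g\<in>UNIV. oct_proj (g + h) y) = (\<Sum>g\<in>UNIV. oct_proj g y)"
      by (rule sum.reindex_bij_witness[of _ "\<lambda>g. g + h" "\<lambda>g. g + h"])
         (auto simp: add.assoc grp_add_self)
    then show ?thesis by (simp add: sum_oct_proj)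
  qed
  have "(\<Sum>g\<in>UNIV. map_proj g d) x = (\<Sum>h\<in>UNIV. \<Sum>g\<in>UNIV. oct_proj (g + h) (d (oct_proj h x)))"
    by (subst sum.swap) (simp add: sum_fun_apply map_proj_def)
  also have "\<dots> = d (\<Sum>h\<in>UNIV. oct_proj h x)"
    by (simp only: inv sum)
  finally show "(\<Sum>g\<in>UNIV. map_proj g d) x = d x" by (simp only: sum_oct_proj)
qed

lemma map_proj_comp:
  assumes "d \<in> g2_comp k"
  shows "map_proj g d = (if g = k then d else 0)"
proof
  fix x
  interpret Vector_Spaces.linear "(*s)" "(*s)" d
    using assms by (simp add: g2_comp_def g2_carrier_def)
  have "oct_proj (g + h) (d (oct_proj h x)) = (if g = k then d (oct_proj h x) else 0)" for h
  proof -
    have "d (oct_proj h x) \<in> oct_comp (k + h)"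
      using assms oct_proj_in unfolding g2_comp_def by blast
    from oct_proj_comp[OF this, of "g + h"] show ?thesis
      by (simp only: add_right_cancel)
  qed
  then have "map_proj g d x = (if g = k then d (\<Sum>h\<in>UNIV. oct_proj h x) else 0)"
    by (simp add: map_proj_def sum)
  then show "map_proj g d x = (if g = k then d else 0) x"
    by (simp add: sum_oct_proj)
qed

lemma contr_br_comp:
  assumes "x \<in> g2_comp g" "y \<in> g2_comp h"
  shows "contr_br \<epsilon> x y = map_scale (\<epsilon> g h) (map_br x y)"
proof -
  have lin: "x 0 = 0" "y 0 = 0"
    using assms vec.linear_0 by (auto simp: g2_comp_def g2_carrier_def)
  have "map_scale (\<epsilon> g' h') (map_br (map_proj g' x) (map_proj h' y)) =
      (if h' = h then if g' = g then map_scale (\<epsilon> g h) (map_br x y) else 0 else 0)" for g' h'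
    using lin by (auto simp: map_proj_comp[OF assms(1)] map_proj_comp[OF assms(2)]
        map_scale_def map_br_def fun_eq_iff)
  then show ?thesis by (simp add: contr_br_def)
qed

text \<open>Admissible graded contractions are symmetric, so listing the two elements of an edge in
  increasing order is immaterial.\<close>

definition eta :: "(grp \<Rightarrow> grp \<Rightarrow> complex) \<Rightarrow> nat set \<Rightarrow> complex" where
  "eta \<epsilon> t = \<epsilon> (gr (Min t)) (gr (Max t))"

definition eta_support :: "(grp \<Rightarrow> grp \<Rightarrow> complex) \<Rightarrow> nat set set" where
  "eta_support \<epsilon> = {t \<in> edges. eta \<epsilon> t \<noteq> 0}"

end

theory Submission
  imports Defs
begin

text \<open>The homogeneous derivations of degree \<open>g\<close> are diagonal up to the shift by \<open>g\<close>: they send \<open>e\<^sub>h\<close> to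
  \<open>a h\<close> times \<open>e\<^sub>g e\<^sub>h\<close>, where \<open>a\<close> is constant on the three lines through \<open>g\<close> and its three
  values sum to zero. On a fixed line \<open>{g, k, g + k}\<close> a derivation of degree \<open>g\<close> is therefore given by its value
  \<open>u\<close> on the line and the difference \<open>v\<close> of its values on the two other lines through \<open>g\<close>, and the
  bracket of degrees \<open>g\<close> and \<open>k\<close> just multiplies the \<open>u\<close>'s and the \<open>v\<close>'s. Hence brackets of
  homogeneous components are onto and nondegenerate, so that the centre and the derived and lower
  central series of a contraction are sums of components that can be read off its support. When the
  support contains the line \<open>{1, 2, 5}\<close> but nothing off it, \<open>u\<close> and \<open>v\<close> give a homomorphism onto two
  copies of the cross product algebra \<open>sl(2)\<close> whose kernel is the radical.\<close>

section \<open>Signs of the octonion product\<close>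

text \<open>The first obstacle is the octonion signs. They are the values of a cubic polynomial over
  the field with two elements; its coboundary governs reassociation, so independent basis elements
  anti-associate, and comparing a derivation of degree \<open>g\<close> with left multiplication by
  \<open>e_g\<close> removes every sign from the Leibniz rule. The coordinates \<open>u\<close> and
  \<open>v\<close> decouple in a bracket because moving an off-line argument by \<open>g\<close>
  exchanges the two values of one factor and fixes those of the other. A second obstacle is that a
  nonzero element may have \<open>u = 0\<close> or \<open>v = 0\<close> on a given line, and then
  its bracket along that line is not onto. Products of whole components avoid this by choosing an
  element with \<open>u = v = 1\<close>. Simplicity cannot choose, and instead looks for a line
  through \<open>g\<close> on which both coordinates of the given element are nonzero. The values of
  \<open>\<epsilon>\<close> matter only through being zero or not: in a product of components they
  are divided out, and on the line \<open>{1, 2, 5}\<close> they are absorbed by rescaling the three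
  degrees, which takes square roots and hence uses the complex numbers.\<close>

declare add_bit_eq_xor [simp del] mult_bit_eq_and [simp del]
  split_paired_All [simp del] split_paired_Ex [simp del]

lemma bit_add_self [simp]: "s + s = (0::bit)"
  by (cases s) (simp_all add: add_bit_eq_xor)

text \<open>Exponent of the cochain that presents the octonions as a twisted group algebra of
  \<open>Z_2^3\<close>. The bilinear terms are cocycles and only fix the orientation of the lines;
  the three cubic terms carry the failure of associativity.\<close>

definition octphase :: "grp \<Rightarrow> grp \<Rightarrow> bit" where
  "octphase g h = (case g of (a, b, c) \<Rightarrow> case h of (x, y, z) \<Rightarrow>
     c*z + c*x + b*z + b*y + b*x + b*c*x + a*x + a*c*y + a*b*z)"

definition octsign :: "grp \<Rightarrow> grp \<Rightarrow> complex" where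
  "octsign g h = (if octphase g h = 0 then 1 else - 1)"

text \<open>Linear independence over the field with two elements, or three points of the Fano plane
  that are not collinear.\<close>

definition indep :: "grp \<Rightarrow> grp \<Rightarrow> grp \<Rightarrow> bool" where
  "indep g h k \<longleftrightarrow> g \<noteq> 0 \<and> h \<noteq> 0 \<and> k \<noteq> 0 \<and> g \<noteq> h \<and> g \<noteq> k \<and> h \<noteq> k \<and> g + h \<noteq> k"

lemma bit_all: "(\<forall>b::bit. P b) \<longleftrightarrow> P 0 \<and> P 1"
  by (metis bit_not_one_iff)

lemma grp_all: "(\<forall>g::grp. P g) \<longleftrightarrow> P (0,0,0) \<and> P (1,0,0) \<and> P (0,1,0) \<and> P (0,0,1)
    \<and> P (1,1,1) \<and> P (1,1,0) \<and> P (1,0,1) \<and> P (0,1,1)"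
  unfolding split_paired_All bit_all by blast

lemma grp_zero: "(0::grp) = (0,0,0)"
  by (simp add: zero_prod_def)

lemma grp_add_left: "g + (g + h) = (h :: grp)"
  by (simp add: add.assoc[symmetric] grp_add_self)

lemma grp_add_eq_0: "g + h = 0 \<longleftrightarrow> g = (h :: grp)"
  by (metis grp_add_left grp_add_self add_0_right)

lemma octsign_sq: "octsign g h * octsign g h = 1"
  by (simp add: octsign_def)

lemma octsign_zero: "octsign 0 h = 1" "octsign h 0 = 1"
  by (cases h; simp add: octsign_def octphase_def zero_prod_def)+

lemma octsign_self: "g \<noteq> 0 \<Longrightarrow> octsign g g = - 1"
proof -
  have "\<forall>g. g \<noteq> 0 \<longrightarrow> octsign g g = - 1"
    unfolding grp_all grp_zero by (simp add: octsign_def octphase_def)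
  then show "g \<noteq> 0 \<Longrightarrow> octsign g g = - 1" by blast
qed

lemma octsign_swap:
  assumes "g \<noteq> 0" "h \<noteq> 0" "g \<noteq> h"
  shows "octsign g h = - octsign h g"
proof -
  have "\<forall>g h. g \<noteq> 0 \<longrightarrow> h \<noteq> 0 \<longrightarrow> g \<noteq> h \<longrightarrow> octsign g h = - octsign h g"
    unfolding grp_all grp_zero by (simp add: octsign_def octphase_def)
  then show ?thesis using assms by blast
qed

text \<open>Sign form of \<open>e_g (e_g e_h) = (e_g e_g) e_h = - e_h\<close>.\<close>

lemma octsign_left_alternative:
  assumes "g \<noteq> 0"
  shows "octsign g (g + h) = - octsign g h"
proof -
  have "\<forall>g h. g \<noteq> 0 \<longrightarrow> octsign g (g + h) = - octsign g h"
    unfolding grp_all grp_zero by (simp add: octsign_def octphase_def)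
  then show ?thesis using assms by blast
qed

lemma octsign_right_alternative:
  assumes "h \<noteq> 0"
  shows "octsign (g + h) h = - octsign g h"
proof -
  have "\<forall>h g. h \<noteq> 0 \<longrightarrow> octsign (g + h) h = - octsign g h"
    unfolding grp_all grp_zero by (simp add: octsign_def octphase_def)
  then show ?thesis using assms by blast
qed

text \<open>The coboundary of \<open>octphase\<close> is the determinant over the field with two elements.\<close>

lemma octphase_coboundary:
  "octphase (a, b, c) ((x, y, z) + (p, q, r)) + octphase (x, y, z) (p, q, r)
   + (octphase ((a, b, c) + (x, y, z)) (p, q, r) + octphase (a, b, c) (x, y, z))
   = a*y*r + a*z*q + b*x*r + b*z*p + c*x*q + c*y*p"
proof -
  have char2: "s + (s + t) = t" for s t :: bit
    by (metis add.assoc add_0 bit_add_self)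
  show ?thesis
    by (simp add: octphase_def algebra_simps char2)
qed

lemma indep_det:
  assumes "indep (a, b, c) (x, y, z) (p, q, r)"
  shows "a*y*r + a*z*q + b*x*r + b*z*p + c*x*q + c*y*p = 1"
proof -
  have "\<forall>a b c x y z p q r. indep (a, b, c) (x, y, z) (p, q, r) \<longrightarrow>
      a*y*r + a*z*q + b*x*r + b*z*p + c*x*q + c*y*p = 1"
    unfolding bit_all indep_def grp_zero by simp
  then show ?thesis using assms by blast
qed

text \<open>The determinant of an independent triple is 1, so reassociating
  \<open>e_g e_h e_k\<close> costs exactly one sign.\<close>

lemma octsign_antiassoc:
  assumes "indep g h k"
  shows "octsign g (h + k) * octsign h k = - (octsign (g + h) k * octsign g h)"
proof -
  have sign: "(if s = 0 then 1 else - 1) * (if t = 0 then 1 else - 1) =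
      - ((if s' = 0 then 1 else - 1) * (if t' = 0 then 1 else - 1) :: complex)"
    if "s + t + (s' + t') = 1" for s t s' t' :: bit
    using that by (cases s; cases t; cases s'; cases t') auto
  obtain a b c x y z p q r where "g = (a, b, c)" "h = (x, y, z)" "k = (p, q, r)"
    by (metis prod_cases3)
  with assms show ?thesis
    unfolding octsign_def by (intro sign) (simp only: octphase_coboundary indep_det)
qed

section \<open>The numbering of the group elements and the octonion product in coordinates\<close>

lemma gr_simps [simp]:
  "gr 0 = (0,0,0)" "gr (Suc 0) = (1,0,0)" "gr 1 = (1,0,0)" "gr 2 = (0,1,0)" "gr 3 = (0,0,1)" "gr 4 = (1,1,1)"
  "gr 5 = (1,1,0)" "gr 6 = (1,0,1)" "gr 7 = (0,1,1)"
  by (simp_all add: gr_def)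

lemma atLeast0_AtMost7: "{0..7::nat} = {0,1,2,3,4,5,6,7}"
  by auto

lemma idx_eq: "idx = {1,2,3,4,5,6,7}"
  unfolding idx_def by auto

lemma gr_bij: "bij_betw gr {0..7} UNIV"
proof -
  have "\<forall>g. g \<in> gr ` {0..7}"
    unfolding grp_all atLeast0_AtMost7 by simp
  moreover have "inj_on gr {0..7}"
    unfolding atLeast0_AtMost7 by simp
  ultimately show ?thesis by (auto simp: bij_betw_def)
qed

lemma gr_inj: "inj_on gr idx"
  by (rule inj_on_subset[OF bij_betw_imp_inj_on[OF gr_bij]]) (auto simp: idx_def)

lemma gr_nonzero: "i \<in> idx \<Longrightarrow> gr i \<noteq> 0"
  by (auto simp: idx_eq grp_zero)

lemma gr_image_idx: "gr ` idx = - {0}"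
proof -
  have "\<forall>g. g \<in> gr ` idx \<longleftrightarrow> g \<noteq> 0"
    unfolding grp_all idx_eq grp_zero by simp
  then show ?thesis by auto
qed

lemma istar_eqI: "k \<in> idx \<Longrightarrow> gr k = gr i + gr j \<Longrightarrow> istar i j = k"
  unfolding istar_def using gr_inj by (intro the_equality) (auto simp: inj_on_def)

lemma
  assumes "i \<in> idx" "j \<in> idx" "i \<noteq> j"
  shows istar_in: "istar i j \<in> idx" and gr_istar: "gr (istar i j) = gr i + gr j"
proof -
  have "gr i + gr j \<in> gr ` idx"
    using assms inj_onD[OF gr_inj] by (auto simp: gr_image_idx grp_add_eq_0)
  then obtain k where k: "k \<in> idx" "gr k = gr i + gr j" by force
  with istar_eqI[OF k] show "istar i j \<in> idx" "gr (istar i j) = gr i + gr j" by auto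
qed

lemma istar_values:
  "istar 1 2 = 5" "istar 1 3 = 6" "istar 1 4 = 7" "istar 1 5 = 2" "istar 1 6 = 3" "istar 1 7 = 4"
  "istar 2 1 = 5" "istar 2 3 = 7" "istar 2 4 = 6" "istar 2 5 = 1" "istar 2 6 = 4" "istar 2 7 = 3"
  "istar 3 1 = 6" "istar 3 2 = 7" "istar 3 4 = 5" "istar 3 5 = 4" "istar 3 6 = 1" "istar 3 7 = 2"
  "istar 4 1 = 7" "istar 4 2 = 6" "istar 4 3 = 5" "istar 4 5 = 3" "istar 4 6 = 2" "istar 4 7 = 1"
  "istar 5 1 = 2" "istar 5 2 = 1" "istar 5 3 = 4" "istar 5 4 = 3" "istar 5 6 = 7" "istar 5 7 = 6"
  "istar 6 1 = 3" "istar 6 2 = 4" "istar 6 3 = 1" "istar 6 4 = 2" "istar 6 5 = 7" "istar 6 7 = 5"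
  "istar 7 1 = 4" "istar 7 2 = 3" "istar 7 3 = 2" "istar 7 4 = 1" "istar 7 5 = 6" "istar 7 6 = 5"
  by (rule istar_eqI; simp add: idx_def)+

text \<open>The place where \<open>octphase\<close> is matched with the seven oriented lines: all 64
  products of basis elements are compared.\<close>

lemma oct_basis_mult_eq:
  assumes "i \<in> {0..7}" "j \<in> {0..7}"
  shows "oct_basis_mult i j = octsign (gr i) (gr j) *s axis (gr i + gr j) 1"
proof -
  have "\<forall>i\<in>{0..7}. \<forall>j\<in>{0..7}. oct_basis_mult i j = octsign (gr i) (gr j) *s axis (gr i + gr j) 1"
    unfolding atLeast0_AtMost7
    by (simp add: oct_basis_mult_def oct_lines_def octsign_def octphase_def oct_basis_def istar_values Let_def
      del: One_nat_def)
  with assms show ?thesis by blast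
qed

text \<open>A twisted convolution: since every group element is its own inverse, the partner of
  \<open>h\<close> in degree \<open>k\<close> is \<open>h + k\<close>.\<close>

lemma oct_mult_nth: "oct_mult x y $ k = (\<Sum>h\<in>UNIV. octsign h (h + k) * x $ h * y $ (h + k))"
proof -
  define F where "F g h = (octsign g h * x $ g * y $ h) *s (axis (g + h) 1 :: oct)" for g h
  have "oct_mult x y = (\<Sum>i\<in>{0..7}. \<Sum>j\<in>{0..7}. F (gr i) (gr j))"
    unfolding oct_mult_def F_def
    by (intro sum.cong refl) (simp add: oct_basis_mult_eq vector_smult_assoc mult_ac)
  also have "\<dots> = (\<Sum>i\<in>{0..7}. \<Sum>h\<in>UNIV. F (gr i) h)"
    by (intro sum.cong refl sum.reindex_bij_betw[OF gr_bij])
  also have "\<dots> = (\<Sum>g\<in>UNIV. \<Sum>h\<in>UNIV. F g h)"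
    by (rule sum.reindex_bij_betw[OF gr_bij])
  finally have "oct_mult x y $ k = (\<Sum>g\<in>UNIV. \<Sum>h\<in>UNIV. F g h $ k)"
    by simp
  moreover have "F g h $ k = (if h = g + k then octsign g (g + k) * x $ g * y $ (g + k) else 0)" for g h
  proof -
    have "g + h = k \<longleftrightarrow> h = g + k"
      using grp_add_left by metis
    then show ?thesis by (auto simp: F_def axis_def)
  qed
  ultimately show ?thesis by simp
qed

section \<open>Homogeneous derivations\<close>

lemmas grp_ac = add.assoc add.commute add.left_commute grp_add_self grp_add_left

lemma oct_mult_left_diff: "oct_mult (x - y) z = oct_mult x z - oct_mult y z"
  by (simp add: vec_eq_iff oct_mult_nth algebra_simps sum_subtractf)

lemma oct_mult_right_diff: "oct_mult z (x - y) = oct_mult z x - oct_mult z y"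
  by (simp add: vec_eq_iff oct_mult_nth algebra_simps sum_subtractf)

lemma oct_mult_axis_right: "oct_mult x (axis m 1) $ k = octsign (k + m) m * x $ (k + m)"
proof -
  have "oct_mult x (axis m 1) $ k = (\<Sum>h\<in>UNIV. if h = k + m then octsign (k + m) m * x $ (k + m) else 0)"
    unfolding oct_mult_nth
  proof (intro sum.cong refl)
    fix h
    have "h + k = m \<longleftrightarrow> h = k + m"
      by (metis add.commute grp_add_left)
    then show "octsign h (h + k) * x $ h * axis m 1 $ (h + k) =
        (if h = k + m then octsign (k + m) m * x $ (k + m) else 0)"
      by (auto simp: axis_def)
  qed
  then show ?thesis by simp
qed

lemma oct_mult_axis_left: "oct_mult (axis m 1) x $ k = octsign m (m + k) * x $ (m + k)"
  by (simp add: oct_mult_nth axis_def if_distrib if_distribR cong: if_cong)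

lemma axis_nth_if: "axis i x $ j = (if j = i then x else 0)"
  by (simp add: axis_def)

lemma grp_add_eq_iff: "g + h = k \<longleftrightarrow> h = g + (k :: grp)"
  by (metis grp_add_left)

lemma oct_mult_axes: "oct_mult (axis h 1) (axis m 1) = octsign h m *s axis (h + m) 1"
  by (subst vec_eq_iff, rule allI)
     (simp add: oct_mult_axis_left axis_nth_if grp_add_eq_iff grp_add_left)

lemma vector_space_oct: "vector_space ((*s) :: complex \<Rightarrow> oct \<Rightarrow> oct)"
  by unfold_locales

lemma g2_carrier_linear: "d \<in> g2_carrier \<Longrightarrow> Vector_Spaces.linear (*s) (*s) d"
  by (simp add: g2_carrier_def)

lemma g2_carrier_leibniz:
  "d \<in> g2_carrier \<Longrightarrow> d (oct_mult x y) = oct_mult (d x) y + oct_mult x (d y)"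
  by (simp add: g2_carrier_def)

lemma g2_comp_carrier: "d \<in> g2_comp g \<Longrightarrow> d \<in> g2_carrier"
  by (simp add: g2_comp_def)

lemma linear_octI:
  assumes "\<And>x y. d (x + y) = d x + d y" "\<And>c x. d (c *s x) = c *s d x"
  shows "Vector_Spaces.linear (*s) (*s) (d :: oct_map)"
  using assms by (simp add: Vector_Spaces.linear_iff vector_space_oct)

lemma g2_carrierI:
  assumes "\<And>x y. d (x + y) = d x + d y" "\<And>c x. d (c *s x) = c *s d x"
    and "\<And>x y. d (oct_mult x y) = oct_mult (d x) y + oct_mult x (d y)"
  shows "d \<in> g2_carrier"
  using linear_octI[of d] assms by (simp add: g2_carrier_def)

context
  fixes d assumes d: "d \<in> g2_carrier"
begin

interpretation Vector_Spaces.linear "(*s)" "(*s)" d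
  by (rule g2_carrier_linear[OF d])

lemma g2_map_add: "d (x + y) = d x + d y"
  by (rule add)

lemma g2_map_scale: "d (c *s x) = c *s d x"
  by (rule scale)

lemma g2_map_zero: "d 0 = 0"
  by (rule zero)

end

lemma map_br_in_carrier:
  assumes "x \<in> g2_carrier" "y \<in> g2_carrier"
  shows "map_br x y \<in> g2_carrier"
  by (rule g2_carrierI)
     (simp_all add: map_br_def g2_map_add[OF assms(1)] g2_map_add[OF assms(2)]
       g2_map_scale[OF assms(1)] g2_map_scale[OF assms(2)] vec.scale_right_diff_distrib
       g2_carrier_leibniz[OF assms(1)] g2_carrier_leibniz[OF assms(2)]
       oct_mult_left_diff oct_mult_right_diff)

text \<open>The map \<open>e_h\<close> to \<open>c h\<close> times \<open>e_{g+h}\<close>. The body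
  is indexed by the target \<open>k\<close>, whose source is \<open>k + g\<close>.\<close>

definition homog :: "grp \<Rightarrow> (grp \<Rightarrow> complex) \<Rightarrow> oct_map" where
  "homog g c = (\<lambda>x. \<chi> k. c (k + g) * x $ (k + g))"

text \<open>The Leibniz rule on the product of \<open>e_h\<close> and \<open>e_m\<close>, read off
  at the coefficient of \<open>e_{g+h+m}\<close>.\<close>

definition leibniz_coeffs :: "grp \<Rightarrow> (grp \<Rightarrow> complex) \<Rightarrow> bool" where
  "leibniz_coeffs g c \<longleftrightarrow>
     (\<forall>h m. octsign h m * c (h + m) = octsign (h + g) m * c h + octsign h (m + g) * c m)"

lemma homog_axis: "homog g c (axis h 1) = c h *s axis (g + h) 1"
  by (subst vec_eq_iff, rule allI)
     (simp add: homog_def axis_nth_if add.commute[of _ g] grp_add_left grp_add_eq_iff[of g])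

lemma homog_in_carrier:
  assumes "leibniz_coeffs g c"
  shows "homog g c \<in> g2_carrier"
proof (rule g2_carrierI)
  fix x y :: oct
  show "homog g c (oct_mult x y) = oct_mult (homog g c x) y + oct_mult x (homog g c y)"
  proof (subst vec_eq_iff, rule allI)
    fix k
    have "homog g c (oct_mult x y) $ k =
        (\<Sum>h\<in>UNIV. octsign h (h + k + g) * c (k + g) * x $ h * y $ (h + k + g))"
      by (simp add: homog_def oct_mult_nth sum_distrib_left mult_ac add_ac)
    also have "\<dots> = (\<Sum>h\<in>UNIV. octsign (h + g) (h + k + g) * c h * x $ h * y $ (h + k + g)
        + octsign h (h + k) * x $ h * c (h + k + g) * y $ (h + k + g))"
    proof (intro sum.cong refl)
      fix h
      \<comment> \<open>The Leibniz identity with \<open>m = h + k + g\<close>, for which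
        \<open>h + m\<close> is the degree \<open>k + g\<close> feeding the coordinate
        \<open>k\<close>.\<close>
      have "octsign h (h + k + g) * c (h + (h + k + g)) =
          octsign (h + g) (h + k + g) * c h + octsign h (h + k + g + g) * c (h + k + g)"
        using assms unfolding leibniz_coeffs_def by blast
      then have "octsign h (h + k + g) * c (k + g) =
          octsign (h + g) (h + k + g) * c h + octsign h (h + k) * c (h + k + g)"
        by (simp add: add.assoc grp_add_self grp_add_left)
      then show "octsign h (h + k + g) * c (k + g) * x $ h * y $ (h + k + g) =
          octsign (h + g) (h + k + g) * c h * x $ h * y $ (h + k + g)
          + octsign h (h + k) * x $ h * c (h + k + g) * y $ (h + k + g)"
        by (simp add: algebra_simps)
    qed
    also have "\<dots> = (\<Sum>h\<in>UNIV. octsign (h + g) (h + k + g) * c h * x $ h * y $ (h + k + g))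
        + oct_mult x (homog g c y) $ k"
      by (simp add: sum.distrib oct_mult_nth homog_def mult_ac)
    \<comment> \<open>Translating the summation index by \<open>g\<close> puts the shift on the
      first factor, as in the coordinates of \<open>homog g c x\<close>.\<close>
    also have "(\<Sum>h\<in>UNIV. octsign (h + g) (h + k + g) * c h * x $ h * y $ (h + k + g))
        = (\<Sum>h\<in>UNIV. octsign h (h + k) * (c (h + g) * x $ (h + g)) * y $ (h + k))"
      by (rule sum.reindex_bij_witness[of _ "\<lambda>h. h + g" "\<lambda>h. h + g"])
         (simp_all add: add.assoc grp_add_self, simp_all add: add.commute[of g] add.assoc grp_add_self mult_ac)
    also have "\<dots> = oct_mult (homog g c x) y $ k"
      by (simp add: oct_mult_nth homog_def mult_ac)
    finally show "homog g c (oct_mult x y) $ k = (oct_mult (homog g c x) y + oct_mult x (homog g c y)) $ k"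
      by simp
  qed
qed (simp_all add: homog_def vec_eq_iff algebra_simps)

lemma homog_in_comp:
  assumes "leibniz_coeffs g c"
  shows "homog g c \<in> g2_comp g"
proof -
  have "homog g c (a *s axis h 1) \<in> oct_comp (g + h)" for a h
    using g2_map_scale[OF homog_in_carrier[OF assms]]
    by (auto simp: homog_axis oct_comp_def vector_smult_assoc)
  with homog_in_carrier[OF assms] show ?thesis
    by (auto simp: g2_comp_def oct_comp_def)
qed

text \<open>Here \<open>d\<close> is an arbitrary derivation: the coefficient at
  \<open>g + h + m\<close> of the Leibniz rule for two basis elements sees only its part of degree
  \<open>g\<close>. Hence the homogeneous parts of a derivation are again derivations.\<close>

lemma leibniz_coeffs_carrier:
  assumes "d \<in> g2_carrier"
  shows "leibniz_coeffs g (\<lambda>h. d (axis h 1) $ (g + h))"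
  unfolding leibniz_coeffs_def
proof (intro allI)
  fix h m
  have "d (oct_mult (axis h 1) (axis m 1)) $ (g + h + m) =
     (oct_mult (d (axis h 1)) (axis m 1) + oct_mult (axis h 1) (d (axis m 1))) $ (g + h + m)"
    by (simp add: g2_carrier_leibniz[OF assms])
  then show "octsign h m * d (axis (h + m) 1) $ (g + (h + m)) =
     octsign (h + g) m * d (axis h 1) $ (g + h) + octsign h (m + g) * d (axis m 1) $ (g + m)"
    by (simp add: oct_mult_axes g2_map_scale[OF assms] oct_mult_axis_left oct_mult_axis_right grp_ac)
qed

lemma map_proj_homog:
  assumes "d \<in> g2_carrier"
  shows "map_proj g d = homog g (\<lambda>h. d (axis h 1) $ (g + h))"
proof (rule ext, subst vec_eq_iff, rule allI)
  fix x k
  have "g + h = k \<longleftrightarrow> h = k + g" for h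
    by (metis add.commute grp_add_left)
  then have "oct_proj (g + h) (d (oct_proj h x)) $ k =
      (if h = k + g then d (axis (k + g) 1) $ k * x $ (k + g) else 0)" for h
    by (simp add: oct_proj_def g2_map_scale[OF assms] axis_nth_if add.commute[of k] grp_add_left)
  then show "map_proj g d x $ k = homog g (\<lambda>h. d (axis h 1) $ (g + h)) x $ k"
    by (simp add: map_proj_def homog_def add.commute[of _ g] grp_add_left)
qed

lemma map_proj_in_comp: "d \<in> g2_carrier \<Longrightarrow> map_proj g d \<in> g2_comp g"
  by (simp add: map_proj_homog homog_in_comp leibniz_coeffs_carrier)

lemma map_br_in_comp:
  assumes x: "x \<in> g2_comp g" and y: "y \<in> g2_comp h"
  shows "map_br x y \<in> g2_comp (g + h)"
proof -
  have diff: "u - v \<in> oct_comp k" if "u \<in> oct_comp k" "v \<in> oct_comp k" for u v k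
    using that unfolding oct_comp_def mem_Collect_eq by (metis vec.scale_left_diff_distrib)
  have "x (y v) \<in> oct_comp (g + h + k)" "y (x v) \<in> oct_comp (g + h + k)" if "v \<in> oct_comp k" for v k
    proof -
    have "y v \<in> oct_comp (h + k)" "x v \<in> oct_comp (g + k)"
      using x y that by (simp_all add: g2_comp_def)
    then have "x (y v) \<in> oct_comp (g + (h + k))" "y (x v) \<in> oct_comp (h + (g + k))"
      using x y by (simp_all add: g2_comp_def)
    then show "x (y v) \<in> oct_comp (g + h + k)" "y (x v) \<in> oct_comp (g + h + k)"
      by (simp_all add: add.assoc add.left_commute)
  qed
  then show ?thesis
    using map_br_in_carrier[OF g2_comp_carrier[OF x] g2_comp_carrier[OF y]]
    unfolding g2_comp_def map_br_def by (blast intro: diff)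
qed

text \<open>A derivation of degree \<open>g\<close> sends \<open>e\<^sub>h\<close> to \<open>coord g d h\<close> times \<open>e\<^sub>g e\<^sub>h\<close>.\<close>

definition coord :: "grp \<Rightarrow> oct_map \<Rightarrow> grp \<Rightarrow> complex" where
  "coord g d h = octsign g h * d (axis h 1) $ (g + h)"

text \<open>Functions on the cosets of \<open>{0, g}\<close>. In the last condition
  \<open>h\<close>, \<open>k\<close>, \<open>h + k\<close> represent the three cosets other than
  \<open>{0, g}\<close>, that is, the three lines through \<open>g\<close>.\<close>

definition weights :: "grp \<Rightarrow> (grp \<Rightarrow> complex) \<Rightarrow> bool" where
  "weights g a \<longleftrightarrow> a 0 = 0 \<and> a g = 0 \<and> (\<forall>h. a (g + h) = a h) \<and>
     (\<forall>h k. indep g h k \<longrightarrow> a h + a k + a (h + k) = 0)"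

section \<open>Homogeneous derivations correspond to weights\<close>

lemma octsign_cancel: "octsign g h * (octsign g h * c) = c"
  by (simp add: mult.assoc[symmetric] octsign_sq)

lemma octsign_nonzero: "octsign g h \<noteq> 0"
  using octsign_sq[of g h] by auto

lemma comp_homog:
  assumes "d \<in> g2_comp g"
  shows "d = homog g (\<lambda>h. octsign g h * coord g d h)"
  using map_proj_comp[OF assms, of g] map_proj_homog[OF g2_comp_carrier[OF assms]]
  by (simp add: coord_def octsign_cancel)

lemma comp_axis:
  assumes "d \<in> g2_comp g"
  shows "d (axis h 1) = (octsign g h * coord g d h) *s axis (g + h) 1"
  using comp_homog[OF assms] homog_axis by metis

lemma indep_swap: "indep g h k \<Longrightarrow> indep g k h" "indep g h k \<Longrightarrow> indep h g k"
  unfolding indep_def by (metis add.commute grp_add_left)+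

text \<open>If \<open>g\<close>, \<open>h\<close>, \<open>m\<close> are independent, the three sign
  products in the Leibniz rule agree up to sign and it collapses to
  \<open>a h + a m + a (h + m) = 0\<close>. The dependent triples are settled by the vanishing and
  invariance of \<open>a\<close>, with alternativity and anticommutativity of the signs.\<close>

lemma weights_leibniz:
  assumes "g \<noteq> 0" and a: "weights g a"
  shows "leibniz_coeffs g (\<lambda>h. octsign g h * a h)"
  unfolding leibniz_coeffs_def
proof (intro allI)
  fix h m
  have a0: "a 0 = 0" "a g = 0" "\<And>h. a (g + h) = a h"
    using a by (auto simp: weights_def)
  consider "h = 0" | "m = 0" | "h = g" | "m = g" | "h = m" "h \<noteq> 0" "h \<noteq> g"
    | "m = g + h" "h \<noteq> 0" "h \<noteq> g" | "indep g h m"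
    using assms(1) unfolding indep_def by blast
  then show "octsign h m * (octsign g (h + m) * a (h + m)) =
      octsign (h + g) m * (octsign g h * a h) + octsign h (m + g) * (octsign g m * a m)"
  proof cases
    case 4
    show ?thesis
    proof (cases "h = 0 \<or> h = g")
      case False
      then have "octsign h g = - octsign g h"
        using octsign_swap assms(1) by blast
      moreover have "octsign (h + g) g = - octsign h g" "octsign g (g + h) = - octsign g h"
        using assms(1) by (rule octsign_right_alternative octsign_left_alternative)+
      moreover have "a (h + g) = a h"
        by (metis a0(3) add.commute)
      ultimately show ?thesis
        using 4 by (simp add: a0 add.commute[of h])
    qed (use 4 in \<open>auto simp: a0 octsign_zero grp_add_self\<close>)
  next
    case 5
    have "octsign (h + g) h = - octsign h (h + g)"
      using 5 assms(1) by (intro octsign_swap) (auto simp: grp_add_eq_0)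
    then show ?thesis using 5 by (simp add: a0 grp_add_self)
  next
    case 6
    have "octsign (h + g) (h + g) = - 1" "octsign h h = - 1" "octsign g (g + h) = - octsign g h"
      using 6 assms(1) by (auto intro!: octsign_self octsign_left_alternative simp: grp_add_eq_0)
    moreover have m: "h + (g + h) = g" "g + h + g = h"
      by (simp_all add: grp_ac)
    ultimately show ?thesis
      unfolding 6(1) m by (simp add: a0 add.commute[of h])
  next
    case 7
    have "a (h + m) = - a h - a m"
      using a 7 unfolding weights_def by (metis add.commute add_diff_cancel_left' diff_0 diff_diff_eq)
    moreover have "octsign g (h + m) * octsign h m = - (octsign (g + h) m * octsign g h)"
      by (rule octsign_antiassoc[OF 7])
    \<comment> \<open>The sign from \<open>e_h (e_g e_m) = - (e_h e_g) e_m\<close> cancels against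
      the one from \<open>e_h e_g = - e_g e_h\<close>.\<close>
    moreover have "octsign h (m + g) * octsign g m = octsign (g + h) m * octsign g h"
      using octsign_antiassoc[OF indep_swap(2)[OF 7]] octsign_swap[of h g] 7
      by (auto simp: indep_def add.commute[of h] add.commute[of m])
    moreover have "octsign h m * (octsign g (h + m) * (- p - q)) = s * p + t * q"
      if "octsign g (h + m) * octsign h m = - s" "t = s" for p q s t
    proof -
      have "octsign h m * (octsign g (h + m) * (- p - q)) = (octsign g (h + m) * octsign h m) * (- p - q)"
        by (simp only: mult_ac)
      then show ?thesis using that by (simp add: algebra_simps)
    qed
    ultimately show ?thesis by (simp add: mult.assoc[symmetric] add.commute[of h g])
  qed (simp_all add: a0 octsign_zero grp_add_self grp_add_left add.commute[of _ g])
qed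

text \<open>Each condition is one instance of the Leibniz identity: the pairs \<open>(0, 0)\<close>,
  \<open>(g, g)\<close> and \<open>(g, h)\<close> give the two zeros and the invariance, an
  independent pair gives the sum.\<close>

lemma leibniz_weights:
  assumes "g \<noteq> 0" and L: "leibniz_coeffs g (\<lambda>h. octsign g h * a h)"
  shows "weights g a"
proof -
  have E: "octsign h m * (octsign g (h + m) * a (h + m)) =
      octsign (h + g) m * (octsign g h * a h) + octsign h (m + g) * (octsign g m * a m)" for h m
    using L unfolding leibniz_coeffs_def by blast
  have a0: "a 0 = 0"
    using E[of 0 0] by (simp add: octsign_zero)
  have ag: "a g = 0"
    using E[of g g] assms(1) by (simp add: octsign_zero grp_add_self a0 octsign_self)
  have shift: "a (g + h) = a h" for h
    using E[of g h] by (simp add: a0 ag octsign_nonzero mult.left_commute add.commute[of h])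
  have "a h + a k + a (h + k) = 0" if i: "indep g h k" for h k
  proof -
    define s where "s = octsign (g + h) k * octsign g h"
    have s: "octsign g (h + k) * octsign h k = - s"
      unfolding s_def by (rule octsign_antiassoc[OF i])
    have t: "octsign h (k + g) * octsign g k = s"
      using octsign_antiassoc[OF indep_swap(2)[OF i]] octsign_swap[of h g] i
      by (auto simp: indep_def add.commute[of h] add.commute[of k] s_def)
    have "(octsign g (h + k) * octsign h k) * a (h + k) =
        s * a h + (octsign h (k + g) * octsign g k) * a k"
      using E[of h k] by (simp add: s_def mult_ac add.commute[of h g])
    then have "s * (a h + a k + a (h + k)) = 0"
      unfolding s t by algebra
    moreover have "s \<noteq> 0"
      by (simp add: s_def octsign_nonzero)
    ultimately show ?thesis by simp
  qed
  with a0 ag shift show ?thesis by (auto simp: weights_def)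
qed

text \<open>In degree 0 all signs cancel and the coefficients form a homomorphism from a group of
  exponent 2 to the additive complex numbers, which is zero.\<close>

lemma comp_zero: "g2_comp 0 = {0}"
proof
  show "g2_comp 0 \<subseteq> {0}"
  proof
    fix d assume d: "d \<in> g2_comp 0"
    define c where "c h = d (axis h 1) $ (0 + h)" for h
    have E: "octsign h m * c (h + m) = octsign h m * c h + octsign h m * c m" for h m
      using leibniz_coeffs_carrier[OF g2_comp_carrier[OF d], of 0]
      unfolding leibniz_coeffs_def c_def[symmetric] by simp
    have "c 0 = 0" using E[of 0 0] by (simp add: octsign_zero)
    then have "c h = 0" for h
      using E[of h h] by (simp add: grp_add_self octsign_nonzero)
    moreover have "d = homog 0 c"
      using map_proj_comp[OF d, of 0] map_proj_homog[OF g2_comp_carrier[OF d], of 0]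
      by (simp add: c_def[abs_def])
    ultimately show "d \<in> {0}"
      by (simp add: homog_def fun_eq_iff vec_eq_iff)
  qed
  have "homog 0 (\<lambda>_. 0) \<in> g2_comp 0"
    by (rule homog_in_comp) (simp add: leibniz_coeffs_def)
  moreover have "homog 0 (\<lambda>_. 0) = 0"
    by (simp add: homog_def fun_eq_iff vec_eq_iff)
  ultimately show "{0} \<subseteq> g2_comp 0" by simp
qed

lemma coord_weights:
  assumes "g \<noteq> 0" "d \<in> g2_comp g"
  shows "weights g (coord g d)"
  by (rule leibniz_weights[OF assms(1)])
     (use leibniz_coeffs_carrier[OF g2_comp_carrier[OF assms(2)], of g] in
       \<open>simp add: coord_def octsign_cancel\<close>)

lemma comp_with_coord:
  assumes "g \<noteq> 0" "weights g a"
  obtains d where "d \<in> g2_comp g" "coord g d = a"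
proof
  show "homog g (\<lambda>h. octsign g h * a h) \<in> g2_comp g"
    by (rule homog_in_comp[OF weights_leibniz[OF assms]])
  show "coord g (homog g (\<lambda>h. octsign g h * a h)) = a"
    by (simp add: fun_eq_iff coord_def homog_axis octsign_cancel)
qed

lemma comp_eqI:
  assumes "x \<in> g2_comp g" "y \<in> g2_comp g" "coord g x = coord g y"
  shows "x = y"
  using comp_homog[OF assms(1)] comp_homog[OF assms(2)] assms(3) by simp

lemma coord_simps [simp]:
  "coord g (x + y) h = coord g x h + coord g y h"
  "coord g (map_scale c x) h = c * coord g x h"
  "coord g 0 h = 0"
  by (simp_all add: coord_def map_scale_def algebra_simps)

section \<open>The bracket in the coordinates of a line\<close>

context
  fixes x y g k
  assumes g: "g \<noteq> 0" and k: "k \<noteq> 0" and ne: "g \<noteq> k"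
    and x: "x \<in> g2_comp g" and y: "y \<in> g2_comp k"
begin

lemma coord_map_br:
  "coord (g + k) (map_br x y) h = octsign (g + k) h *
     (octsign g (k + h) * octsign k h * (coord g x (k + h) * coord k y h)
      - octsign k (g + h) * octsign g h * (coord g x h * coord k y (g + h)))"
proof -
  have "x (y (axis h 1)) = (octsign g (k + h) * octsign k h * (coord g x (k + h) * coord k y h)) *s axis (g + k + h) 1"
    by (simp add: comp_axis[OF x] comp_axis[OF y] g2_map_scale[OF g2_comp_carrier[OF x]]
       vector_smult_assoc mult_ac add.assoc)
  moreover have "y (x (axis h 1)) = (octsign k (g + h) * octsign g h * (coord g x h * coord k y (g + h))) *s axis (g + k + h) 1"
    by (simp add: comp_axis[OF x] comp_axis[OF y] g2_map_scale[OF g2_comp_carrier[OF y]]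
       vector_smult_assoc mult_ac add.left_commute add.assoc)
  ultimately show ?thesis
    by (simp add: coord_def map_br_def)
qed

text \<open>Only one of the two terms of the commutator survives, since \<open>coord g x\<close>
  vanishes at \<open>g\<close>; this is the product of the \<open>u\<close> coordinates.\<close>

lemma coord_map_br_line:
  "coord (g + k) (map_br x y) g = octsign g k * (coord g x k * coord k y g)"
proof -
  have "octsign (g + k) g = - octsign k g" "octsign g (k + g) = - octsign g k"
    using octsign_right_alternative[OF g, of k] octsign_left_alternative[OF g, of k]
    by (simp_all add: add.commute)
  moreover have "coord g x g = 0" "coord g x (k + g) = coord g x k"
    using coord_weights[OF g x] by (simp_all add: weights_def add.commute[of k])
  moreover have "octsign k g * (s * octsign k g * c) = s * c" for s c
    by (metis mult.left_commute mult.assoc octsign_cancel)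
  ultimately show ?thesis
    by (simp add: coord_map_br)
qed

text \<open>By anti-associativity the two sign products of the commutator are opposite, so its
  difference turns into a sum.\<close>

lemma coord_map_br_off:
  assumes i: "indep g k h"
  shows "coord (g + k) (map_br x y) h =
    - octsign g k * (coord g x (k + h) * coord k y h + coord g x h * coord k y (g + h))"
proof -
  have "octsign g (k + h) * octsign k h = - (octsign (g + k) h * octsign g k)"
    by (rule octsign_antiassoc[OF i])
  moreover have "octsign k (g + h) * octsign g h = octsign (g + k) h * octsign g k"
    using octsign_antiassoc[OF indep_swap(2)[OF i]] octsign_swap[OF g k ne]
    by (simp add: add.commute)
  ultimately show ?thesis
    unfolding coord_map_br by (simp add: algebra_simps octsign_cancel)
qed

text \<open>Replacing \<open>h\<close> by \<open>g + h\<close> exchanges the two values of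
  \<open>y\<close> and keeps those of \<open>x\<close>, so the difference of the two sums factors;
  this is the product of the \<open>v\<close> coordinates.\<close>

lemma coord_diff_map_br:
  assumes i: "indep g k h"
  shows "coord (g + k) (map_br x y) h - coord (g + k) (map_br x y) (g + h) =
    octsign g k * ((coord g x h - coord g x (k + h)) * (coord k y h - coord k y (g + h)))"
proof -
  have i': "indep g k (g + h)"
    using i unfolding indep_def by (metis add.commute grp_add_left grp_add_eq_0)
  have "coord g x (g + h) = coord g x h" "coord g x (k + (g + h)) = coord g x (k + h)"
    using coord_weights[OF g x] unfolding weights_def by (metis add.left_commute)+
  then show ?thesis
    by (simp add: coord_map_br_off[OF i] coord_map_br_off[OF i'] grp_add_left algebra_simps)
qed

end

lemma indep_distinct:
  assumes "indep g k h"
  shows "distinct [0, g, k, g + k, h, g + h, k + h, g + k + h]"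
proof -
  have *: "g \<noteq> 0" "k \<noteq> 0" "h \<noteq> 0" "g \<noteq> k" "g \<noteq> h" "k \<noteq> h"
    "g + k \<noteq> h" "g + h \<noteq> k" "k + h \<noteq> g"
    using assms unfolding indep_def by (metis add.commute grp_add_left)+
  moreover have "g + k \<noteq> 0" "g + h \<noteq> 0" "k + h \<noteq> 0" "g + (k + h) \<noteq> 0"
    using * by (simp_all add: grp_add_eq_0)
  ultimately show ?thesis
    by (simp add: add.assoc *[symmetric])
qed

text \<open>An independent triple is a basis: its eight subset sums are distinct, hence all of the
  group.\<close>

lemma indep_cases:
  assumes "indep g k h"
  shows "m \<in> {0, g, k, g + k, h, g + h, k + h, g + k + h}"
proof -
  have "card (set [0, g, k, g + k, h, g + h, k + h, g + k + h]) = card (UNIV :: grp set)"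
    unfolding distinct_card[OF indep_distinct[OF assms]] bij_betw_same_card[OF gr_bij, symmetric] by simp
  then have "set [0, g, k, g + k, h, g + h, k + h, g + k + h] = UNIV"
    by (intro card_subset_eq) auto
  then show ?thesis by auto
qed

section \<open>Brackets of homogeneous components\<close>

lemma indep_third:
  assumes "g \<noteq> 0" "k \<noteq> 0" "g \<noteq> k"
  obtains h where "indep g k h"
proof -
  have "card {0, g, k, g + k} < card (UNIV :: grp set)"
    unfolding bij_betw_same_card[OF gr_bij, symmetric]
    by (rule le_less_trans[OF card_length[of "[0, g, k, g + k]", simplified]]) simp
  then have "{0, g, k, g + k} \<noteq> UNIV" by force
  then obtain h where "h \<notin> {0, g, k, g + k}" by blast
  with assms have "indep g k h" by (auto simp: indep_def)
  then show thesis by (rule that)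
qed

lemma indep_extend:
  assumes "g \<noteq> 0"
  obtains k h where "indep g k h"
proof -
  have "card {0, g} < card (UNIV :: grp set)"
    unfolding bij_betw_same_card[OF gr_bij, symmetric]
    by (rule le_less_trans[OF card_length[of "[0, g]", simplified]]) simp
  then have "{0, g} \<noteq> UNIV" by force
  then obtain k where "k \<noteq> 0" "g \<noteq> k" by blast
  from indep_third[OF assms this] that show thesis by blast
qed

lemma indep_nonzero:
  assumes "indep g k h"
  shows "g \<noteq> 0" "k \<noteq> 0" "h \<noteq> 0" "g \<noteq> k" "g \<noteq> h" "k \<noteq> h" 
    "g + k \<noteq> 0" "g + h \<noteq> 0" "k + h \<noteq> 0" "g + k \<noteq> h" "k + h \<noteq> g" "g + h \<noteq> k"
  using assms unfolding indep_def by (metis add.commute grp_add_left grp_add_eq_0)+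

lemma indep_line:
  assumes "indep g k h"
  shows "indep g (g + k) h" "indep (g + k) g h" "indep (g + k) k h" "indep g k (g + h)"
    "indep g (k + h) h"
  using indep_nonzero[OF assms] by (auto simp: indep_def grp_ac)

lemma weightsD:
  assumes "weights g a"
  shows "a 0 = 0" "a g = 0" "a (g + h) = a h" "indep g h k \<Longrightarrow> a h + a k + a (h + k) = 0"
  using assms by (auto simp: weights_def)

lemma weights_solve:
  assumes "weights g a" "indep g k h"
  shows "a h = (a h - a (k + h) - a k) / 2" "a (k + h) = - (a h - a (k + h) + a k) / 2"
  using weightsD(4)[OF assms] by (simp_all add: field_simps)

lemma weights_eqI:
  assumes a: "weights g a" and b: "weights g b" and i: "indep g k h"
    and eq: "a k = b k" "a h - a (k + h) = b h - b (k + h)"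
  shows "a = b"
proof
  fix m
  have "a h = b h" "a (k + h) = b (k + h)"
    using weights_solve[OF a i] weights_solve[OF b i] eq by simp_all
  moreover have "a (g + l) = a l" "b (g + l) = b l" for l
    using a b by (simp_all add: weightsD)
  ultimately show "a m = b m"
    using indep_cases[OF i, of m] eq(1) weightsD(1,2)[OF a] weightsD(1,2)[OF b]
    by (elim insertE emptyE) (simp_all add: add.assoc)
qed

lemma weights_exists:
  assumes i: "indep g k h"
  obtains a where "weights g a" "a k = u" "a h - a (k + h) = v"
proof -
  \<comment> \<open>The solution of \<open>u + p + q = 0\<close> and
    \<open>p - q = v\<close>.\<close>
  define p q where "p = (v - u) / 2" and "q = - (v + u) / 2"
  define a where "a m = (if m = k \<or> m = g + k then u else if m = h \<or> m = g + h then p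
    else if m = k + h \<or> m = g + k + h then q else 0)" for m
  note d = indep_distinct[OF i, simplified]
  have vals: "a 0 = 0" "a g = 0" "a k = u" "a (g + k) = u" "a h = p" "a (g + h) = p"
    "a (k + h) = q" "a (g + k + h) = q"
    using d unfolding a_def by (auto simp: add.assoc)
  have sum: "u + p + q = 0"
    by (simp add: p_def q_def field_simps)
  then have sum': "u + q + p = 0" "p + u + q = 0" "p + q + u = 0" "q + u + p = 0" "q + p + u = 0"
    by (simp_all add: ac_simps)
  have "weights g a"
    unfolding weights_def
  proof (intro conjI allI impI)
    show "a (g + m) = a m" for m
      using indep_cases[OF i, of m] vals
      by (elim insertE emptyE) (simp_all add: grp_add_left add.assoc grp_add_self)
    fix m n assume mn: "indep g m n"
    show "a m + a n + a (m + n) = 0"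
      using indep_cases[OF i, of m] indep_cases[OF i, of n] indep_nonzero[OF mn] vals sum sum'
      by (elim insertE emptyE) (simp_all add: grp_ac)
  qed (simp_all add: vals)
  moreover have "a h - a (k + h) = v"
    unfolding vals p_def q_def by (simp add: field_simps)
  ultimately show thesis using that vals(3) by blast
qed

lemma comp_exists:
  assumes i: "indep g k h"
  obtains x where "x \<in> g2_comp g" "coord g x k = u" "coord g x h - coord g x (k + h) = v"
proof -
  from weights_exists[OF i] obtain a where a: "weights g a" "a k = u" "a h - a (k + h) = v" .
  from comp_with_coord[OF indep_nonzero(1)[OF i] a(1)] obtain d where "d \<in> g2_comp g" "coord g d = a" .
  with a that show thesis by blast
qed

lemma comp_eqI_line:
  assumes i: "indep g k h" and x: "x \<in> g2_comp g" and y: "y \<in> g2_comp g"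
    and "coord g x k = coord g y k"
    and "coord g x h - coord g x (k + h) = coord g y h - coord g y (k + h)"
  shows "x = y"
  using weights_eqI[OF coord_weights[OF indep_nonzero(1)[OF i] x] coord_weights[OF indep_nonzero(1)[OF i] y] i]
    comp_eqI[OF x y] assms(4,5) by simp

lemma zero_in_comp: "0 \<in> g2_comp g"
proof -
  have "homog g (\<lambda>_. 0) \<in> g2_comp g"
    by (rule homog_in_comp) (simp add: leibniz_coeffs_def)
  moreover have "homog g (\<lambda>_. 0) = 0"
    by (simp add: homog_def fun_eq_iff vec_eq_iff)
  ultimately show ?thesis by simp
qed

lemma comp_zeroI:
  assumes "indep g k h" "x \<in> g2_comp g" "coord g x k = 0" "coord g x h - coord g x (k + h) = 0"
  shows "x = 0"
  by (rule comp_eqI_line[OF assms(1,2) zero_in_comp]) (simp_all add: assms(3,4))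

text \<open>Bracketing with \<open>x\<close> multiplies the two coordinates of \<open>y\<close> by
  those of \<open>x\<close>, up to a common sign, so \<open>y\<close> is found by division. The sign
  is its own inverse and therefore appears as a factor.\<close>

lemma map_br_onto:
  assumes i: "indep g k h" and x: "x \<in> g2_comp g"
    and U: "coord g x k \<noteq> 0" and V: "coord g x h - coord g x (k + h) \<noteq> 0"
    and z: "z \<in> g2_comp (g + k)"
  obtains y where "y \<in> g2_comp k" "map_br x y = z"
proof -
  note n = indep_nonzero[OF i]
  from comp_exists[OF indep_swap(2)[OF i]] obtain y where y: "y \<in> g2_comp k"
    "coord k y g = octsign g k * coord (g + k) z g / coord g x k"
    "coord k y h - coord k y (g + h) = octsign g k * (coord (g + k) z h - coord (g + k) z (g + h))
       / (coord g x h - coord g x (k + h))" .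
  have "map_br x y = z"
  proof (rule comp_eqI_line[OF indep_line(2)[OF i] map_br_in_comp[OF x y(1)] z])
    show "coord (g + k) (map_br x y) g = coord (g + k) z g"
      by (simp add: coord_map_br_line[OF n(1,2,4) x y(1)] y(2) U octsign_cancel)
    show "coord (g + k) (map_br x y) h - coord (g + k) (map_br x y) (g + h) =
        coord (g + k) z h - coord (g + k) z (g + h)"
      unfolding coord_diff_map_br[OF n(1,2,4) x y(1) i] y(3) using V by (simp add: octsign_cancel)
  qed
  with y(1) that show thesis by blast
qed

text \<open>The element with \<open>u = v = 1\<close> serves for all \<open>z\<close> at
  once.\<close>

lemma map_br_generic:
  assumes "g \<noteq> 0" "k \<noteq> 0" "g \<noteq> k"
  obtains x where "x \<in> g2_comp g" "\<And>z. z \<in> g2_comp (g + k) \<Longrightarrow> \<exists>y\<in>g2_comp k. map_br x y = z"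
proof -
  from indep_third[OF assms] obtain h where i: "indep g k h" .
  from comp_exists[OF i] obtain x where
    x: "x \<in> g2_comp g" "coord g x k = 1" "coord g x h - coord g x (k + h) = 1" .
  show thesis
    by (rule that[OF x(1)]) (use map_br_onto[OF i x(1)] x(2,3) in auto)
qed

text \<open>The single test element \<open>y\<close> with \<open>u = v = 1\<close> already returns
  both coordinates of \<open>x\<close>, up to sign.\<close>

lemma map_br_nondegenerate:
  assumes "g \<noteq> 0" "k \<noteq> 0" "g \<noteq> k" and x: "x \<in> g2_comp g"
    and zero: "\<And>y. y \<in> g2_comp k \<Longrightarrow> map_br x y = 0"
  shows "x = 0"
proof -
  from indep_third[OF assms(1-3)] obtain h where i: "indep g k h" .
  from comp_exists[OF indep_swap(2)[OF i]] obtain y where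
    y: "y \<in> g2_comp k" "coord k y g = 1" "coord k y h - coord k y (g + h) = 1" .
  show ?thesis
    using coord_map_br_line[OF assms(1-3) x y(1)] coord_diff_map_br[OF assms(1-3) x y(1) i]
    by (intro comp_zeroI[OF i x]) (simp_all add: zero[OF y(1)] y(2,3) octsign_nonzero)
qed

text \<open>Supplies the two conditions of \<open>map_br_onto\<close> for a prescribed element, by
  changing the line through \<open>g\<close>. The pairs \<open>(k, h)\<close>, \<open>(h, k)\<close>
  and \<open>(k + h, h)\<close> single out the three lines in turn.\<close>

lemma comp_regular_line:
  assumes "g \<noteq> 0" and z: "z \<in> g2_comp g" "z \<noteq> 0"
  obtains k h where "indep g k h" "coord g z k \<noteq> 0" "coord g z h - coord g z (k + h) \<noteq> 0"
proof -
  from indep_extend[OF assms(1)] obtain k h where i: "indep g k h" .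
  note i2 = indep_swap(1)[OF i] and i3 = indep_line(5)[OF i]
  have sum: "coord g z k + coord g z h + coord g z (k + h) = 0"
    using weightsD(4)[OF coord_weights[OF assms(1) z(1)] i] .
  have kh: "k + h + h = k" by (simp add: grp_ac)
  show thesis
  proof (rule ccontr)
    assume "\<not> thesis"
    then have 1: "coord g z k = 0 \<or> coord g z h - coord g z (k + h) = 0"
      and 2: "coord g z h = 0 \<or> coord g z k - coord g z (h + k) = 0"
      and 3: "coord g z (k + h) = 0 \<or> coord g z h - coord g z (k + h + h) = 0"
      using that[OF i] that[OF i2] that[OF i3] by blast+
    \<comment> \<open>If no value vanishes, all three are equal and their sum is
      \<open>3 * c\<close>; if one vanishes, the other two are opposite and another of the
      conditions makes them zero.\<close>
    have "a = 0 \<and> b - c = 0" if "a + b + c = 0" "a = 0 \<or> b - c = 0" "b = 0 \<or> a - c = 0" "c = 0 \<or> b - a = 0"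
      for a b c :: complex
    proof -
      have "c + c + c = 3 * c" by simp
      then show ?thesis using that by auto
    qed
    from this[OF sum 1 2[unfolded add.commute[of h]] 3[unfolded kh]]
    have "z = 0"
      by (intro comp_zeroI[OF i z(1)]) simp_all
    with z(2) show False by simp
  qed
qed

text \<open>Again the element with \<open>u = v = 1\<close>, whose bracket preserves both
  coordinates up to sign.\<close>

lemma map_br_injective:
  assumes "g \<noteq> 0" "k \<noteq> 0" "g \<noteq> k"
  obtains x where "x \<in> g2_comp g" "\<forall>z\<in>g2_comp k. map_br x z = 0 \<longrightarrow> z = 0"
proof -
  from indep_third[OF assms] obtain h where i: "indep g k h" .
  from comp_exists[OF i] obtain x where
    x: "x \<in> g2_comp g" "coord g x k = 1" "coord g x h - coord g x (k + h) = 1" .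
  have "z = 0" if z: "z \<in> g2_comp k" "map_br x z = 0" for z
    using coord_map_br_line[OF assms x(1) z(1)] coord_diff_map_br[OF assms x(1) z(1) i]
    by (intro comp_zeroI[OF indep_swap(2)[OF i] z(1)]) (simp_all add: z(2) x(2,3) octsign_nonzero)
  with x(1) that show thesis by blast
qed

section \<open>Graded contractions\<close>

lemma vector_space_map_scale: "vector_space map_scale"
  by unfold_locales (simp_all add: map_scale_def fun_eq_iff vec.scale_right_distrib
    vec.scale_left_distrib vector_smult_assoc)

interpretation maps: vector_space map_scale
  by (rule vector_space_map_scale)

lemma g2_contr_simps [simp]:
  "lie_carrier (g2_contr \<epsilon>) = g2_carrier" "lie_scale (g2_contr \<epsilon>) = map_scale"
  "lie_br (g2_contr \<epsilon>) = contr_br \<epsilon>"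
  by (simp_all add: g2_contr_def g2_def)

lemma map_proj_add: "map_proj g (x + y) = map_proj g x + map_proj g y"
  by (simp add: map_proj_def oct_proj_def vec.scale_left_distrib sum.distrib fun_eq_iff)

lemma map_proj_scale: "map_proj g (map_scale c x) = map_scale c (map_proj g x)"
  by (simp add: map_proj_def map_scale_def oct_proj_def vec.scale_sum_right vector_smult_assoc fun_eq_iff)

lemma map_proj_zero: "map_proj g 0 = 0"
  by (simp add: map_proj_def oct_proj_def fun_eq_iff)

lemma map_proj_setsum: "map_proj g (sum f A) = (\<Sum>a\<in>A. map_proj g (f a))"
  by (induction A rule: infinite_finite_induct)
     (simp_all only: sum.infinite sum.empty sum.insert map_proj_add map_proj_zero not_False_eq_True)

lemma map_proj_diff: "map_proj g (x - y) = map_proj g x - map_proj g y"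
  using map_proj_add[of g "x - y" y] by (simp only: diff_add_cancel eq_diff_eq)

lemma gr_eq_iff: "i \<in> idx \<Longrightarrow> j \<in> idx \<Longrightarrow> gr i = gr j \<longleftrightarrow> i = j"
  using gr_inj by (simp add: inj_on_eq_iff)

lemma map_proj_degree_zero: "d \<in> g2_carrier \<Longrightarrow> map_proj 0 d = 0"
  using map_proj_in_comp[of d 0] by (simp add: comp_zero)

lemma carrier_decomposition:
  assumes "d \<in> g2_carrier"
  shows "(\<Sum>i\<in>idx. map_proj (gr i) d) = d"
proof -
  have "(\<Sum>i\<in>idx. map_proj (gr i) d) = (\<Sum>g\<in>-{0}. map_proj g d)"
    using gr_inj gr_image_idx by (intro sum.reindex_bij_betw) (simp add: bij_betw_def)
  also have "\<dots> = (\<Sum>g\<in>UNIV. map_proj g d)"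
    by (rule sum.mono_neutral_left) (simp_all add: map_proj_degree_zero[OF assms])
  also have "\<dots> = d"
    by (rule map_proj_sum[OF g2_carrier_linear[OF assms]])
  finally show ?thesis .
qed

lemma finite_idx [simp]: "finite idx"
  by (simp add: idx_def)

section \<open>Sums of components: membership, bases and dimension\<close>

lemma subspace_g2_carrier: "maps.subspace g2_carrier"
proof (rule maps.subspaceI)
  have lin: "oct_mult (x + y) z = oct_mult x z + oct_mult y z"
    "oct_mult z (x + y) = oct_mult z x + oct_mult z y"
    "oct_mult (c *s x) z = c *s oct_mult x z" "oct_mult z (c *s x) = c *s oct_mult z x" for c x y z
    by (simp_all add: vec_eq_iff oct_mult_nth algebra_simps sum.distrib sum_distrib_left)
  show "0 \<in> g2_carrier"
    using zero_in_comp g2_comp_carrier by blast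
  show "x + y \<in> g2_carrier" if x: "x \<in> g2_carrier" and y: "y \<in> g2_carrier" for x y
    by (rule g2_carrierI) (simp_all add: g2_map_add[OF x] g2_map_add[OF y] g2_map_scale[OF x]
      g2_map_scale[OF y] g2_carrier_leibniz[OF x] g2_carrier_leibniz[OF y] lin vec.scale_right_distrib)
  show "map_scale c x \<in> g2_carrier" if x: "x \<in> g2_carrier" for c x
    by (rule g2_carrierI) (simp_all add: map_scale_def g2_map_add[OF x] g2_map_scale[OF x]
      g2_carrier_leibniz[OF x] lin vec.scale_right_distrib vector_smult_assoc mult.commute)
qed

text \<open>Membership as the vanishing of projections, which makes closure, inclusions and
  intersections of such sums immediate.\<close>

lemma g2_sum_iff:
  assumes "J \<subseteq> idx"
  shows "d \<in> g2_sum J \<longleftrightarrow> d \<in> g2_carrier \<and> (\<forall>i\<in>idx - J. map_proj (gr i) d = 0)"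
proof
  assume "d \<in> g2_sum J"
  then obtain x where d: "d = (\<Sum>i\<in>J. x i)" and x: "\<And>i. i \<in> J \<Longrightarrow> x i \<in> g2_comp (gr i)"
    by (auto simp: g2_sum_def)
  have "map_proj (gr j) d = 0" if "j \<in> idx - J" for j
  proof -
    have "map_proj (gr j) (x i) = 0" if "i \<in> J" for i
      using that \<open>j \<in> idx - J\<close> assms gr_eq_iff[of j i] by (auto simp: map_proj_comp[OF x[OF that]])
    then show ?thesis by (simp add: d map_proj_setsum)
  qed
  moreover have "d \<in> g2_carrier"
    unfolding d using x by (intro maps.subspace_sum[OF subspace_g2_carrier] g2_comp_carrier)
  ultimately show "d \<in> g2_carrier \<and> (\<forall>i\<in>idx - J. map_proj (gr i) d = 0)" by blast
next
  assume d: "d \<in> g2_carrier \<and> (\<forall>i\<in>idx - J. map_proj (gr i) d = 0)"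
  then have "d = (\<Sum>i\<in>J. map_proj (gr i) d)"
    using carrier_decomposition[of d] assms sum.mono_neutral_left[of idx J "\<lambda>i. map_proj (gr i) d"] by simp
  then show "d \<in> g2_sum J"
    using d map_proj_in_comp unfolding g2_sum_def by blast
qed

lemma subspace_g2_sum:
  assumes "J \<subseteq> idx"
  shows "maps.subspace (g2_sum J)"
  using maps.subspace_add[OF subspace_g2_carrier] maps.subspace_scale[OF subspace_g2_carrier]
    maps.subspace_0[OF subspace_g2_carrier]
  by (intro maps.subspaceI) (auto simp: g2_sum_iff[OF assms] map_proj_add map_proj_scale map_proj_zero)

lemma g2_sum_mono:
  assumes "J \<subseteq> K" "K \<subseteq> idx"
  shows "g2_sum J \<subseteq> g2_sum K"
proof -
  have "J \<subseteq> idx" using assms by blast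
  then show ?thesis using assms by (simp add: g2_sum_iff subset_iff) blast
qed

lemma g2_sum_idx: "g2_sum idx = g2_carrier"
  by (auto simp: g2_sum_iff)

lemma g2_sum_empty: "g2_sum {} = {0}"
  by (auto simp: g2_sum_def)

lemma comp_subset_g2_sum:
  assumes "J \<subseteq> idx" "i \<in> J"
  shows "g2_comp (gr i) \<subseteq> g2_sum J"
proof
  fix x assume x: "x \<in> g2_comp (gr i)"
  have "gr j \<noteq> gr i" if "j \<in> idx - J" for j
    using that assms inj_onD[OF gr_inj, of i j] by auto
  then show "x \<in> g2_sum J"
    using x by (simp add: g2_sum_iff[OF assms(1)] g2_comp_carrier map_proj_comp)
qed

lemma comp_nontrivial:
  assumes "g \<noteq> 0"
  obtains x where "x \<in> g2_comp g" "x \<noteq> 0"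
proof -
  from indep_extend[OF assms] obtain k h where i: "indep g k h" .
  from comp_exists[OF i, of 1 0] obtain x where "x \<in> g2_comp g" "coord g x k = 1" .
  then show thesis by (intro that[of x]) auto
qed

lemma g2_sum_eq_zero_iff:
  assumes "J \<subseteq> idx"
  shows "g2_sum J = {0} \<longleftrightarrow> J = {}"
proof
  assume 0: "g2_sum J = {0}"
  show "J = {}"
  proof (rule ccontr)
    assume "J \<noteq> {}"
    then obtain i where i: "i \<in> J" by blast
    from comp_nontrivial[OF gr_nonzero[of i]] i assms obtain x where "x \<in> g2_comp (gr i)" "x \<noteq> 0" by blast
    with comp_subset_g2_sum[OF assms i] 0 show False by blast
  qed
qed (simp add: g2_sum_empty)

text \<open>The basis dual to the coordinates of a line: \<open>(u, v)\<close> is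
  \<open>(1, 0)\<close> on \<open>a\<close> and \<open>(0, 1)\<close> on \<open>b\<close>.\<close>

lemma span_comp:
  assumes "g \<noteq> 0"
  obtains a b where "a \<in> g2_comp g" "b \<in> g2_comp g" "a \<noteq> 0" "\<And>c. b \<noteq> map_scale c a"
    "\<And>x. x \<in> g2_comp g \<Longrightarrow> \<exists>s t. x = map_scale s a + map_scale t b"
proof -
  from indep_extend[OF assms] obtain k h where i: "indep g k h" .
  from comp_exists[OF i, of 1 0] obtain a where
    a: "a \<in> g2_comp g" "coord g a k = 1" "coord g a h - coord g a (k + h) = 0" .
  from comp_exists[OF i, of 0 1] obtain b where
    b: "b \<in> g2_comp g" "coord g b k = 0" "coord g b h - coord g b (k + h) = 1" .
  have closed: "map_scale s a + map_scale t b \<in> g2_comp g" for s t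
    using a(1) b(1) subspace_g2_carrier
  proof -
    have "map_scale s a + map_scale t b \<in> g2_carrier"
      by (intro maps.subspace_add[OF subspace_g2_carrier] maps.subspace_scale[OF subspace_g2_carrier]
        g2_comp_carrier[OF a(1)] g2_comp_carrier[OF b(1)])
    moreover have "map_proj g (map_scale s a + map_scale t b) = map_scale s a + map_scale t b"
      by (simp add: map_proj_add map_proj_scale map_proj_comp[OF a(1)] map_proj_comp[OF b(1)])
    ultimately show ?thesis using map_proj_in_comp by metis
  qed
  show thesis
  proof (rule that[OF a(1) b(1)])
    show "a \<noteq> 0" using a(2) by auto
    show "b \<noteq> map_scale c a" for c
    proof
      assume "b = map_scale c a"
      with b(3) have "c * (coord g a h - coord g a (k + h)) = 1" by (simp add: algebra_simps)
      with a(3) show False by simp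
    qed
    fix x assume x: "x \<in> g2_comp g"
    have "x = map_scale (coord g x k) a + map_scale (coord g x h - coord g x (k + h)) b"
    proof (rule comp_eqI_line[OF i x closed])
      define v where "v = coord g x h - coord g x (k + h)"
      have "coord g x k * coord g a h + v * coord g b h - (coord g x k * coord g a (k + h) + v * coord g b (k + h))
        = coord g x k * (coord g a h - coord g a (k + h)) + v * (coord g b h - coord g b (k + h))"
        by (simp add: algebra_simps)
      then show "coord g x h - coord g x (k + h) = coord g (map_scale (coord g x k) a + map_scale (coord g x h - coord g x (k + h)) b) h
         - coord g (map_scale (coord g x k) a + map_scale (coord g x h - coord g x (k + h)) b) (k + h)"
        unfolding v_def[symmetric] a(3) b(3) by (simp add: v_def)
    qed (simp add: a(2) b(2))
    then show "\<exists>s t. x = map_scale s a + map_scale t b" by blast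
  qed
qed

text \<open>Two vectors are added for each degree. The projection to the new degree kills the old
  span and fixes both new vectors, so a dependence would make \<open>b\<close> a multiple of the
  nonzero \<open>a\<close>.\<close>

lemma g2_sum_basis:
  assumes "J \<subseteq> idx"
  obtains B where "finite B" "card B = 2 * card J" "maps.independent B" "maps.span B = g2_sum J"
proof -
  have "finite J" using assms finite_subset finite_idx by blast
  then have "\<exists>B. finite B \<and> card B = 2 * card J \<and> maps.independent B \<and> maps.span B = g2_sum J"
    using assms
  proof (induction J)
    case empty
    show ?case
      by (rule exI[of _ "{}"]) (simp add: g2_sum_empty maps.independent_empty)
  next
    case (insert i J)
    then obtain B where B: "finite B" "card B = 2 * card J" "maps.independent B" "maps.span B = g2_sum J"
      by blast
    have i: "gr i \<noteq> 0" "J \<subseteq> idx" "insert i J \<subseteq> idx" using insert.prems gr_nonzero by auto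
    from span_comp[OF i(1)] obtain a b where ab: "a \<in> g2_comp (gr i)" "b \<in> g2_comp (gr i)" "a \<noteq> 0"
      "\<And>c. b \<noteq> map_scale c a" "\<And>x. x \<in> g2_comp (gr i) \<Longrightarrow> \<exists>s t. x = map_scale s a + map_scale t b"
      by blast
    have pB: "map_proj (gr i) x = 0" if "x \<in> maps.span B" for x
      using that insert.hyps insert.prems by (simp add: B(4) g2_sum_iff[OF i(2)])
    have pa: "map_proj (gr i) a = a" "map_proj (gr i) b = b"
      by (simp_all add: map_proj_comp[OF ab(1)] map_proj_comp[OF ab(2)])
    have a: "a \<notin> maps.span B" using pB pa(1) ab(3) by metis
    have b: "b \<notin> maps.span (insert a B)"
    proof
      assume "b \<in> maps.span (insert a B)"
      then obtain k where "b - map_scale k a \<in> maps.span B" by (auto simp: maps.span_insert)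
      from pB[OF this] have "b - map_scale k a = 0"
        by (simp only: map_proj_diff map_proj_scale pa)
      with ab(4)[of k] show False by (simp only: right_minus_eq simp_thms)
    qed
    define B' where "B' = insert b (insert a B)"
    have "maps.independent B'"
      unfolding B'_def using a b B(3) maps.independent_insertI by blast
    moreover have "card B' = 2 * card (insert i J)"
      using a b B(1,2) insert.hyps maps.span_base[of _ B] maps.span_base[of _ "insert a B"]
      unfolding B'_def by (subst card_insert_disjoint, simp, blast)+ simp
    moreover have "maps.span B' = g2_sum (insert i J)"
    proof
      have "a \<in> g2_sum (insert i J)" "b \<in> g2_sum (insert i J)" "B \<subseteq> g2_sum (insert i J)"
        using comp_subset_g2_sum[OF i(3), of i] ab(1,2) maps.span_superset[of B] B(4)
          g2_sum_mono[OF _ i(3), of J] by blast+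
      then show "maps.span B' \<subseteq> g2_sum (insert i J)"
        unfolding B'_def by (intro maps.span_minimal subspace_g2_sum i) blast
      show "g2_sum (insert i J) \<subseteq> maps.span B'"
      proof
        fix x assume x: "x \<in> g2_sum (insert i J)"
        then have xc: "x \<in> g2_carrier" by (simp add: g2_sum_iff[OF i(3)])
        from ab(5)[OF map_proj_in_comp[OF xc]] obtain s t where
          st: "map_proj (gr i) x = map_scale s a + map_scale t b" by blast
        define y where "y = map_scale s a + map_scale t b"
        have y: "y \<in> g2_comp (gr i)" using map_proj_in_comp[OF xc] st y_def by metis
        have "x - y \<in> g2_sum J"
          unfolding g2_sum_iff[OF i(2)]
        proof (intro conjI ballI)
          show "x - y \<in> g2_carrier"
            by (intro maps.subspace_diff[OF subspace_g2_carrier] xc g2_comp_carrier[OF y])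
          fix j assume j: "j \<in> idx - J"
          have "map_proj (gr j) (x - y) = map_proj (gr j) x - map_proj (gr j) y"
            by (rule map_proj_diff)
          also have "\<dots> = 0"
          proof (cases "j = i")
            case True
            then show ?thesis using st[folded y_def] map_proj_comp[OF y, of "gr i"] by simp
          next
            case False
            then have "gr j \<noteq> gr i" using j i(3) inj_onD[OF gr_inj] by blast
            then show ?thesis using x j False by (simp add: map_proj_comp[OF y] g2_sum_iff[OF i(3)])
          qed
          finally show "map_proj (gr j) (x - y) = 0" .
        qed
        then have "x - y \<in> maps.span B'"
          using B(4) maps.span_mono[of B B'] unfolding B'_def by blast
        moreover have "y \<in> maps.span B'"
          unfolding y_def B'_def by (intro maps.span_add maps.span_scale maps.span_base) simp_all
        ultimately show "x \<in> maps.span B'"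
          using maps.span_add by fastforce
      qed
    qed
    moreover have "finite B'" using B(1) by (simp add: B'_def)
    ultimately show ?case by (intro exI[of _ B'] conjI)
  qed
  with that show thesis by blast
qed

lemma dim_g2_sum:
  assumes "J \<subseteq> idx"
  shows "maps.dim (g2_sum J) = 2 * card J"
proof -
  from g2_sum_basis[OF assms] obtain B where
    "card B = 2 * card J" "maps.independent B" "maps.span B = g2_sum J" by blast
  then show ?thesis
    using maps.dim_eq_card[of B "g2_sum J"] subspace_g2_sum[OF assms] maps.span_eq_iff by metis
qed

text \<open>The combinatorial counterpart of \<open>lie_prod\<close>: the degrees met by brackets of
  degrees in \<open>A\<close> with degrees in \<open>B\<close> along edges of
  \<open>S\<close>.\<close>

definition star_reach :: "nat set set \<Rightarrow> nat set \<Rightarrow> nat set \<Rightarrow> nat set" where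
  "star_reach S A B = {istar i j | i j. i \<in> A \<and> j \<in> B \<and> {i, j} \<in> S}"

lemma star_reach_empty: "star_reach {} A B = {}"
  by (simp add: star_reach_def)

text \<open>Evaluates \<open>star_reach\<close> on an explicit support edge by edge. Both orders of
  an edge lead to the same index because \<open>istar\<close> is symmetric.\<close>

lemma star_reach_insert:
  "star_reach (insert {a, b} S) A B =
    (if a \<in> A \<and> b \<in> B \<or> b \<in> A \<and> a \<in> B then {istar a b} else {}) \<union> star_reach S A B"
proof -
  have "istar b a = istar a b"
    by (simp add: istar_def add.commute)
  then show ?thesis
    unfolding star_reach_def by (auto simp: doubleton_eq_iff) metis
qed

lemma star_reach_mono: "A \<subseteq> A' \<Longrightarrow> B \<subseteq> B' \<Longrightarrow> star_reach S A B \<subseteq> star_reach S A' B'"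
  unfolding star_reach_def by blast

section \<open>The contracted bracket, its products and its centre\<close>

locale contraction =
  fixes \<epsilon> :: "grp \<Rightarrow> grp \<Rightarrow> complex"
  assumes graded_contraction: "graded_contraction \<epsilon>" and admissible: "admissible \<epsilon>"
begin

abbreviation "M \<equiv> g2_contr \<epsilon>"
abbreviation "br \<equiv> contr_br \<epsilon>"
abbreviation "T \<equiv> eta_support \<epsilon>"

lemma lie_algebra_M: "lie_algebra M"
  using graded_contraction by (simp add: graded_contraction_def)

lemma br_closed: "x \<in> g2_carrier \<Longrightarrow> y \<in> g2_carrier \<Longrightarrow> br x y \<in> g2_carrier"
  using lie_algebra_M by (simp add: lie_algebra_def)

lemma br_add_left: "x \<in> g2_carrier \<Longrightarrow> y \<in> g2_carrier \<Longrightarrow> z \<in> g2_carrier \<Longrightarrow> br (x + y) z = br x z + br y z"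
  using lie_algebra_M by (simp add: lie_algebra_def)

lemma br_add_right: "x \<in> g2_carrier \<Longrightarrow> y \<in> g2_carrier \<Longrightarrow> z \<in> g2_carrier \<Longrightarrow> br z (x + y) = br z x + br z y"
  using lie_algebra_M by (simp add: lie_algebra_def)

lemma br_self: "x \<in> g2_carrier \<Longrightarrow> br x x = 0"
  using lie_algebra_M by (simp add: lie_algebra_def)

lemma br_swap:
  assumes "x \<in> g2_carrier" "y \<in> g2_carrier"
  shows "br y x = - br x y"
proof -
  have "br (x + y) (x + y) = 0"
    using assms maps.subspace_add[OF subspace_g2_carrier] by (intro br_self)
  moreover have "br (x + y) (x + y) = br x y + br y x"
    using br_add_left[OF assms maps.subspace_add[OF subspace_g2_carrier assms]]
    by (simp add: br_add_right br_self assms)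
  ultimately show ?thesis
    by (simp only: eq_neg_iff_add_eq_0 add.commute)
qed

lemma proj_br:
  assumes x: "x \<in> g2_carrier" and y: "y \<in> g2_carrier"
  shows "map_proj k (br x y) =
    (\<Sum>g\<in>UNIV. map_scale (\<epsilon> g (g + k)) (map_br (map_proj g x) (map_proj (g + k) y)))"
proof -
  have "map_proj k (map_scale (\<epsilon> g h) (map_br (map_proj g x) (map_proj h y))) =
      (if h = g + k then map_scale (\<epsilon> g (g + k)) (map_br (map_proj g x) (map_proj (g + k) y)) else 0)" for g h
  proof -
    have "k = g + h \<longleftrightarrow> h = g + k"
      using grp_add_left by metis
    then show ?thesis
      using map_proj_comp[OF map_br_in_comp[OF map_proj_in_comp[OF x, of g] map_proj_in_comp[OF y, of h]], of k]
      by (auto simp: map_proj_scale)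
  qed
  then show ?thesis
    by (simp add: contr_br_def map_proj_setsum)
qed

lemma map_br_zero: "x \<in> g2_carrier \<Longrightarrow> map_br x 0 = 0" "x \<in> g2_carrier \<Longrightarrow> map_br 0 x = 0"
  by (simp_all add: map_br_def g2_map_zero fun_eq_iff)

text \<open>Both brackets are antisymmetric, so the two values agree as soon as some
  \<open>map_br x y\<close> is nonzero; nondegeneracy provides such a pair.\<close>

lemma eps_symmetric:
  assumes "g \<noteq> 0" "h \<noteq> 0" "g \<noteq> h"
  shows "\<epsilon> g h = \<epsilon> h g"
proof -
  from comp_nontrivial[OF assms(1)] obtain x where x: "x \<in> g2_comp g" "x \<noteq> 0" .
  with map_br_nondegenerate[OF assms x(1)] obtain y where y: "y \<in> g2_comp h" "map_br x y \<noteq> 0" by blast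
  have "map_br y x = - map_br x y"
    by (simp add: map_br_def fun_eq_iff)
  then have "map_scale (\<epsilon> h g) (map_br x y) = map_scale (\<epsilon> g h) (map_br x y)"
    using br_swap[OF g2_comp_carrier[OF x(1)] g2_comp_carrier[OF y(1)]]
    by (simp add: contr_br_comp[OF x(1) y(1)] contr_br_comp[OF y(1) x(1)])
  with y(2) show ?thesis by simp
qed

text \<open>Symmetry of \<open>\<epsilon>\<close> removes the ordering by \<open>Min\<close> and
  \<open>Max\<close> built into \<open>eta\<close>.\<close>

lemma edge_iff: "{i, j} \<in> T \<longleftrightarrow> i \<in> idx \<and> j \<in> idx \<and> i \<noteq> j \<and> \<epsilon> (gr i) (gr j) \<noteq> 0"
proof -
  have "{i, j} \<in> edges \<longleftrightarrow> i \<in> idx \<and> j \<in> idx \<and> i \<noteq> j"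
    by (auto simp: edges_def doubleton_eq_iff)
  moreover have "eta \<epsilon> {i, j} = \<epsilon> (gr i) (gr j)" if "i \<in> idx" "j \<in> idx" "i \<noteq> j"
    using that eps_symmetric[of "gr i" "gr j"] gr_nonzero gr_eq_iff[of i j]
    by (cases "i < j") (auto simp: eta_def)
  ultimately show ?thesis by (auto simp: eta_support_def)
qed

lemma support_subset: "T \<subseteq> edges"
  by (auto simp: eta_support_def)

lemma star_reach_subset: "star_reach T A B \<subseteq> idx"
  using istar_in by (auto simp: star_reach_def edge_iff)

text \<open>A nonzero component of a bracket must come from some nonzero summand of
  \<open>proj_br\<close>; both degrees of that summand are nonzero as degree 0 carries no
  derivations.\<close>

lemma proj_br_nonzero:
  assumes x: "x \<in> g2_carrier" and y: "y \<in> g2_carrier" and nz: "map_proj (gr k) (br x y) \<noteq> 0" and k: "k \<in> idx"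
  obtains i j where "{i, j} \<in> T" "istar i j = k" "map_proj (gr i) x \<noteq> 0" "map_proj (gr j) y \<noteq> 0"
proof -
  from nz obtain g where "map_scale (\<epsilon> g (g + gr k)) (map_br (map_proj g x) (map_proj (g + gr k) y)) \<noteq> 0"
    unfolding proj_br[OF x y] by (metis (no_types, lifting) sum.neutral)
  then have g: "\<epsilon> g (g + gr k) \<noteq> 0" "map_br (map_proj g x) (map_proj (g + gr k) y) \<noteq> 0" by auto
  then have nz: "map_proj g x \<noteq> 0" "map_proj (g + gr k) y \<noteq> 0"
    using map_br_zero[OF g2_comp_carrier[OF map_proj_in_comp]] x y by metis+
  then have "g \<in> gr ` idx" "g + gr k \<in> gr ` idx"
    using map_proj_degree_zero x y unfolding gr_image_idx by auto
  then obtain i j where ij: "i \<in> idx" "gr i = g" "j \<in> idx" "gr j = g + gr k" by force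
  have "i \<noteq> j" using ij gr_nonzero[OF k] by (auto simp: eq_commute[of "gr j"])
  moreover have "gr k = gr i + gr j" using ij by (simp add: grp_add_left)
  then have "istar i j = k" by (rule istar_eqI[OF k])
  ultimately show thesis using that[of i j] ij g(1) nz by (simp add: edge_iff)
qed

lemma br_in_star_reach:
  assumes "A \<subseteq> idx" "B \<subseteq> idx" "x \<in> g2_sum A" "y \<in> g2_sum B"
  shows "br x y \<in> g2_sum (star_reach T A B)"
  unfolding g2_sum_iff[OF star_reach_subset]
proof (intro conjI ballI)
  have x: "x \<in> g2_carrier" "\<And>i. i \<in> idx - A \<Longrightarrow> map_proj (gr i) x = 0"
    using assms by (simp_all add: g2_sum_iff)
  have y: "y \<in> g2_carrier" "\<And>i. i \<in> idx - B \<Longrightarrow> map_proj (gr i) y = 0"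
    using assms by (simp_all add: g2_sum_iff)
  show "br x y \<in> g2_carrier" by (rule br_closed[OF x(1) y(1)])
  fix k assume k: "k \<in> idx - star_reach T A B"
  show "map_proj (gr k) (br x y) = 0"
  proof (rule ccontr)
    assume "map_proj (gr k) (br x y) \<noteq> 0"
    from proj_br_nonzero[OF x(1) y(1) this] k obtain i j where
      "{i, j} \<in> T" "istar i j = k" "map_proj (gr i) x \<noteq> 0" "map_proj (gr j) y \<noteq> 0" by blast
    with k x(2) y(2) show False unfolding star_reach_def edge_iff by blast
  qed
qed

text \<open>A homogeneous element of a reachable degree is a single bracket up to a nonzero factor.
  So whole components occur, and the product depends on \<open>\<epsilon>\<close> only through its
  support.\<close>

lemma lie_prod_g2_sum:
  assumes A: "A \<subseteq> idx" and B: "B \<subseteq> idx"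
  shows "lie_prod M (g2_sum A) (g2_sum B) = g2_sum (star_reach T A B)"
proof
  show "lie_prod M (g2_sum A) (g2_sum B) \<subseteq> g2_sum (star_reach T A B)"
    unfolding lie_prod_def g2_contr_simps
    by (rule maps.span_minimal[OF _ subspace_g2_sum[OF star_reach_subset]]) (use br_in_star_reach[OF A B] in auto)
  let ?S = "maps.span {br x y | x y. x \<in> g2_sum A \<and> y \<in> g2_sum B}"
  have hom: "z \<in> ?S" if "k \<in> star_reach T A B" "z \<in> g2_comp (gr k)" for k z
  proof -
    from that(1) obtain i j where ij: "i \<in> A" "j \<in> B" "{i, j} \<in> T" "k = istar i j"
      by (auto simp: star_reach_def)
    then have e: "i \<in> idx" "j \<in> idx" "i \<noteq> j" "\<epsilon> (gr i) (gr j) \<noteq> 0" by (simp_all add: edge_iff)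
    then have ne: "gr i \<noteq> 0" "gr j \<noteq> 0" "gr i \<noteq> gr j" using gr_nonzero inj_onD[OF gr_inj] by blast+
    from map_br_generic[OF ne] that(2) obtain x y where xy: "x \<in> g2_comp (gr i)" "y \<in> g2_comp (gr j)" "map_br x y = z"
      unfolding ij(4) gr_istar[OF e(1-3)] by metis
    have "br x y \<in> ?S"
      using xy(1,2) comp_subset_g2_sum[OF A ij(1)] comp_subset_g2_sum[OF B ij(2)]
      by (intro maps.span_base) blast
    \<comment> \<open>The contracted bracket of \<open>x\<close> and \<open>y\<close> is
      \<open>\<epsilon> (gr i) (gr j)\<close> times \<open>z\<close>.\<close>
    then have "map_scale (1 / \<epsilon> (gr i) (gr j)) (br x y) \<in> ?S" by (rule maps.span_scale)
    then show ?thesis using e(4) by (simp add: contr_br_comp[OF xy(1,2)] xy(3))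
  qed
  show "g2_sum (star_reach T A B) \<subseteq> lie_prod M (g2_sum A) (g2_sum B)"
  proof
    fix z assume "z \<in> g2_sum (star_reach T A B)"
    then obtain x where "z = (\<Sum>k\<in>star_reach T A B. x k)" "\<forall>k\<in>star_reach T A B. x k \<in> g2_comp (gr k)"
      by (auto simp: g2_sum_def)
    then show "z \<in> lie_prod M (g2_sum A) (g2_sum B)"
      unfolding lie_prod_def g2_contr_simps using hom by (auto intro!: maps.span_sum)
  qed
qed

text \<open>A degree on some edge is excluded by nondegeneracy along that edge; a degree on no edge
  has only zero brackets.\<close>

lemma lie_center_M: "lie_center M = g2_sum (idx - \<Union>T)"
proof
  show "lie_center M \<subseteq> g2_sum (idx - \<Union>T)"
  proof
    fix x assume x: "x \<in> lie_center M"
    then have xc: "x \<in> g2_carrier" and x0: "\<And>y. y \<in> g2_carrier \<Longrightarrow> br x y = 0"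
      by (simp_all add: lie_center_def)
    have "map_proj (gr i) x = 0" if i: "i \<in> \<Union>T" for i
    proof -
      from i obtain t where t: "i \<in> t" "t \<in> T" by blast
      then obtain j where T: "{i, j} \<in> T"
        using support_subset by (fastforce simp: edges_def insert_commute)
      then have e: "i \<in> idx" "j \<in> idx" "i \<noteq> j" "\<epsilon> (gr i) (gr j) \<noteq> 0" by (simp_all add: edge_iff)
      then have ne: "gr i \<noteq> 0" "gr j \<noteq> 0" "gr i \<noteq> gr j" using gr_nonzero inj_onD[OF gr_inj] by blast+
      show ?thesis
      proof (rule map_br_nondegenerate[OF ne map_proj_in_comp[OF xc]])
        fix y assume y: "y \<in> g2_comp (gr j)"
        have eq: "g + (gr i + gr j) = gr j \<longleftrightarrow> g = gr i" for g
          by (metis add.commute grp_add_left)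
        \<comment> \<open>Against \<open>y\<close> of degree \<open>gr j\<close>, only the degree
          \<open>gr i\<close> part of \<open>x\<close> contributes to this degree, so the components
          of \<open>x\<close> are tested separately.\<close>
        have "0 = map_proj (gr i + gr j) (br x y)"
          using x0[OF g2_comp_carrier[OF y]] by (simp add: map_proj_zero)
        also have "\<dots> = (\<Sum>g\<in>UNIV. if g = gr i then map_scale (\<epsilon> (gr i) (gr j)) (map_br (map_proj (gr i) x) y) else 0)"
          unfolding proj_br[OF xc g2_comp_carrier[OF y]]
          by (intro sum.cong refl)
             (auto simp: map_proj_comp[OF y] eq map_br_zero g2_comp_carrier[OF map_proj_in_comp[OF xc]] grp_add_left)
        finally show "map_br (map_proj (gr i) x) y = 0"
          using e(4) by simp
      qed
    qed
    with xc show "x \<in> g2_sum (idx - \<Union>T)" by (auto simp: g2_sum_iff)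
  qed
  show "g2_sum (idx - \<Union>T) \<subseteq> lie_center M"
  proof
    fix x assume x: "x \<in> g2_sum (idx - \<Union>T)"
    have "star_reach T (idx - \<Union>T) idx = {}" by (auto simp: star_reach_def)
    with br_in_star_reach[OF _ _ x, of idx] have "br x y = 0" if "y \<in> g2_carrier" for y
      using that by (simp add: g2_sum_idx g2_sum_empty)
    then show "x \<in> lie_center M" using x by (simp add: lie_center_def g2_sum_iff)
  qed
qed

end

section \<open>Nilpotency, solvability and simplicity\<close>

context contraction
begin

lemma lie_dim_g2_sum: "J \<subseteq> idx \<Longrightarrow> lie_dim M (g2_sum J) = 2 * card J"
  by (simp add: lie_dim_def dim_g2_sum)

lemma lie_lower_Suc:
  "J \<subseteq> idx \<Longrightarrow> lie_lower M n = g2_sum J \<Longrightarrow> lie_lower M (Suc n) = g2_sum (star_reach T idx J)"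
  using lie_prod_g2_sum[of idx J] by (simp add: g2_sum_idx)

lemma lie_der_Suc:
  "J \<subseteq> idx \<Longrightarrow> lie_der M n = g2_sum J \<Longrightarrow> lie_der M (Suc n) = g2_sum (star_reach T J J)"
  using lie_prod_g2_sum[of J J] by simp

lemma lie_derived_M: "lie_derived M = g2_sum (star_reach T idx idx)"
  using lie_prod_g2_sum[of idx idx] by (simp add: g2_sum_idx)

lemma lie_lower_1: "lie_lower M 1 = g2_sum (star_reach T idx idx)"
  using lie_derived_M by simp

lemma lie_der_1: "lie_der M 1 = g2_sum (star_reach T idx idx)"
  using lie_derived_M by simp

lemma lie_lower_stable:
  assumes "lie_lower M m = g2_sum J" "J \<subseteq> idx" "star_reach T idx J = J" "m \<le> n"
  shows "lie_lower M n = g2_sum J"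
  using assms(4) by (induction n rule: dec_induct) (use assms(1-3) lie_lower_Suc in auto)

lemma lie_der_stable:
  assumes "lie_der M m = g2_sum J" "J \<subseteq> idx" "star_reach T J J = J" "m \<le> n"
  shows "lie_der M n = g2_sum J"
  using assms(4) by (induction n rule: dec_induct) (use assms(1-3) lie_der_Suc in auto)

text \<open>By monotonicity of \<open>star_reach\<close>, the degrees in \<open>J\<close> survive in
  every term of the lower central series.\<close>

lemma not_nilpotentI:
  assumes J: "J \<noteq> {}" "J \<subseteq> idx" "J \<subseteq> star_reach T idx J"
  shows "\<not> lie_nilpotent M"
proof -
  have "\<exists>L. L \<subseteq> idx \<and> J \<subseteq> L \<and> lie_lower M n = g2_sum L" for n
  proof (induction n)
    case 0
    show ?case using J(2) by (intro exI[of _ idx]) (simp add: g2_sum_idx)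
  next
    case (Suc n)
    then obtain L where L: "L \<subseteq> idx" "J \<subseteq> L" "lie_lower M n = g2_sum L" by blast
    have "J \<subseteq> star_reach T idx L"
      using J(3) star_reach_mono[OF order_refl L(2)] by blast
    with lie_lower_Suc[OF L(1,3)] star_reach_subset show ?case by blast
  qed
  then have "lie_lower M n \<noteq> {0}" for n
    using J(1) g2_sum_eq_zero_iff by (metis subset_empty)
  then show ?thesis
    by (simp add: lie_nilpotent_def)
qed

text \<open>The derived series analogue: \<open>J\<close> has to reproduce itself from brackets
  within \<open>J\<close>.\<close>

lemma not_solvableI:
  assumes J: "J \<noteq> {}" "J \<subseteq> idx" "J \<subseteq> star_reach T J J"
  shows "\<not> lie_solvable M"
proof -
  have "\<exists>L. L \<subseteq> idx \<and> J \<subseteq> L \<and> lie_der M n = g2_sum L" for n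
  proof (induction n)
    case 0
    show ?case using J(2) by (intro exI[of _ idx]) (simp add: g2_sum_idx)
  next
    case (Suc n)
    then obtain L where L: "L \<subseteq> idx" "J \<subseteq> L" "lie_der M n = g2_sum L" by blast
    have "J \<subseteq> star_reach T L L"
      using J(3) star_reach_mono[OF L(2) L(2)] by blast
    with lie_der_Suc[OF L(1,3)] star_reach_subset show ?case by blast
  qed
  then have "lie_der M n \<noteq> {0}" for n
    using J(1) g2_sum_eq_zero_iff by (metis subset_empty)
  then show ?thesis
    by (simp add: lie_solvable_def)
qed

section \<open>Reduction of the structure statements to finite set equations\<close>

lemma lie_nonzero: "lie_lower M 0 \<noteq> {0}" "lie_der M 0 \<noteq> {0}"
proof -
  have "idx \<noteq> {}" by (simp add: idx_def)
  then show "lie_lower M 0 \<noteq> {0}" "lie_der M 0 \<noteq> {0}"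
    using g2_sum_eq_zero_iff[of idx] by (simp_all add: g2_sum_idx)
qed

text \<open>In this and the following case lemmas \<open>Z\<close> and \<open>J\<close> are the
  degrees of the centre and the derived algebra. All hypotheses are equations between finite sets,
  settled by evaluation for a concrete support.\<close>

lemma two_step_nilpotent_case:
  assumes Z: "idx - \<Union>T = Z" and J: "star_reach T idx idx = J" "J \<noteq> {}" "star_reach T idx J = {}"
    and card: "2 * card Z = a" "2 * card J = b"
  shows "lie_center M = g2_sum Z \<and> lie_dim M (lie_center M) = a \<and>
    lie_derived M = g2_sum J \<and> lie_dim M (lie_derived M) = b \<and>
    lie_der M 2 = {0} \<and> lie_lower M 2 = {0} \<and> step_nilpotent 2 M"
proof -
  have sub: "J \<subseteq> idx" "Z \<subseteq> idx" using J(1) Z star_reach_subset by blast+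
  \<comment> \<open>The second derived term lies in the second lower central term, so one hypothesis
    kills both.\<close>
  have "star_reach T J J = {}" using star_reach_mono[OF sub(1) order_refl] J(3) by blast
  then have der: "lie_der M 2 = {0}"
    using lie_der_Suc[OF sub(1), of 1] lie_der_1 J(1) by (simp add: numeral_2_eq_2 g2_sum_empty)
  have low: "lie_lower M 2 = {0}"
    using lie_lower_Suc[OF sub(1), of 1] lie_lower_1 J(1,3) by (simp add: numeral_2_eq_2 g2_sum_empty)
  have "lie_lower M k \<noteq> {0}" if "k < 2" for k
    using that lie_nonzero lie_lower_1 J(1,2) g2_sum_eq_zero_iff[OF sub(1)]
    by (auto simp: less_2_cases_iff)
  with der low sub Z J(1) show ?thesis
    by (simp add: step_nilpotent_def lie_center_M lie_derived_M[unfolded g2_contr_simps] lie_dim_g2_sum card)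
qed

text \<open>\<open>K\<close> is the set of degrees at which the lower central series becomes
  stationary, from its second term on.\<close>

lemma two_step_solvable_case:
  assumes Z: "idx - \<Union>T = Z" and J: "star_reach T idx idx = J" "J \<noteq> {}" "star_reach T J J = {}"
    and K: "star_reach T idx J = K" "star_reach T idx K = K" "K \<noteq> {}"
    and card: "2 * card Z = a" "2 * card J = b"
  shows "lie_center M = g2_sum Z \<and> lie_dim M (lie_center M) = a \<and>
    lie_derived M = g2_sum J \<and> lie_dim M (lie_derived M) = b \<and>
    lie_der M 2 = {0} \<and> step_solvable 2 M \<and> (\<forall>n\<ge>2. lie_lower M n = g2_sum K) \<and> \<not> lie_nilpotent M"
proof -
  have sub: "J \<subseteq> idx" "Z \<subseteq> idx" "K \<subseteq> idx" using J(1) Z K(1) star_reach_subset by blast+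
  have der: "lie_der M 2 = {0}"
    using lie_der_Suc[OF sub(1), of 1] lie_der_1 J(1,3) by (simp add: numeral_2_eq_2 g2_sum_empty)
  have "lie_lower M 2 = g2_sum K"
    using lie_lower_Suc[OF sub(1), of 1] lie_lower_1 J(1) K(1) by (simp add: numeral_2_eq_2)
  then have low: "lie_lower M n = g2_sum K" if "n \<ge> 2" for n
    using lie_lower_stable[OF _ sub(3) K(2) that] by blast
  have "lie_der M k \<noteq> {0}" if "k < 2" for k
    using that lie_nonzero lie_der_1 J(1,2) g2_sum_eq_zero_iff[OF sub(1)]
    by (auto simp: less_2_cases_iff)
  with der low sub Z J(1) not_nilpotentI[OF K(3) sub(3)] K(2) show ?thesis
    by (simp add: step_solvable_def lie_center_M lie_derived_M[unfolded g2_contr_simps] lie_dim_g2_sum card)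
qed

lemma three_step_nilpotent_case:
  assumes Z: "idx - \<Union>T = Z" and J: "star_reach T idx idx = J" "J \<noteq> {}" "star_reach T J J = {}"
    and K: "star_reach T idx J = K" "K \<noteq> {}" "star_reach T idx K = {}"
    and card: "2 * card Z = a" "2 * card J = b"
  shows "lie_center M = g2_sum Z \<and> lie_dim M (lie_center M) = a \<and>
    lie_derived M = g2_sum J \<and> lie_dim M (lie_derived M) = b \<and>
    lie_der M 2 = {0} \<and> step_solvable 2 M \<and> lie_lower M 2 = g2_sum K \<and> step_nilpotent 3 M"
proof -
  have sub: "J \<subseteq> idx" "Z \<subseteq> idx" "K \<subseteq> idx" using J(1) Z K(1) star_reach_subset by blast+
  have der: "lie_der M 2 = {0}"
    using lie_der_Suc[OF sub(1), of 1] lie_der_1 J(1,3) by (simp add: numeral_2_eq_2 g2_sum_empty)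
  have low: "lie_lower M 2 = g2_sum K"
    using lie_lower_Suc[OF sub(1), of 1] lie_lower_1 J(1) K(1) by (simp add: numeral_2_eq_2)
  have low3: "lie_lower M 3 = {0}"
    using lie_lower_Suc[OF sub(3) low] K(3) by (simp add: numeral_3_eq_3 numeral_2_eq_2 g2_sum_empty)
  have "lie_der M k \<noteq> {0}" if "k < 2" for k
    using that lie_nonzero lie_der_1 J(1,2) g2_sum_eq_zero_iff[OF sub(1)]
    by (auto simp: less_2_cases_iff)
  moreover have "lie_lower M k \<noteq> {0}" if "k < 3" for k
  proof -
    have "k = 0 \<or> k = 1 \<or> k = 2" using that by auto
    then show ?thesis
      using lie_nonzero lie_lower_1 low J(1,2) K(2) g2_sum_eq_zero_iff[OF sub(1)] g2_sum_eq_zero_iff[OF sub(3)]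
      by auto
  qed
  ultimately show ?thesis
    using der low low3 sub Z J(1)
    by (simp add: step_solvable_def step_nilpotent_def lie_center_M
      lie_derived_M[unfolded g2_contr_simps] lie_dim_g2_sum card)
qed

text \<open>Here \<open>K\<close> belongs to the second derived term, while the lower central series
  is already stationary at \<open>J\<close>.\<close>

lemma three_step_solvable_case:
  assumes Z: "idx - \<Union>T = Z" and J: "star_reach T idx idx = J" "J \<noteq> {}" "star_reach T idx J = J"
    and K: "star_reach T J J = K" "K \<noteq> {}" "star_reach T K K = {}"
    and card: "2 * card J = b"
  shows "lie_center M = g2_sum Z \<and> (\<forall>n\<ge>1. lie_lower M n = g2_sum J) \<and>
    lie_dim M (lie_derived M) = b \<and> \<not> lie_nilpotent M \<and>
    lie_der M 2 = g2_sum K \<and> lie_der M 3 = {0} \<and> step_solvable 3 M"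
proof -
  have sub: "J \<subseteq> idx" "Z \<subseteq> idx" "K \<subseteq> idx" using J(1) Z K(1) star_reach_subset by blast+
  have low: "lie_lower M n = g2_sum J" if "n \<ge> 1" for n
    using lie_lower_stable[OF _ sub(1) J(3) that] lie_lower_1 J(1) by blast
  have der: "lie_der M 2 = g2_sum K"
    using lie_der_Suc[OF sub(1), of 1] lie_der_1 J(1) K(1) by (simp add: numeral_2_eq_2)
  have der3: "lie_der M 3 = {0}"
    using lie_der_Suc[OF sub(3) der] K(3) by (simp add: numeral_3_eq_3 numeral_2_eq_2 g2_sum_empty)
  have "lie_der M k \<noteq> {0}" if "k < 3" for k
  proof -
    have "k = 0 \<or> k = 1 \<or> k = 2" using that by auto
    then show ?thesis
      using lie_nonzero lie_der_1 der J(1,2) K(2) g2_sum_eq_zero_iff[OF sub(1)] g2_sum_eq_zero_iff[OF sub(3)]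
      by auto
  qed
  then show ?thesis
    using low der der3 sub Z J(1) not_nilpotentI[OF J(2) sub(1)] J(3)
    by (simp add: step_solvable_def lie_center_M lie_derived_M[unfolded g2_contr_simps] lie_dim_g2_sum card)
qed

section \<open>Simplicity for full support\<close>

lemma proj_br_homogeneous:
  assumes a: "a \<in> g2_comp g" and y: "y \<in> g2_carrier"
  shows "map_proj (g + m) (br a y) = map_scale (\<epsilon> g m) (map_br a (map_proj m y))"
proof -
  have "map_proj (g + m) (br a y) =
      (\<Sum>h\<in>UNIV. if h = g then map_scale (\<epsilon> g m) (map_br a (map_proj m y)) else 0)"
    unfolding proj_br[OF g2_comp_carrier[OF a] y]
    by (intro sum.cong refl)
       (auto simp: map_proj_comp[OF a] map_br_zero g2_comp_carrier[OF map_proj_in_comp[OF y]] grp_add_left)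
  then show ?thesis by simp
qed

text \<open>An element of a nonzero ideal whose support is minimal is homogeneous: bracketing with an
  element of degree \<open>g\<close> kills the component of degree \<open>g\<close>, and generically no other one.\<close>

lemma simple_full_support:
  assumes T: "T = edges"
  shows "lie_simple M"
proof -
  have nz: "\<epsilon> g h \<noteq> 0" if gh: "g \<noteq> 0" "h \<noteq> 0" "g \<noteq> h" for g h
  proof -
    from gh obtain i j where ij: "i \<in> idx" "gr i = g" "j \<in> idx" "gr j = h"
      using gr_image_idx by (metis ComplI image_iff singletonD)
    then have "{i, j} \<in> edges" using gh(3) by (auto simp: edges_def)
    then show ?thesis using edge_iff[of i j] T ij by simp
  qed
  have "\<not> lie_abelian M"
  proof
    assume "lie_abelian M"
    then have "lie_center M = g2_carrier" by (auto simp: lie_center_def lie_abelian_def)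
    moreover have "idx - \<Union>edges = {}"
    proof -
      have "i \<in> \<Union>edges" if "i \<in> idx" for i
      proof -
        have "(if i = 1 then 2 else 1) \<in> idx" "i \<noteq> (if i = 1 then 2 else 1)" by (auto simp: idx_def)
        then show ?thesis using that unfolding edges_def by blast
      qed
      then show ?thesis by blast
    qed
    ultimately show False
      using lie_nonzero by (simp add: lie_center_M T g2_sum_empty)
  qed
  moreover have "J = {0} \<or> J = g2_carrier" if J: "lie_ideal M J" for J
  proof (cases "J = {0}")
    case False
    have sub: "J \<subseteq> g2_carrier" and sp: "maps.subspace J"
      and br: "\<And>x y. x \<in> g2_carrier \<Longrightarrow> y \<in> J \<Longrightarrow> br x y \<in> J"
      using J by (auto simp: lie_ideal_def)
    define supp where "supp x = {g. map_proj g x \<noteq> 0}" for x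
    obtain x0 where "x0 \<in> J \<and> x0 \<noteq> 0"
      using False maps.subspace_0[OF sp] by auto
    \<comment> \<open>A nonzero element of the ideal with the fewest homogeneous components.\<close>
    from ex_has_least_nat[of "\<lambda>x. x \<in> J \<and> x \<noteq> 0", OF this, of "\<lambda>x. card (supp x)"]
    obtain x where "(x \<in> J \<and> x \<noteq> 0) \<and> (\<forall>y. y \<in> J \<and> y \<noteq> 0 \<longrightarrow> card (supp x) \<le> card (supp y))" ..
    then have x: "x \<in> J" "x \<noteq> 0"
      and min: "\<And>y. y \<in> J \<Longrightarrow> y \<noteq> 0 \<Longrightarrow> card (supp x) \<le> card (supp y)"
      by simp_all
    have xc: "x \<in> g2_carrier" using x sub by blast
    have s0: "0 \<notin> supp x" by (simp add: supp_def map_proj_degree_zero[OF xc])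
    have uniq: "g = m" if g: "g \<in> supp x" and m: "m \<in> supp x" for g m
    proof (rule ccontr)
      assume "g \<noteq> m"
      moreover have "g \<noteq> 0" "m \<noteq> 0" using g m s0 by auto
      ultimately have gm: "g \<noteq> 0" "m \<noteq> 0" "g \<noteq> m" by simp_all
      have ne: "\<epsilon> g m \<noteq> 0" by (rule nz[OF gm])
      \<comment> \<open>Bracketing with \<open>a\<close> loses the component of degree
        \<open>g\<close>, which would land in degree 0, but keeps the one of degree
        \<open>m\<close>, so the result is nonzero.\<close>
      from map_br_injective[OF gm] obtain a where
        a: "a \<in> g2_comp g" "\<forall>z\<in>g2_comp m. map_br a z = 0 \<longrightarrow> z = 0" .
      define y where "y = br a x"
      have y: "y \<in> J"
        unfolding y_def using br x(1) a(1) g2_comp_carrier by blast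
      have pm: "map_proj k y = map_scale (\<epsilon> g (g + k)) (map_br a (map_proj (g + k) x))" for k
        using proj_br_homogeneous[OF a(1) xc, of "g + k"] by (simp add: y_def grp_add_left)
      have "map_br a (map_proj m x) \<noteq> 0"
        using a(2) map_proj_in_comp[OF xc, of m] m by (auto simp: supp_def)
      then have "map_proj (g + m) y \<noteq> 0"
        using ne by (simp add: pm grp_add_left)
      then have "y \<noteq> 0" by (auto simp: map_proj_zero)
      have "g + k \<in> supp x - {g}" if "k \<in> supp y" for k
      proof -
        have "k \<noteq> 0" using that br_closed[OF g2_comp_carrier[OF a(1)] xc]
          by (auto simp: supp_def y_def map_proj_degree_zero)
        moreover have "map_proj (g + k) x \<noteq> 0"
          using that map_br_zero(1)[OF g2_comp_carrier[OF a(1)]] by (force simp: supp_def pm)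
        ultimately show ?thesis by (simp add: supp_def)
      qed
      \<comment> \<open>Translation by \<open>g\<close> embeds the support of \<open>y\<close> into
        that of \<open>x\<close> without \<open>g\<close>, against minimality.\<close>
      then have "(+) g ` supp y \<subseteq> supp x - {g}" by (rule image_subsetI)
      then have "card ((+) g ` supp y) \<le> card (supp x - {g})" by (intro card_mono) simp_all
      also have "\<dots> < card (supp x)" using g by (intro psubset_card_mono) auto
      finally have "card (supp y) < card (supp x)" by (simp add: card_image)
      with min[OF y \<open>y \<noteq> 0\<close>] show False by simp
    qed
    have "supp x \<noteq> {}"
      using map_proj_sum[OF g2_carrier_linear[OF xc]] x(2) by (auto simp: supp_def)
    then obtain g where g: "supp x = {g}" using uniq by blast
    have "map_proj g x = (\<Sum>k\<in>UNIV. map_proj k x)"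
      using sum.mono_neutral_left[of UNIV "{g}" "\<lambda>k. map_proj k x"] g by (auto simp: supp_def)
    then have xg: "x \<in> g2_comp g"
      using map_proj_in_comp[OF xc] map_proj_sum[OF g2_carrier_linear[OF xc]] by metis
    have g0: "g \<noteq> 0" using g s0 by auto
    \<comment> \<open>The homogeneous \<open>x\<close> is prescribed, so the line along which its
      bracket is onto has to be chosen to fit it.\<close>
    from comp_regular_line[OF g0 xg x(2)] obtain k h where i: "indep g k h"
      and UV: "coord g x k \<noteq> 0" "coord g x h - coord g x (k + h) \<noteq> 0" .
    note n = indep_nonzero[OF i]
    \<comment> \<open>With all relevant \<open>\<epsilon>\<close> nonzero, \<open>J\<close> absorbs
      the uncontracted brackets of homogeneous elements of distinct nonzero degrees as well.\<close>
    have ideal: "z \<in> J" if "u \<in> g2_comp p" "v \<in> g2_comp q" "map_br u v = z \<or> map_br v u = z" "v \<in> J"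
      "p \<noteq> 0" "q \<noteq> 0" "p \<noteq> q" for u v z p q
    proof -
      have "map_scale (\<epsilon> p q) (map_br u v) \<in> J"
        using br[OF g2_comp_carrier[OF that(1)] that(4)] by (simp add: contr_br_comp[OF that(1,2)])
      from maps.subspace_scale[OF sp this, of "1 / \<epsilon> p q"] have "map_br u v \<in> J"
        using nz[OF that(5-7)] by simp
      moreover have "map_br v u = - map_br u v" by (simp add: map_br_def fun_eq_iff)
      ultimately show ?thesis using that(3) maps.subspace_neg[OF sp] by auto
    qed
    \<comment> \<open>The first degree whose whole component is forced into \<open>J\<close>; it
      then generates all others.\<close>
    define m where "m = g + k"
    have m0: "m \<noteq> 0" using n by (simp add: m_def)
    have mJ: "g2_comp m \<subseteq> J"
    proof
      fix z assume "z \<in> g2_comp m"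
      then obtain y where "y \<in> g2_comp k" "map_br x y = z"
        using map_br_onto[OF i xg UV] unfolding m_def by blast
      then show "z \<in> J" using ideal[of y k x g z] xg x(1) n by blast
    qed
    have comps: "g2_comp p \<subseteq> J" for p
    proof (cases "p = 0 \<or> p = m")
      case True
      then show ?thesis using mJ maps.subspace_0[OF sp] by (auto simp: comp_zero)
    next
      case False
      show ?thesis
      proof
        fix z assume z: "z \<in> g2_comp p"
        \<comment> \<open>Every remaining degree \<open>p\<close> is the sum of \<open>p + m\<close>
          and \<open>m\<close>, and the factor of degree \<open>m\<close> already lies in
          \<open>J\<close>.\<close>
        have q: "p + m \<noteq> 0" "m \<noteq> 0" "p + m \<noteq> m" "p + m + m = p"
          using False m0 by (auto simp: grp_add_eq_0 add.assoc grp_add_self)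
        from map_br_generic[OF q(1-3)] z obtain u v where
          "u \<in> g2_comp (p + m)" "v \<in> g2_comp m" "map_br u v = z"
          unfolding q(4) by metis
        with ideal[of u "p + m" v m z] mJ q show "z \<in> J" by blast
      qed
    qed
    have "g2_carrier \<subseteq> J"
    proof
      fix y assume y: "y \<in> g2_carrier"
      have "(\<Sum>g\<in>UNIV. map_proj g y) \<in> J"
        using comps map_proj_in_comp[OF y] by (intro maps.subspace_sum[OF sp]) blast
      then show "y \<in> J" by (simp add: map_proj_sum[OF g2_carrier_linear[OF y]])
    qed
    with sub show ?thesis by blast
  qed simp
  ultimately show ?thesis by (simp add: lie_simple_def)
qed

end

section \<open>Two copies of the cross product algebra\<close>

definition cprod :: "complex ^ 3 \<Rightarrow> complex ^ 3 \<Rightarrow> complex ^ 3" where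
  "cprod p q = vector [p$2 * q$3 - p$3 * q$2, p$3 * q$1 - p$1 * q$3, p$1 * q$2 - p$2 * q$1]"

lemma cprod_zero [simp]: "cprod 0 q = 0" "cprod p 0 = 0"
  by (simp_all add: cprod_def vec_eq_iff forall_3)

text \<open>The triple product expansion for orthogonal axes; it extracts one coordinate of
  \<open>p\<close> by bracketing.\<close>

lemma cprod_axis_axis:
  assumes "i \<noteq> j"
  shows "cprod (axis i 1) (cprod (axis j 1) p) = (p $ i) *s axis j 1"
  using exhaust_3[of i] exhaust_3[of j] assms
  by (auto simp: cprod_def vec_eq_iff forall_3 axis_def)

text \<open>The cross product algebra is perfect, in the explicit form needed to lift elements
  through the derived series.\<close>

lemma cprod_expand:
  "p = cprod ((p$1) *s axis 2 1) (axis 3 1) + cprod ((p$2) *s axis 3 1) (axis 1 1)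
     + cprod ((p$3) *s axis 1 1) (axis 2 1)"
  by (simp add: cprod_def vec_eq_iff forall_3 axis_def)

text \<open>Stated abstractly to be used twice: for the whole contraction, where the kernel is the
  radical, and for its subalgebra on the line, where the kernel is zero.\<close>

locale cross_quotient =
  fixes N :: "'v::ab_group_add lie_alg" and P Q :: "'v \<Rightarrow> complex ^ 3"
  assumes vs: "vector_space (lie_scale N)"
    and carrier: "module.subspace (lie_scale N) (lie_carrier N)"
    and closed: "x \<in> lie_carrier N \<Longrightarrow> y \<in> lie_carrier N \<Longrightarrow> lie_br N x y \<in> lie_carrier N"
    and P_add: "x \<in> lie_carrier N \<Longrightarrow> y \<in> lie_carrier N \<Longrightarrow> P (x + y) = P x + P y"
    and Q_add: "x \<in> lie_carrier N \<Longrightarrow> y \<in> lie_carrier N \<Longrightarrow> Q (x + y) = Q x + Q y"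
    and P_scale: "x \<in> lie_carrier N \<Longrightarrow> P (lie_scale N c x) = c *s P x"
    and Q_scale: "x \<in> lie_carrier N \<Longrightarrow> Q (lie_scale N c x) = c *s Q x"
    and P_br: "x \<in> lie_carrier N \<Longrightarrow> y \<in> lie_carrier N \<Longrightarrow> P (lie_br N x y) = cprod (P x) (P y)"
    and Q_br: "x \<in> lie_carrier N \<Longrightarrow> y \<in> lie_carrier N \<Longrightarrow> Q (lie_br N x y) = cprod (Q x) (Q y)"
    and onto: "\<exists>x\<in>lie_carrier N. P x = p \<and> Q x = q"
    and kernel_abelian: "\<lbrakk>x \<in> lie_carrier N; P x = 0; Q x = 0; y \<in> lie_carrier N; P y = 0; Q y = 0\<rbrakk>
      \<Longrightarrow> lie_br N x y = 0"
begin

sublocale V: vector_space "lie_scale N"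
  by (rule vs)

text \<open>Lets every result about \<open>P\<close> be reused for \<open>Q\<close>.\<close>

lemma swap: "cross_quotient N Q P"
proof (rule cross_quotient.intro)
  show "\<exists>x\<in>lie_carrier N. Q x = p \<and> P x = q" for p q
    using onto[of q p] by blast
qed (simp_all add: vs carrier closed P_add Q_add P_scale Q_scale P_br Q_br kernel_abelian)

definition kernel :: "'v set" where
  "kernel = {x \<in> lie_carrier N. P x = 0 \<and> Q x = 0}"

lemma P_zero: "P 0 = 0"
  using P_scale[OF V.subspace_0[OF carrier], of 0] by simp

lemma Q_zero: "Q 0 = 0"
  using Q_scale[OF V.subspace_0[OF carrier], of 0] by simp

lemma subspace_kernel: "V.subspace kernel"
  using V.subspace_0[OF carrier] V.subspace_add[OF carrier] V.subspace_scale[OF carrier]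
  by (intro V.subspaceI) (auto simp: kernel_def P_zero Q_zero P_add Q_add P_scale Q_scale)

lemma kernel_ideal: "lie_ideal N kernel"
  unfolding lie_ideal_def using subspace_kernel closed by (auto simp: kernel_def P_br Q_br)

lemma kernel_solvable: "lie_solvable (lie_restrict N kernel)"
proof -
  have "{lie_br N x y | x y. x \<in> kernel \<and> y \<in> kernel} = {0}"
  proof
    show "{lie_br N x y | x y. x \<in> kernel \<and> y \<in> kernel} \<subseteq> {0}"
      by (auto simp: kernel_def kernel_abelian)
    have "0 \<in> kernel" by (rule V.subspace_0[OF subspace_kernel])
    moreover have "lie_br N 0 0 = 0"
      using V.subspace_0[OF carrier] by (simp add: kernel_abelian P_zero Q_zero)
    ultimately show "{0} \<subseteq> {lie_br N x y | x y. x \<in> kernel \<and> y \<in> kernel}" by force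
  qed
  then have "lie_der (lie_restrict N kernel) 1 = {0}"
    by (simp add: lie_prod_def lie_restrict_def)
  then show ?thesis unfolding lie_solvable_def by blast
qed

text \<open>Bracketing with an element whose \<open>Q\<close> part is 0 erases \<open>Q\<close> and
  multiplies \<open>P\<close> by a prescribed vector. Two such brackets turn one nonzero coordinate
  of \<open>P x\<close> into an axis vector, and the axis vectors span.\<close>

lemma ideal_contains_factor:
  assumes J: "lie_ideal N J" and x: "x \<in> J" "P x \<noteq> 0"
  shows "\<exists>y\<in>J. P y = p \<and> Q y = 0"
proof -
  have sub: "J \<subseteq> lie_carrier N" and sp: "V.subspace J"
    and br: "\<And>x y. x \<in> lie_carrier N \<Longrightarrow> y \<in> J \<Longrightarrow> lie_br N x y \<in> J"
    using J by (auto simp: lie_ideal_def)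
  define W where "W = {P y | y. y \<in> J \<and> Q y = 0}"
  have W_cprod: "cprod r (P y) \<in> W" if "y \<in> J" for r y
  proof -
    from onto[of r 0] obtain a where a: "a \<in> lie_carrier N" "P a = r" "Q a = 0" by blast
    have "lie_br N a y \<in> J" "P (lie_br N a y) = cprod r (P y)" "Q (lie_br N a y) = 0"
      using br[OF a(1) that] a that sub by (auto simp: P_br Q_br)
    then show ?thesis unfolding W_def by force
  qed
  have W_cprod': "cprod r w \<in> W" if "w \<in> W" for r w
    using that W_cprod unfolding W_def by blast
  have W_scale: "c *s w \<in> W" if "w \<in> W" for c w
  proof -
    from that obtain y where y: "y \<in> J" "Q y = 0" "w = P y" unfolding W_def by auto
    then have "lie_scale N c y \<in> J" "P (lie_scale N c y) = c *s w" "Q (lie_scale N c y) = 0"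
      using V.subspace_scale[OF sp] P_scale[of y] Q_scale[of y] sub by auto
    then show ?thesis unfolding W_def by force
  qed
  have W_add: "w + w' \<in> W" if "w \<in> W" "w' \<in> W" for w w'
  proof -
    from that obtain y y' where y: "y \<in> J" "Q y = 0" "w = P y" "y' \<in> J" "Q y' = 0" "w' = P y'"
      unfolding W_def by auto
    then have "y + y' \<in> J" "P (y + y') = w + w'" "Q (y + y') = 0"
      using V.subspace_add[OF sp] P_add[of y y'] Q_add[of y y'] sub by auto
    then show ?thesis unfolding W_def by force
  qed
  have W_axis: "axis j 1 \<in> W" if "y \<in> J" "P y $ i \<noteq> 0" "i \<noteq> j" for y i j
  proof -
    have "(P y $ i) *s axis j 1 \<in> W"
      using W_cprod'[OF W_cprod[OF that(1)]] cprod_axis_axis[OF that(3)] by metis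
    from W_scale[OF this, of "1 / P y $ i"] show ?thesis
      using that(2) by (simp add: vector_smult_assoc)
  qed
  from x(2) obtain i where i: "P x $ i \<noteq> 0" by (auto simp: vec_eq_iff)
  have ax: "axis j 1 \<in> W" for j
  proof (cases "j = i")
    case True
    \<comment> \<open>The coordinate formula needs two different axes, so the axis \<open>i\<close>
      itself is reached by a detour through another axis \<open>k\<close>.\<close>
    obtain k :: 3 where k: "k \<noteq> i"
      by (cases "i = 1") (auto intro: that[of 1] that[of 2])
    have "axis k 1 \<in> W" by (rule W_axis[OF x(1) i k[symmetric]])
    then obtain y where "y \<in> J" "P y = axis k 1" unfolding W_def by auto
    then show ?thesis using W_axis[of y k j] k True by simp
  next
    case False
    then show ?thesis using W_axis[OF x(1) i, of j] by auto
  qed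
  have "p = (p$1) *s axis 1 1 + (p$2) *s axis 2 1 + (p$3) *s axis 3 1"
    by (simp add: vec_eq_iff forall_3 axis_def)
  then have "p \<in> W" using W_add W_scale ax by metis
  then show ?thesis unfolding W_def by auto
qed

lemma lie_der_restrict_subset:
  assumes J: "lie_ideal N J"
  shows "lie_der (lie_restrict N J) n \<subseteq> J"
proof (induction n)
  case (Suc n)
  have "lie_br N x y \<in> J" if "x \<in> lie_der (lie_restrict N J) n" "y \<in> lie_der (lie_restrict N J) n" for x y
    using that Suc J unfolding lie_ideal_def by blast
  then have "{lie_br N x y | x y. x \<in> lie_der (lie_restrict N J) n \<and> y \<in> lie_der (lie_restrict N J) n} \<subseteq> J"
    by blast
  moreover have "V.subspace J" using J by (simp add: lie_ideal_def)
  ultimately show ?case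
    using V.span_minimal by (simp add: lie_prod_def lie_restrict_def)
qed (simp add: lie_restrict_def)

text \<open>\<open>P\<close> maps \<open>J\<close> onto a perfect algebra, and this surjectivity
  passes from each derived term to the next.\<close>

lemma not_solvable_if_P:
  assumes J: "lie_ideal N J" and x: "x \<in> J" "P x \<noteq> 0"
  shows "\<not> lie_solvable (lie_restrict N J)"
proof -
  have JN: "J \<subseteq> lie_carrier N" using J by (simp add: lie_ideal_def)
  have "\<exists>y\<in>lie_der (lie_restrict N J) n. P y = p" for n p
  proof (induction n arbitrary: p)
    case 0
    show ?case using ideal_contains_factor[OF J x, of p] by (auto simp: lie_restrict_def)
  next
    case (Suc n)
    let ?D = "lie_der (lie_restrict N J) n" and ?D' = "lie_der (lie_restrict N J) (Suc n)"
    have D: "?D \<subseteq> lie_carrier N" "?D' \<subseteq> lie_carrier N"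
      using lie_der_restrict_subset[OF J] JN by blast+
    have D': "?D' = V.span {lie_br N x y | x y. x \<in> ?D \<and> y \<in> ?D}"
      by (simp add: lie_prod_def lie_restrict_def)
    have "\<exists>y\<in>?D'. P y = cprod r s" for r s
    proof -
      from Suc[of r] Suc[of s] obtain a b where ab: "a \<in> ?D" "P a = r" "b \<in> ?D" "P b = s" by blast
      then have "lie_br N a b \<in> ?D'" unfolding D' by (intro V.span_base) blast
      moreover have "P (lie_br N a b) = cprod r s" using P_br[of a b] ab D(1) by auto
      ultimately show ?thesis by blast
    qed
    moreover have "\<exists>y\<in>?D'. P y = r + s" if "\<exists>y\<in>?D'. P y = r" "\<exists>y\<in>?D'. P y = s" for r s
    proof -
      from that obtain a b where ab: "a \<in> ?D'" "P a = r" "b \<in> ?D'" "P b = s" by blast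
      then have "a + b \<in> ?D'" unfolding D' by (intro V.span_add)
      moreover have "P (a + b) = r + s" using ab D P_add by blast
      ultimately show ?thesis by blast
    qed
    ultimately have "\<exists>y\<in>?D'. P y = cprod ((p$1) *s axis 2 1) (axis 3 1) + cprod ((p$2) *s axis 3 1) (axis 1 1)
     + cprod ((p$3) *s axis 1 1) (axis 2 1)" by blast
    then show ?case using cprod_expand[of p] by metis
  qed
  then have "lie_der (lie_restrict N J) n \<noteq> {0}" for n
    using P_zero by (metis axis_eq_0_iff singletonD zero_neq_one)
  then show ?thesis by (simp add: lie_solvable_def)
qed

text \<open>A solvable ideal must vanish under both \<open>P\<close> and \<open>Q\<close>, while the
  kernel is itself an abelian ideal.\<close>

lemma lie_radical_kernel: "lie_radical N = kernel"
  unfolding lie_radical_def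
proof (rule Greatest_equality)
  show "lie_ideal N kernel \<and> lie_solvable (lie_restrict N kernel)"
    using kernel_ideal kernel_solvable by blast
  interpret S: cross_quotient N Q P by (rule swap)
  show "J \<subseteq> kernel" if J: "lie_ideal N J \<and> lie_solvable (lie_restrict N J)" for J
    using J not_solvable_if_P S.not_solvable_if_P unfolding kernel_def lie_ideal_def by blast
qed

text \<open>\<open>pauli p\<close> is \<open>- \<i> / 2\<close> times the combination of the Pauli matrices with coefficients \<open>p\<close>.\<close>

definition pauli :: "complex ^ 3 \<Rightarrow> complex ^ 2 ^ 2" where
  "pauli p = vector [vector [- \<i> / 2 * p$3, - \<i> / 2 * p$1 - p$2 / 2],
                     vector [- \<i> / 2 * p$1 + p$2 / 2, \<i> / 2 * p$3]]"

lemma pauli_cprod: "pauli (cprod p q) = pauli p ** pauli q - pauli q ** pauli p"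
  by (simp add: pauli_def cprod_def vec_eq_iff forall_2 matrix_matrix_mult_def sum_2 field_simps)

lemma pauli_add: "pauli (p + q) = pauli p + pauli q"
  by (simp add: pauli_def vec_eq_iff forall_2 field_simps)

lemma pauli_scale: "pauli (c *s p) = (\<chi> i j. c * pauli p $ i $ j)"
  by (simp add: pauli_def vec_eq_iff forall_2 field_simps)

lemma trace_pauli: "trace (pauli p) = 0"
  by (simp add: pauli_def trace_def sum_2)

text \<open>A left inverse of \<open>pauli\<close>; the same formula, applied to a traceless matrix,
  is the witness for surjectivity.\<close>

lemma pauli_coeffs:
  "p = vector [\<i> * (pauli p$1$2 + pauli p$2$1), pauli p$2$1 - pauli p$1$2, 2 * \<i> * pauli p$1$1]"
  by (simp add: pauli_def vec_eq_iff forall_3 algebra_simps)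

lemma inj_pauli: "pauli p = pauli q \<Longrightarrow> p = q"
  by (metis pauli_coeffs)

lemma surj_pauli:
  assumes "trace A = 0"
  obtains p where "pauli p = A"
proof
  have "A$2$2 = - A$1$1"
    using assms by (simp add: trace_def sum_2 eq_neg_iff_add_eq_0 add.commute)
  then show "pauli (vector [\<i> * (A$1$2 + A$2$1), A$2$1 - A$1$2, 2 * \<i> * A$1$1]) = A"
    by (simp add: pauli_def vec_eq_iff forall_2 field_simps)
qed

lemma isomorphic_sl2_sl2:
  assumes "kernel = {0}"
  shows "lie_isomorphic N (lie_sum sl2 sl2)"
proof -
  let ?f = "\<lambda>x. (pauli (P x), pauli (Q x))"
  have "inj_on ?f (lie_carrier N)"
  proof (rule inj_onI)
    fix x y assume x: "x \<in> lie_carrier N" and y: "y \<in> lie_carrier N" and "?f x = ?f y"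
    then have eq: "P x = P y" "Q x = Q y" using inj_pauli by auto
    have d: "x - y \<in> lie_carrier N" by (rule V.subspace_diff[OF carrier x y])
    have "P x = P (x - y) + P y" "Q x = Q (x - y) + Q y"
      using P_add[OF d y] Q_add[OF d y] by simp_all
    with eq d have "x - y \<in> kernel" by (simp add: kernel_def)
    with assms show "x = y" by simp
  qed
  moreover have "?f ` lie_carrier N = lie_carrier (lie_sum sl2 sl2)"
  proof
    show "?f ` lie_carrier N \<subseteq> lie_carrier (lie_sum sl2 sl2)"
      by (auto simp: lie_sum_def sl2_def trace_pauli)
    show "lie_carrier (lie_sum sl2 sl2) \<subseteq> ?f ` lie_carrier N"
    proof
      fix z assume "z \<in> lie_carrier (lie_sum sl2 sl2)"
      then obtain A B where z: "z = (A, B)" "trace A = 0" "trace B = 0"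
        by (auto simp: lie_sum_def sl2_def)
      from surj_pauli[OF z(2)] obtain p where p: "pauli p = A" .
      from surj_pauli[OF z(3)] obtain q where q: "pauli q = B" .
      from onto[of p q] p q z(1) show "z \<in> ?f ` lie_carrier N" by blast
    qed
  qed
  ultimately have "bij_betw ?f (lie_carrier N) (lie_carrier (lie_sum sl2 sl2))"
    by (simp add: bij_betw_def)
  then show ?thesis
    unfolding lie_isomorphic_def
    by (intro exI[of _ ?f])
       (simp add: P_add Q_add P_scale Q_scale P_br Q_br pauli_add pauli_scale pauli_cprod
         lie_sum_def sl2_def)
qed

end

section \<open>Contractions containing a full line\<close>

text \<open>With \<open>line_v\<close>, the coordinates of the degree \<open>g\<close> part relative
  to the line \<open>{g, k, g + k}\<close>; in \<open>line_v\<close> the point \<open>h\<close>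
  decides which of the two other lines counts positively.\<close>

definition line_u :: "grp \<Rightarrow> grp \<Rightarrow> oct_map \<Rightarrow> complex" where
  "line_u g k d = coord g (map_proj g d) k"

definition line_v :: "grp \<Rightarrow> grp \<Rightarrow> grp \<Rightarrow> oct_map \<Rightarrow> complex" where
  "line_v g k h d = coord g (map_proj g d) h - coord g (map_proj g d) (k + h)"

text \<open>Weights are invariant under \<open>g\<close>, so either of the two other points of the
  line may name it.\<close>

lemma line_u_shift:
  assumes "g \<noteq> 0" "d \<in> g2_carrier"
  shows "line_u g (g + k) d = line_u g k d"
  using weightsD(3)[OF coord_weights[OF assms(1) map_proj_in_comp[OF assms(2)]]]
  by (simp add: line_u_def)

lemma line_v_shift:
  assumes "g \<noteq> 0" "d \<in> g2_carrier"
  shows "line_v g (g + k) h d = line_v g k h d"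
  using weightsD(3)[OF coord_weights[OF assms(1) map_proj_in_comp[OF assms(2)]]]
  by (simp add: line_v_def add.assoc)

lemma line_u_add: "line_u g k (x + y) = line_u g k x + line_u g k y"
  by (simp add: line_u_def map_proj_add)

lemma line_v_add: "line_v g k h (x + y) = line_v g k h x + line_v g k h y"
  by (simp add: line_v_def map_proj_add)

lemma line_u_scale: "line_u g k (map_scale c x) = c * line_u g k x"
  by (simp add: line_u_def map_proj_scale)

lemma line_v_scale: "line_v g k h (map_scale c x) = c * line_v g k h x"
  by (simp add: line_v_def map_proj_scale right_diff_distrib)

lemma map_proj_zero_iff:
  assumes i: "indep g k h" and d: "d \<in> g2_carrier"
  shows "map_proj g d = 0 \<longleftrightarrow> line_u g k d = 0 \<and> line_v g k h d = 0"
  using comp_zeroI[OF i map_proj_in_comp[OF d]] by (auto simp: line_u_def line_v_def)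

context contraction
begin

text \<open>The hypothesis \<open>off\<close> rules out pairs of off-line degrees whose sum is
  \<open>g + k\<close>; pairs involving degree 0 vanish, which leaves \<open>(g, k)\<close> and
  \<open>(k, g)\<close>.\<close>

lemma proj_br_line:
  assumes i: "indep g k h" and x: "x \<in> g2_carrier" and y: "y \<in> g2_carrier"
    and off: "\<And>m. m \<notin> {0, g, k, g + k} \<Longrightarrow> \<epsilon> m (m + (g + k)) = 0"
  shows "map_proj (g + k) (br x y) =
    map_scale (\<epsilon> g k) (map_br (map_proj g x) (map_proj k y)) +
    map_scale (- \<epsilon> g k) (map_br (map_proj g y) (map_proj k x))"
proof -
  note n = indep_nonzero[OF i]
  let ?t = "\<lambda>m. map_scale (\<epsilon> m (m + (g + k))) (map_br (map_proj m x) (map_proj (m + (g + k)) y))"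
  have "?t m = 0" if "m \<notin> {g, k}" for m
  proof -
    have "m = 0 \<or> m = g + k \<or> \<epsilon> m (m + (g + k)) = 0"
      using off[of m] that by auto
    then consider "m = 0" | "m = g + k" | "\<epsilon> m (m + (g + k)) = 0" by argo
    then show ?thesis
      by cases (simp_all add: map_proj_degree_zero x y map_br_zero
        g2_comp_carrier[OF map_proj_in_comp[OF x]] g2_comp_carrier[OF map_proj_in_comp[OF y]] grp_add_self)
  qed
  then have "(\<Sum>m\<in>UNIV. ?t m) = (\<Sum>m\<in>{g, k}. ?t m)"
    by (intro sum.mono_neutral_right) auto
  also have "\<dots> = ?t g + ?t k"
    using n(4) by simp
  also have "?t g = map_scale (\<epsilon> g k) (map_br (map_proj g x) (map_proj k y))"
    by (simp add: grp_add_left)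
  \<comment> \<open>Symmetry of \<open>\<epsilon>\<close> gives the common factor, antisymmetry of
    \<open>map_br\<close> the minus sign.\<close>
  also have "?t k = map_scale (- \<epsilon> g k) (map_br (map_proj g y) (map_proj k x))"
    using eps_symmetric[OF n(1,2,4)]
    by (simp add: grp_ac map_br_def map_scale_def fun_eq_iff vec.scale_right_diff_distrib)
  finally show ?thesis unfolding proj_br[OF x y] .
qed

text \<open>Each coordinate obeys the formula for one component of a cross product, apart from the
  factor \<open>\<epsilon> g k\<close>; \<open>pos\<close> fixes the orientation of the line so that
  no sign is left.\<close>

lemma line_br:
  assumes i: "indep g k h" and x: "x \<in> g2_carrier" and y: "y \<in> g2_carrier"
    and off: "\<And>m. m \<notin> {0, g, k, g + k} \<Longrightarrow> \<epsilon> m (m + (g + k)) = 0"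
    and pos: "octsign g k = 1"
  shows "line_u (g + k) g (br x y) = \<epsilon> g k * (line_u g k x * line_u k g y - line_u g k y * line_u k g x)"
    and "line_v (g + k) g h (br x y) =
      \<epsilon> g k * (line_v g k h x * line_v k g h y - line_v g k h y * line_v k g h x)"
proof -
  note n = indep_nonzero[OF i]
  have pr: "map_proj (g + k) (br x y) =
      map_scale (\<epsilon> g k) (map_br (map_proj g x) (map_proj k y)) +
      map_scale (- \<epsilon> g k) (map_br (map_proj g y) (map_proj k x))"
    by (rule proj_br_line[OF i x y]) (rule off)
  note px = map_proj_in_comp[OF x] and py = map_proj_in_comp[OF y]
  show "line_u (g + k) g (br x y) = \<epsilon> g k * (line_u g k x * line_u k g y - line_u g k y * line_u k g x)"
    using coord_map_br_line[OF n(1,2,4) px py] coord_map_br_line[OF n(1,2,4) py px]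
    unfolding line_u_def pr coord_simps by (simp add: pos algebra_simps)
  let ?A = "map_br (map_proj g x) (map_proj k y)" and ?B = "map_br (map_proj g y) (map_proj k x)"
  have "line_v (g + k) g h (br x y) = \<epsilon> g k * (coord (g + k) ?A h - coord (g + k) ?A (g + h))
     - \<epsilon> g k * (coord (g + k) ?B h - coord (g + k) ?B (g + h))"
    unfolding line_v_def pr coord_simps by (simp add: algebra_simps)
  also have "\<dots> = \<epsilon> g k * (line_v g k h x * line_v k g h y - line_v g k h y * line_v k g h x)"
    unfolding coord_diff_map_br[OF n(1,2,4) px py i] coord_diff_map_br[OF n(1,2,4) py px i]
    by (simp add: line_v_def pos algebra_simps)
  finally show "line_v (g + k) g h (br x y) =
      \<epsilon> g k * (line_v g k h x * line_v k g h y - line_v g k h y * line_v k g h x)" .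
qed

lemma internal_direct_sum_g2_sum:
  assumes "A \<union> B = idx" "A \<inter> B = {}"
  shows "internal_direct_sum g2_carrier (g2_sum A) (g2_sum B)"
  unfolding internal_direct_sum_def
proof
  have sub: "A \<subseteq> idx" "B \<subseteq> idx" "finite A" "finite B"
    using assms(1) finite_subset[OF _ finite_idx] by blast+
  show "g2_carrier = {u + v | u v. u \<in> g2_sum A \<and> v \<in> g2_sum B}"
  proof
    show "g2_carrier \<subseteq> {u + v | u v. u \<in> g2_sum A \<and> v \<in> g2_sum B}"
    proof
      fix d assume d: "d \<in> g2_carrier"
      have "(\<Sum>i\<in>A. map_proj (gr i) d) + (\<Sum>i\<in>B. map_proj (gr i) d) = d"
        using carrier_decomposition[OF d] sum.union_disjoint[OF sub(3,4) assms(2)] assms(1) by metis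
      then have "d = (\<Sum>i\<in>A. map_proj (gr i) d) + (\<Sum>i\<in>B. map_proj (gr i) d)" ..
      moreover have "(\<Sum>i\<in>A. map_proj (gr i) d) \<in> g2_sum A" "(\<Sum>i\<in>B. map_proj (gr i) d) \<in> g2_sum B"
        unfolding g2_sum_def using map_proj_in_comp[OF d] by blast+
      ultimately show "d \<in> {u + v | u v. u \<in> g2_sum A \<and> v \<in> g2_sum B}" by blast
    qed
    show "{u + v | u v. u \<in> g2_sum A \<and> v \<in> g2_sum B} \<subseteq> g2_carrier"
      using maps.subspace_add[OF subspace_g2_carrier] sub by (auto simp: g2_sum_iff)
  qed
  show "g2_sum A \<inter> g2_sum B = {0}"
  proof -
    have "d = 0" if "d \<in> g2_sum A" "d \<in> g2_sum B" for d
    proof -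
      have d: "d \<in> g2_carrier" and "\<forall>i\<in>idx. map_proj (gr i) d = 0"
        using that sub assms(2) by (auto simp: g2_sum_iff)
      then have "(\<Sum>i\<in>idx. map_proj (gr i) d) = 0" by (simp add: sum.neutral)
      with carrier_decomposition[OF d] show ?thesis by simp
    qed
    then show ?thesis
      using maps.subspace_0[OF subspace_g2_sum] sub by blast
  qed
qed

end

text \<open>Edges joining \<open>{1, 2, 5}\<close> to \<open>{3, 4, 6, 7}\<close> are left free.
  This covers both the support consisting of the line alone and the one missing exactly the edges
  inside \<open>{3, 4, 6, 7}\<close>.\<close>

locale line_contraction = contraction +
  assumes line: "{1, 2} \<in> T" "{1, 5} \<in> T" "{2, 5} \<in> T"
    and off_line: "i \<in> {3, 4, 6, 7} \<Longrightarrow> j \<in> {3, 4, 6, 7} \<Longrightarrow> {i, j} \<notin> T"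
begin

abbreviation "g\<^sub>1 \<equiv> gr 1"
abbreviation "g\<^sub>2 \<equiv> gr 2"
abbreviation "g\<^sub>5 \<equiv> gr 5"
abbreviation "h \<equiv> gr 3"

lemma line_eps: "\<epsilon> g\<^sub>1 g\<^sub>2 \<noteq> 0" "\<epsilon> g\<^sub>1 g\<^sub>5 \<noteq> 0" "\<epsilon> g\<^sub>2 g\<^sub>5 \<noteq> 0"
  using line by (simp_all only: edge_iff simp_thms)

lemma off_eps:
  assumes "m \<notin> {0, g\<^sub>1, g\<^sub>2, g\<^sub>5}" "l \<in> {g\<^sub>1, g\<^sub>2, g\<^sub>5}"
  shows "\<epsilon> m (m + l) = 0"
proof -
  \<comment> \<open>The line together with 0 is a subgroup of index 2, so \<open>m\<close> and
    \<open>m + l\<close> both lie in its other coset.\<close>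
  have l: "l \<noteq> 0" "m + l \<notin> {0, g\<^sub>1, g\<^sub>2, g\<^sub>5}"
    using assms by (cases m; auto simp: grp_zero)+
  have "n \<in> gr ` {3, 4, 6, 7}" if "n \<notin> {0, g\<^sub>1, g\<^sub>2, g\<^sub>5}" for n
  proof -
    have "n \<in> gr ` idx" using that by (simp add: gr_image_idx)
    then show ?thesis using that by (auto simp: idx_eq)
  qed
  from this[OF assms(1)] this[OF l(2)] obtain i j where
    ij: "i \<in> {3, 4, 6, 7}" "m = gr i" "j \<in> {3, 4, 6, 7}" "m + l = gr j" by blast
  then have "i \<noteq> j" using l(1) by auto
  moreover have "i \<in> idx" "j \<in> idx" using ij by (auto simp: idx_def)
  ultimately show ?thesis using off_line[OF ij(1,3)] ij by (simp add: edge_iff)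
qed

text \<open>The three scales are to solve the equations in \<open>scale_mult\<close>. Multiplying
  the first equation by the third, or by the second, determines the squares of
  \<open>scale\<^sub>1\<close> and \<open>scale\<^sub>2\<close>; the first then gives
  \<open>scale\<^sub>5\<close>.\<close>

definition scale\<^sub>1 :: complex where "scale\<^sub>1 = csqrt (\<epsilon> g\<^sub>1 g\<^sub>2 * \<epsilon> g\<^sub>1 g\<^sub>5)"
definition scale\<^sub>2 :: complex where "scale\<^sub>2 = csqrt (\<epsilon> g\<^sub>1 g\<^sub>2 * \<epsilon> g\<^sub>2 g\<^sub>5)"
definition scale\<^sub>5 :: complex where "scale\<^sub>5 = scale\<^sub>1 * scale\<^sub>2 / \<epsilon> g\<^sub>1 g\<^sub>2"

lemma scale_nonzero: "scale\<^sub>1 \<noteq> 0" "scale\<^sub>2 \<noteq> 0" "scale\<^sub>5 \<noteq> 0"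
  using line_eps by (simp_all add: scale\<^sub>1_def scale\<^sub>2_def scale\<^sub>5_def)

lemma scale_mult:
  "scale\<^sub>5 * \<epsilon> g\<^sub>1 g\<^sub>2 = scale\<^sub>1 * scale\<^sub>2" "scale\<^sub>1 * \<epsilon> g\<^sub>2 g\<^sub>5 = scale\<^sub>2 * scale\<^sub>5"
  "scale\<^sub>2 * \<epsilon> g\<^sub>5 g\<^sub>1 = scale\<^sub>5 * scale\<^sub>1"
proof -
  have sq: "scale\<^sub>1 * scale\<^sub>1 = \<epsilon> g\<^sub>1 g\<^sub>2 * \<epsilon> g\<^sub>1 g\<^sub>5" "scale\<^sub>2 * scale\<^sub>2 = \<epsilon> g\<^sub>1 g\<^sub>2 * \<epsilon> g\<^sub>2 g\<^sub>5"
    unfolding scale\<^sub>1_def scale\<^sub>2_def by (simp_all only: power2_eq_square[symmetric] power2_csqrt)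
  show "scale\<^sub>5 * \<epsilon> g\<^sub>1 g\<^sub>2 = scale\<^sub>1 * scale\<^sub>2"
    using line_eps(1) by (simp add: scale\<^sub>5_def)
  have "scale\<^sub>2 * scale\<^sub>5 = scale\<^sub>1 * (scale\<^sub>2 * scale\<^sub>2) / \<epsilon> g\<^sub>1 g\<^sub>2"
    by (simp add: scale\<^sub>5_def)
  then show "scale\<^sub>1 * \<epsilon> g\<^sub>2 g\<^sub>5 = scale\<^sub>2 * scale\<^sub>5"
    using line_eps(1) by (simp add: sq)
  have "scale\<^sub>5 * scale\<^sub>1 = scale\<^sub>2 * (scale\<^sub>1 * scale\<^sub>1) / \<epsilon> g\<^sub>1 g\<^sub>2"
    by (simp add: scale\<^sub>5_def)
  moreover have "\<epsilon> g\<^sub>5 g\<^sub>1 = \<epsilon> g\<^sub>1 g\<^sub>5"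
    by (rule eps_symmetric) (simp_all add: grp_zero)
  ultimately show "scale\<^sub>2 * \<epsilon> g\<^sub>5 g\<^sub>1 = scale\<^sub>5 * scale\<^sub>1"
    using line_eps(1) by (simp add: sq)
qed

text \<open>With the \<open>\<epsilon>\<close> values scaled away, \<open>P\<close> and
  \<open>Q\<close> restricted to \<open>g2_sum {1, 2, 5}\<close> become the projections to its two
  simple factors.\<close>

definition P :: "oct_map \<Rightarrow> complex ^ 3" where
  "P x = vector [scale\<^sub>1 * line_u g\<^sub>1 g\<^sub>2 x, scale\<^sub>2 * line_u g\<^sub>2 g\<^sub>1 x, scale\<^sub>5 * line_u g\<^sub>5 g\<^sub>1 x]"

definition Q :: "oct_map \<Rightarrow> complex ^ 3" where
  "Q x = vector [scale\<^sub>1 * line_v g\<^sub>1 g\<^sub>2 h x, scale\<^sub>2 * line_v g\<^sub>2 g\<^sub>1 h x, scale\<^sub>5 * line_v g\<^sub>5 g\<^sub>1 h x]"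

lemma line_indep:
  "indep g\<^sub>1 g\<^sub>2 h" "indep g\<^sub>2 g\<^sub>5 h" "indep g\<^sub>5 g\<^sub>1 h" "indep g\<^sub>2 g\<^sub>1 h"
  by (simp_all add: indep_def grp_zero)

lemma line_sum: "g\<^sub>1 + g\<^sub>2 = g\<^sub>5" "g\<^sub>2 + g\<^sub>5 = g\<^sub>1" "g\<^sub>5 + g\<^sub>1 = g\<^sub>2" "g\<^sub>2 + g\<^sub>1 = g\<^sub>5" "g\<^sub>1 + g\<^sub>5 = g\<^sub>2" "g\<^sub>5 + g\<^sub>2 = g\<^sub>1"
  by simp_all

lemma line_octsign: "octsign g\<^sub>1 g\<^sub>2 = 1" "octsign g\<^sub>2 g\<^sub>5 = 1" "octsign g\<^sub>5 g\<^sub>1 = 1"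
  by (simp_all add: octsign_def octphase_def)

lemma line_nonzero: "g\<^sub>1 \<noteq> 0" "g\<^sub>2 \<noteq> 0" "g\<^sub>5 \<noteq> 0"
  by (simp_all add: grp_zero)

lemma line_shifts:
  assumes "d \<in> g2_carrier"
  shows "line_u g\<^sub>2 g\<^sub>5 d = line_u g\<^sub>2 g\<^sub>1 d" "line_u g\<^sub>5 g\<^sub>2 d = line_u g\<^sub>5 g\<^sub>1 d" "line_u g\<^sub>1 g\<^sub>5 d = line_u g\<^sub>1 g\<^sub>2 d"
    "line_v g\<^sub>2 g\<^sub>5 h d = line_v g\<^sub>2 g\<^sub>1 h d" "line_v g\<^sub>5 g\<^sub>2 h d = line_v g\<^sub>5 g\<^sub>1 h d" "line_v g\<^sub>1 g\<^sub>5 h d = line_v g\<^sub>1 g\<^sub>2 h d"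
  using line_u_shift[OF line_nonzero(2) assms, of g\<^sub>1] line_u_shift[OF line_nonzero(3) assms, of g\<^sub>1]
    line_u_shift[OF line_nonzero(1) assms, of g\<^sub>2] line_v_shift[OF line_nonzero(2) assms, of g\<^sub>1]
    line_v_shift[OF line_nonzero(3) assms, of g\<^sub>1] line_v_shift[OF line_nonzero(1) assms, of g\<^sub>2]
  unfolding line_sum by simp_all

lemma PQ_br:
  assumes x: "x \<in> g2_carrier" and y: "y \<in> g2_carrier"
  shows "P (br x y) = cprod (P x) (P y)" "Q (br x y) = cprod (Q x) (Q y)"
proof -
  have off: "\<epsilon> m (m + (g\<^sub>1 + g\<^sub>2)) = 0" if "m \<notin> {0, g\<^sub>1, g\<^sub>2, g\<^sub>1 + g\<^sub>2}" for m
    using off_eps[of m g\<^sub>5] that unfolding line_sum by blast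
  have off': "\<epsilon> m (m + (g\<^sub>2 + g\<^sub>5)) = 0" if "m \<notin> {0, g\<^sub>2, g\<^sub>5, g\<^sub>2 + g\<^sub>5}" for m
    using off_eps[of m g\<^sub>1] that unfolding line_sum by blast
  have off'': "\<epsilon> m (m + (g\<^sub>5 + g\<^sub>1)) = 0" if "m \<notin> {0, g\<^sub>5, g\<^sub>1, g\<^sub>5 + g\<^sub>1}" for m
    using off_eps[of m g\<^sub>2] that unfolding line_sum by blast
  note b = line_br[OF line_indep(1) x y off line_octsign(1), unfolded line_sum]
    line_br[OF line_indep(2) x y off' line_octsign(2), unfolded line_sum]
    line_br[OF line_indep(3) x y off'' line_octsign(3), unfolded line_sum]
  note sh = line_shifts[OF x] line_shifts[OF y] line_shifts[OF br_closed[OF x y]]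
  \<comment> \<open>How an equation of \<open>scale_mult\<close> moves the factor
    \<open>\<epsilon>\<close> into the coordinates.\<close>
  have scaled: "r * (c * (a * b - a' * b')) = s * a * (t * b) - s * a' * (t * b')"
    if "r * c = s * t" for r c s t a b a' b' :: complex
    using that by algebra
  show "P (br x y) = cprod (P x) (P y)"
    using scaled[OF scale_mult(1)] scaled[OF scale_mult(2)] scaled[OF scale_mult(3)] b sh
    by (simp add: P_def cprod_def vec_eq_iff forall_3 del: gr_simps)
  show "Q (br x y) = cprod (Q x) (Q y)"
    using scaled[OF scale_mult(1)] scaled[OF scale_mult(2)] scaled[OF scale_mult(3)] b sh
    by (simp add: Q_def cprod_def vec_eq_iff forall_3 del: gr_simps)
qed

text \<open>The preimages are found inside \<open>g2_sum {1, 2, 5}\<close>, so the same fact serves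
  the whole algebra and this subalgebra.\<close>

lemma PQ_onto: "\<exists>x\<in>g2_sum {1, 2, 5}. P x = p \<and> Q x = q"
proof -
  from comp_exists[OF line_indep(1)] obtain x where x: "x \<in> g2_comp g\<^sub>1"
    "coord g\<^sub>1 x g\<^sub>2 = p$1 / scale\<^sub>1" "coord g\<^sub>1 x h - coord g\<^sub>1 x (g\<^sub>2 + h) = q$1 / scale\<^sub>1" .
  from comp_exists[OF line_indep(4)] obtain y where y: "y \<in> g2_comp g\<^sub>2"
    "coord g\<^sub>2 y g\<^sub>1 = p$2 / scale\<^sub>2" "coord g\<^sub>2 y h - coord g\<^sub>2 y (g\<^sub>1 + h) = q$2 / scale\<^sub>2" .
  from comp_exists[OF line_indep(3)] obtain z where z: "z \<in> g2_comp g\<^sub>5"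
    "coord g\<^sub>5 z g\<^sub>1 = p$3 / scale\<^sub>5" "coord g\<^sub>5 z h - coord g\<^sub>5 z (g\<^sub>1 + h) = q$3 / scale\<^sub>5" .
  have pr: "map_proj g\<^sub>1 (x + y + z) = x" "map_proj g\<^sub>2 (x + y + z) = y" "map_proj g\<^sub>5 (x + y + z) = z"
    by (simp_all add: map_proj_add map_proj_comp[OF x(1)] map_proj_comp[OF y(1)] map_proj_comp[OF z(1)])
  have J: "{1, 2, 5} \<subseteq> idx" by (simp add: idx_def)
  have "x \<in> g2_sum {1, 2, 5}" "y \<in> g2_sum {1, 2, 5}" "z \<in> g2_sum {1, 2, 5}"
    using comp_subset_g2_sum[OF J, of 1] comp_subset_g2_sum[OF J, of 2] comp_subset_g2_sum[OF J, of 5]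
      x(1) y(1) z(1) by blast+
  then have "x + y + z \<in> g2_sum {1, 2, 5}"
    by (intro maps.subspace_add[OF subspace_g2_sum[OF J]])
  moreover have "P (x + y + z) = p"
    unfolding P_def line_u_def pr x(2) y(2) z(2) using scale_nonzero by (simp add: vec_eq_iff forall_3)
  moreover have "Q (x + y + z) = q"
    unfolding Q_def line_v_def pr x(3) y(3) z(3) using scale_nonzero by (simp add: vec_eq_iff forall_3)
  ultimately show ?thesis by blast
qed

text \<open>In each of the degrees 1, 2 and 5, the coordinates \<open>u\<close> and \<open>v\<close>
  together determine the component.\<close>

lemma PQ_zero_iff:
  assumes d: "d \<in> g2_carrier"
  shows "P d = 0 \<and> Q d = 0 \<longleftrightarrow> d \<in> g2_sum {3, 4, 6, 7}"
proof -
  have "P d = 0 \<and> Q d = 0 \<longleftrightarrow> map_proj g\<^sub>1 d = 0 \<and> map_proj g\<^sub>2 d = 0 \<and> map_proj g\<^sub>5 d = 0"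
    unfolding map_proj_zero_iff[OF line_indep(1) d] map_proj_zero_iff[OF line_indep(3) d]
      map_proj_zero_iff[OF line_indep(4) d]
    using scale_nonzero by (auto simp: P_def Q_def vec_eq_iff forall_3 simp del: gr_simps)
  moreover have "{3, 4, 6, 7} \<subseteq> idx" "idx - {3, 4, 6, 7} = {1, 2, 5}" by (auto simp: idx_eq)
  ultimately show ?thesis using d by (simp add: g2_sum_iff del: gr_simps)
qed

lemma off_line_abelian:
  assumes "x \<in> g2_sum {3, 4, 6, 7}" "y \<in> g2_sum {3, 4, 6, 7}"
  shows "br x y = 0"
proof -
  have "star_reach T {3, 4, 6, 7} {3, 4, 6, 7} = {}"
    unfolding star_reach_def using off_line by blast
  then show ?thesis
    using br_in_star_reach[OF _ _ assms] by (simp add: idx_def g2_sum_empty)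
qed

lemma PQ_linear:
  "P (x + y) = P x + P y" "Q (x + y) = Q x + Q y"
  "P (map_scale c x) = c *s P x" "Q (map_scale c x) = c *s Q x"
  by (simp_all add: P_def Q_def line_u_add line_v_add line_u_scale line_v_scale vec_eq_iff forall_3
    algebra_simps del: gr_simps)

lemma restrict_simps:
  "lie_carrier (lie_restrict M S) = S" "lie_scale (lie_restrict M S) = map_scale"
  "lie_br (lie_restrict M S) = br"
  by (simp_all add: lie_restrict_def)

lemma subset_idx: "{1, 2, 5} \<subseteq> idx" "{3, 4, 6, 7} \<subseteq> idx"
  by (simp_all add: idx_def)

lemma line_subset_carrier: "g2_sum {1, 2, 5} \<subseteq> g2_carrier" "g2_sum {3, 4, 6, 7} \<subseteq> g2_carrier"
  using g2_sum_iff[OF subset_idx(1)] g2_sum_iff[OF subset_idx(2)] by blast+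

lemma line_decomposition: "internal_direct_sum g2_carrier (g2_sum {3, 4, 6, 7}) (g2_sum {1, 2, 5})"
  by (rule internal_direct_sum_g2_sum) (auto simp: idx_eq)

lemma line_closed:
  assumes "x \<in> g2_sum {1, 2, 5}" "y \<in> g2_sum {1, 2, 5}"
  shows "br x y \<in> g2_sum {1, 2, 5}"
proof -
  have "star_reach T {1, 2, 5} {1, 2, 5} \<subseteq> {1, 2, 5}"
    unfolding star_reach_def using istar_values edge_iff by auto
  then show ?thesis
    using br_in_star_reach[OF subset_idx(1,1) assms] g2_sum_mono[OF _ subset_idx(1)] by blast
qed

text \<open>Yields the radical of the contraction.\<close>

sublocale whole: cross_quotient M P Q
proof (rule cross_quotient.intro, unfold g2_contr_simps)
  show "br x y = 0" if "x \<in> g2_carrier" "P x = 0" "Q x = 0" "y \<in> g2_carrier" "P y = 0" "Q y = 0" for x y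
    using that PQ_zero_iff off_line_abelian by blast
  show "\<exists>x\<in>g2_carrier. P x = p \<and> Q x = q" for p q
    using PQ_onto line_subset_carrier(1) by blast
qed (simp_all add: vector_space_map_scale subspace_g2_carrier br_closed PQ_linear PQ_br)

text \<open>Yields semisimplicity of the complement and its isomorphism type.\<close>

sublocale levi: cross_quotient "lie_restrict M (g2_sum {1, 2, 5})" P Q
proof (rule cross_quotient.intro, unfold restrict_simps)
  show "br x y = 0" if "x \<in> g2_sum {1, 2, 5}" "P x = 0" "Q x = 0" "y \<in> g2_sum {1, 2, 5}" "P y = 0" "Q y = 0" for x y
    using that PQ_zero_iff off_line_abelian line_subset_carrier(1) by blast
  show "\<exists>x\<in>g2_sum {1, 2, 5}. P x = p \<and> Q x = q" for p q
    by (rule PQ_onto)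
  show "P (br x y) = cprod (P x) (P y)" "Q (br x y) = cprod (Q x) (Q y)"
    if "x \<in> g2_sum {1, 2, 5}" "y \<in> g2_sum {1, 2, 5}" for x y
    using that PQ_br line_subset_carrier(1) by blast+
qed (simp_all add: vector_space_map_scale subspace_g2_sum[OF subset_idx(1)] line_closed PQ_linear
    del: One_nat_def)

section \<open>Radical, Levi subalgebra and its uniqueness\<close>

lemma lie_radical_line: "lie_radical M = g2_sum {3, 4, 6, 7}"
  unfolding whole.lie_radical_kernel whole.kernel_def
  using PQ_zero_iff line_subset_carrier(2) by auto

lemma levi_kernel: "levi.kernel = {0}"
proof -
  have "levi.kernel = g2_sum {3, 4, 6, 7} \<inter> g2_sum {1, 2, 5}"
    unfolding levi.kernel_def restrict_simps using PQ_zero_iff line_subset_carrier(1) by blast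
  then show ?thesis using line_decomposition by (simp add: internal_direct_sum_def)
qed

lemma line_isomorphic: "lie_isomorphic (lie_restrict M (g2_sum {1, 2, 5})) (lie_sum sl2 sl2)"
  by (rule levi.isomorphic_sl2_sl2[OF levi_kernel])

lemma off_line_ideal: "lie_ideal M (g2_sum {3, 4, 6, 7})"
  using whole.kernel_ideal whole.lie_radical_kernel lie_radical_line by simp

lemma line_levi: "levi_subalgebra M (g2_sum {1, 2, 5})"
  using line_subset_carrier(1) subspace_g2_sum[OF subset_idx(1)] line_closed line_decomposition
    levi.lie_radical_kernel levi_kernel
  by (simp add: levi_subalgebra_def lie_subalgebra_def lie_semisimple_def lie_radical_line)

lemma line_levi_decomposition: "levi_decomposition M (lie_radical M) (g2_sum {1, 2, 5})"
  using line_levi by (simp add: levi_decomposition_def levi_subalgebra_def)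

text \<open>If the radical is central, brackets see only components in \<open>S\<close>, so the
  derived algebra lies in \<open>S\<close>; two nested complements of the radical are equal. This
  justifies speaking of the Levi subalgebra in the reductive case.\<close>

lemma levi_unique:
  assumes center: "lie_center M = lie_radical M" and der: "lie_derived M = g2_sum {1, 2, 5}"
    and S: "levi_subalgebra M S"
  shows "S = g2_sum {1, 2, 5}"
proof
  let ?R = "lie_radical M"
  have sub: "S \<subseteq> g2_carrier" and sp: "maps.subspace S" and cl: "\<And>x y. x \<in> S \<Longrightarrow> y \<in> S \<Longrightarrow> br x y \<in> S"
    and dec: "g2_carrier = {u + v | u v. u \<in> ?R \<and> v \<in> S}" and int: "?R \<inter> S = {0}"
    using S by (auto simp: levi_subalgebra_def lie_subalgebra_def internal_direct_sum_def)
  have R: "u \<in> g2_carrier" "br u y = 0" "br y u = 0" if "u \<in> ?R" "y \<in> g2_carrier" for u y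
    using that br_swap[of u y] unfolding center[symmetric] by (auto simp: lie_center_def)
  \<comment> \<open>Writing both arguments as radical part plus part in \<open>S\<close>, the
    central radical parts drop out.\<close>
  have "br x y \<in> S" if xy: "x \<in> g2_carrier" "y \<in> g2_carrier" for x y
  proof -
    from xy dec obtain u v u' v' where "x = u + v" "u \<in> ?R" "v \<in> S" "y = u' + v'" "u' \<in> ?R" "v' \<in> S"
      by blast
    moreover from this have "u \<in> g2_carrier" "u' \<in> g2_carrier" "v \<in> g2_carrier" "v' \<in> g2_carrier"
      using R(1)[OF _ xy(1)] sub by auto
    ultimately have "br x y = br v v'"
      using xy R(2)[of u] R(3)[of u'] br_add_left[of u v y] br_add_right[of u' v' v] by simp
    with cl[OF \<open>v \<in> S\<close> \<open>v' \<in> S\<close>] show ?thesis by simp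
  qed
  then show D: "g2_sum {1, 2, 5} \<subseteq> S"
    unfolding der[symmetric] lie_prod_def g2_contr_simps by (intro maps.span_minimal sp) auto
  show "S \<subseteq> g2_sum {1, 2, 5}"
  proof
    fix s assume s: "s \<in> S"
    have "s \<in> {u + v | u v. u \<in> ?R \<and> v \<in> g2_sum {1, 2, 5}}"
      using s sub line_decomposition unfolding internal_direct_sum_def lie_radical_line by auto
    then obtain u v where uv: "s = u + v" "u \<in> ?R" "v \<in> g2_sum {1, 2, 5}" by auto
    then have "u = s - v" by simp
    \<comment> \<open>\<open>v\<close> lies in the derived algebra and hence in \<open>S\<close>, so
      the radical part \<open>u\<close> of \<open>s\<close> lies in \<open>S\<close> too and must be
      0.\<close>
    then have "u \<in> ?R \<inter> S"
      using uv D maps.subspace_diff[OF sp s, of v] by blast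
    with int uv show "s \<in> g2_sum {1, 2, 5}" by simp
  qed
qed

end

section \<open>The classification\<close>

lemma edges_eq: "edges = {{1, 2}, {1, 3}, {1, 4}, {1, 5}, {1, 6}, {1, 7}, {2, 3}, {2, 4}, {2, 5},
  {2, 6}, {2, 7}, {3, 4}, {3, 5}, {3, 6}, {3, 7}, {4, 5}, {4, 6}, {4, 7}, {5, 6}, {5, 7}, {6, 7}}"
proof -
  have "edges = (\<Union>i\<in>idx. \<Union>j\<in>idx - {i}. {{i, j}})"
    unfolding edges_def by auto
  also have "\<dots> = {{1, 2}, {1, 3}, {1, 4}, {1, 5}, {1, 6}, {1, 7}, {2, 3}, {2, 4}, {2, 5},
  {2, 6}, {2, 7}, {3, 4}, {3, 5}, {3, 6}, {3, 7}, {4, 5}, {4, 6}, {4, 7}, {5, 6}, {5, 7}, {6, 7}}"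
    unfolding idx_eq by (simp add: insert_commute insert_Diff_if)
  finally show ?thesis .
qed

lemma line_complement_eq:
  "edges - {{3, 4}, {3, 6}, {3, 7}, {4, 6}, {4, 7}, {6, 7}} =
   {{1, 2}, {1, 3}, {1, 4}, {1, 5}, {1, 6}, {1, 7}, {2, 3}, {2, 4}, {2, 5}, {2, 6}, {2, 7},
    {3, 5}, {4, 5}, {5, 6}, {5, 7}}"
  unfolding edges_eq by (simp add: insert_Diff_if doubleton_eq_iff)

lemmas reach_simps = star_reach_insert star_reach_empty istar_values idx_eq

theorem theorem5p1:
  fixes \<epsilon> :: "grp \<Rightarrow> grp \<Rightarrow> complex"
    and M :: "oct_map lie_alg"
    and T :: "nat set set"
  assumes "graded_contraction \<epsilon>"
    and "admissible \<epsilon>"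
    and "M = g2_contr \<epsilon>"
    and "T = eta_support \<epsilon>"
  shows
    "(T = {} \<longrightarrow>
        lie_abelian M) \<and>
     (T = {{1, 2}} \<longrightarrow>
        lie_center M = g2_sum {3, 4, 5, 6, 7} \<and> lie_dim M (lie_center M) = 10 \<and>
        lie_derived M = g2_sum {5} \<and> lie_dim M (lie_derived M) = 2 \<and>
        lie_der M 2 = {0} \<and> lie_lower M 2 = {0} \<and> step_nilpotent 2 M) \<and>
     (T = {{1, 2}, {1, 3}} \<longrightarrow>
        lie_center M = g2_sum {4, 5, 6, 7} \<and> lie_dim M (lie_center M) = 8 \<and>
        lie_derived M = g2_sum {5, 6} \<and> lie_dim M (lie_derived M) = 4 \<and>
        lie_der M 2 = {0} \<and> lie_lower M 2 = {0} \<and> step_nilpotent 2 M) \<and>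
     (T = {{1, 2}, {1, 5}} \<longrightarrow>
        lie_center M = g2_sum {3, 4, 6, 7} \<and> lie_dim M (lie_center M) = 8 \<and>
        lie_derived M = g2_sum {2, 5} \<and>
        (\<forall>n\<ge>1. lie_lower M n = g2_sum {2, 5}) \<and>
        lie_dim M (lie_derived M) = 4 \<and> \<not> lie_nilpotent M \<and>
        lie_der M 2 = {0} \<and> step_solvable 2 M) \<and>
     (T = {{1, 2}, {6, 7}} \<longrightarrow>
        lie_center M = g2_sum {3, 4, 5} \<and> lie_dim M (lie_center M) = 6 \<and>
        lie_derived M = g2_sum {5} \<and> lie_dim M (lie_derived M) = 2 \<and>
        lie_der M 2 = {0} \<and> lie_lower M 2 = {0} \<and> step_nilpotent 2 M) \<and>
     (T = {{1, 2}, {1, 5}, {2, 5}} \<longrightarrow>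
        lie_center M = g2_sum {3, 4, 6, 7} \<and> lie_radical M = g2_sum {3, 4, 6, 7} \<and>
        lie_dim M (lie_center M) = 8 \<and> lie_reductive M \<and>
        lie_derived M = g2_sum {1, 2, 5} \<and>
        (\<forall>n\<ge>1. lie_der M n = g2_sum {1, 2, 5}) \<and>
        (\<forall>n\<ge>1. lie_lower M n = g2_sum {1, 2, 5}) \<and> \<not> lie_nilpotent M \<and>
        \<not> lie_solvable M \<and>
        lie_isomorphic (lie_restrict M (lie_derived M)) (lie_sum sl2 sl2) \<and>
        (\<forall>S. levi_subalgebra M S \<longleftrightarrow> S = lie_derived M) \<and>
        levi_decomposition M (lie_center M) (lie_derived M)) \<and>
     (T = {{2, 5}, {3, 6}, {4, 7}} \<longrightarrow>
        lie_center M = g2_sum {1} \<and> lie_derived M = g2_sum {1} \<and>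
        lie_dim M (lie_center M) = 2 \<and> lie_der M 2 = {0} \<and> lie_lower M 2 = {0} \<and>
        step_nilpotent 2 M) \<and>
     (T = {{1, 2}, {1, 3}, {1, 4}} \<longrightarrow>
        lie_center M = g2_sum {5, 6, 7} \<and> lie_derived M = g2_sum {5, 6, 7} \<and>
        lie_dim M (lie_center M) = 6 \<and> lie_der M 2 = {0} \<and> lie_lower M 2 = {0} \<and>
        step_nilpotent 2 M) \<and>
     (T = {{1, 2}, {1, 3}, {1, 5}} \<longrightarrow>
        lie_center M = g2_sum {4, 6, 7} \<and> lie_dim M (lie_center M) = 6 \<and>
        lie_derived M = g2_sum {2, 5, 6} \<and> lie_dim M (lie_derived M) = 6 \<and>
        lie_der M 2 = {0} \<and> step_solvable 2 M \<and>
        (\<forall>n\<ge>2. lie_lower M n = g2_sum {2, 5}) \<and> \<not> lie_nilpotent M) \<and>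
     (T = {{1, 2}, {1, 6}, {2, 6}} \<longrightarrow>
        lie_center M = g2_sum {3, 4, 5, 7} \<and> lie_dim M (lie_center M) = 8 \<and>
        lie_derived M = g2_sum {3, 4, 5} \<and> lie_dim M (lie_derived M) = 6 \<and>
        lie_der M 2 = {0} \<and> lie_lower M 2 = {0} \<and> step_nilpotent 2 M) \<and>
     (T = {{1, 2}, {1, 6}, {6, 7}} \<longrightarrow>
        lie_center M = g2_sum {3, 4, 5} \<and> lie_dim M (lie_center M) = 6 \<and>
        lie_derived M = g2_sum {3, 5} \<and> lie_dim M (lie_derived M) = 4 \<and>
        lie_der M 2 = {0} \<and> lie_lower M 2 = {0} \<and> step_nilpotent 2 M) \<and>
     (T = {{1, 2}, {1, 3}, {1, 4}, {1, 5}} \<longrightarrow>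
        lie_center M = g2_sum {6, 7} \<and> lie_dim M (lie_center M) = 4 \<and>
        lie_derived M = g2_sum {2, 5, 6, 7} \<and> lie_dim M (lie_derived M) = 8 \<and>
        lie_der M 2 = {0} \<and> step_solvable 2 M \<and>
        (\<forall>n\<ge>2. lie_lower M n = g2_sum {2, 5}) \<and> \<not> lie_nilpotent M) \<and>
     (T = {{1, 2}, {1, 3}, {1, 5}, {1, 6}} \<longrightarrow>
        lie_center M = g2_sum {4, 7} \<and> lie_dim M (lie_center M) = 4 \<and>
        lie_derived M = g2_sum {2, 3, 5, 6} \<and>
        (\<forall>n\<ge>1. lie_lower M n = g2_sum {2, 3, 5, 6}) \<and>
        lie_dim M (lie_derived M) = 8 \<and> \<not> lie_nilpotent M \<and>
        lie_der M 2 = {0} \<and> step_solvable 2 M) \<and>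
     (T = {{1, 2}, {1, 6}, {1, 7}, {2, 6}} \<longrightarrow>
        lie_center M = g2_sum {3, 4, 5} \<and> lie_derived M = g2_sum {3, 4, 5} \<and>
        lie_dim M (lie_center M) = 6 \<and> lie_der M 2 = {0} \<and> lie_lower M 2 = {0} \<and>
        step_nilpotent 2 M) \<and>
     (T = {{1, 2}, {1, 6}, {2, 7}, {6, 7}} \<longrightarrow>
        lie_center M = g2_sum {3, 4, 5} \<and> lie_dim M (lie_center M) = 6 \<and>
        lie_derived M = g2_sum {3, 5} \<and> lie_dim M (lie_derived M) = 4 \<and>
        lie_der M 2 = {0} \<and> lie_lower M 2 = {0} \<and> step_nilpotent 2 M) \<and>
     (T = {{1, 2}, {1, 3}, {1, 4}, {1, 5}, {1, 6}} \<longrightarrow>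
        lie_center M = g2_sum {7} \<and> lie_dim M (lie_center M) = 2 \<and>
        lie_derived M = g2_sum {2, 3, 5, 6, 7} \<and> lie_dim M (lie_derived M) = 10 \<and>
        lie_der M 2 = {0} \<and> step_solvable 2 M \<and>
        (\<forall>n\<ge>2. lie_lower M n = g2_sum {2, 3, 5, 6}) \<and> \<not> lie_nilpotent M) \<and>
     (T = {{1, 2}, {1, 6}, {1, 7}, {2, 6}, {2, 7}} \<longrightarrow>
        lie_center M = g2_sum {3, 4, 5} \<and> lie_derived M = g2_sum {3, 4, 5} \<and>
        lie_dim M (lie_center M) = 6 \<and> lie_der M 2 = {0} \<and> lie_lower M 2 = {0} \<and>
        step_nilpotent 2 M) \<and>
     (T = {{3, 4}, {3, 6}, {3, 7}, {4, 6}, {4, 7}, {6, 7}} \<longrightarrow>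
        lie_center M = g2_sum {1, 2, 5} \<and> lie_derived M = g2_sum {1, 2, 5} \<and>
        lie_dim M (lie_center M) = 6 \<and> lie_der M 2 = {0} \<and> lie_lower M 2 = {0} \<and>
        step_nilpotent 2 M) \<and>
     (T = {{1, 2}, {1, 3}, {1, 4}, {1, 5}, {1, 6}, {1, 7}} \<longrightarrow>
        lie_center M = {0} \<and> lie_derived M = g2_sum {2, 3, 4, 5, 6, 7} \<and>
        lie_dim M (lie_derived M) = 12 \<and> lie_der M 2 = {0} \<and> step_solvable 2 M \<and>
        (\<forall>n\<ge>2. lie_lower M n = lie_derived M) \<and> \<not> lie_nilpotent M) \<and>
     (T = {{1, 2}, {1, 3}, {1, 7}, {2, 3}, {2, 6}, {3, 5}} \<longrightarrow>
        lie_center M = g2_sum {4} \<and> lie_dim M (lie_center M) = 2 \<and>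
        lie_derived M = g2_sum {4, 5, 6, 7} \<and> lie_dim M (lie_derived M) = 8 \<and>
        lie_der M 2 = {0} \<and> step_solvable 2 M \<and> lie_lower M 2 = lie_center M \<and>
        step_nilpotent 3 M) \<and>
     (T = {{1, 2}, {1, 3}, {1, 4}, {1, 5}, {1, 6}, {1, 7}, {2, 3}, {2, 6}, {3, 5}, {5, 6}} \<longrightarrow>
        lie_center M = {0} \<and>
        (\<forall>n\<ge>1. lie_lower M n = g2_sum {2, 3, 4, 5, 6, 7}) \<and>
        lie_dim M (lie_derived M) = 12 \<and> \<not> lie_nilpotent M \<and>
        lie_der M 2 = g2_sum {4, 7} \<and> lie_der M 3 = {0} \<and> step_solvable 3 M) \<and>
     (T = edges - {{3, 4}, {3, 6}, {3, 7}, {4, 6}, {4, 7}, {6, 7}} \<longrightarrow>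
        lie_center M = {0} \<and> (\<forall>n\<ge>1. lie_lower M n = lie_carrier M) \<and>
        (\<forall>n\<ge>1. lie_der M n = lie_carrier M) \<and> \<not> lie_nilpotent M \<and>
        \<not> lie_solvable M \<and> lie_radical M = g2_sum {3, 4, 6, 7} \<and>
        lie_ideal M (g2_sum {3, 4, 6, 7}) \<and>
        lie_abelian (lie_restrict M (g2_sum {3, 4, 6, 7})) \<and>
        lie_dim M (g2_sum {3, 4, 6, 7}) = 8 \<and> \<not> lie_reductive M \<and>
        lie_isomorphic (lie_restrict M (g2_sum {1, 2, 5})) (lie_sum sl2 sl2) \<and>
        levi_subalgebra M (g2_sum {1, 2, 5}) \<and>
        levi_decomposition M (lie_radical M) (g2_sum {1, 2, 5})) \<and>
     (T = edges \<longrightarrow>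
        lie_simple M)"
proof -
  interpret contraction \<epsilon>
    using assms(1,2) by unfold_locales
  let ?M = "g2_contr \<epsilon>" and ?T = "eta_support \<epsilon>"
  show ?thesis
    unfolding assms(3,4)
  \<comment> \<open>Goal numbers agree with the items of the theorem up to 9 and are one less
    afterwards, since no assertion is made for the support
    \<open>{{1, 2}, {1, 3}, {1, 7}}\<close>.\<close>
  proof ((intro conjI; rule impI), goal_cases)
    case 1
    have "lie_center ?M = lie_carrier ?M"
      unfolding lie_center_M 1 by (simp add: g2_sum_idx)
    then show ?case by (auto simp: lie_center_def lie_abelian_def)
  next
    case 2
    have r: "idx - \<Union>?T = {3, 4, 5, 6, 7}"
      "star_reach ?T idx idx = {5}"
      "{5} \<noteq> ({} :: nat set)"
      "star_reach ?T idx {5} = {}"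
      "2 * card ({3, 4, 5, 6, 7} :: nat set) = 10"
      "2 * card ({5} :: nat set) = 2"
      unfolding 2 by (simp_all add: reach_simps insert_commute insert_Diff_if del: One_nat_def)
    from two_step_nilpotent_case[OF r] show ?case by (elim conjE) (intro conjI; assumption)
  next
    case 3
    have r: "idx - \<Union>?T = {4, 5, 6, 7}"
      "star_reach ?T idx idx = {5, 6}"
      "{5, 6} \<noteq> ({} :: nat set)"
      "star_reach ?T idx {5, 6} = {}"
      "2 * card ({4, 5, 6, 7} :: nat set) = 8"
      "2 * card ({5, 6} :: nat set) = 4"
      unfolding 3 by (simp_all add: reach_simps insert_commute insert_Diff_if del: One_nat_def)
    from two_step_nilpotent_case[OF r] show ?case by (elim conjE) (intro conjI; assumption)
  next
    case 4
    have r: "idx - \<Union>?T = {3, 4, 6, 7}"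
      "star_reach ?T idx idx = {2, 5}"
      "{2, 5} \<noteq> ({} :: nat set)"
      "star_reach ?T {2, 5} {2, 5} = {}"
      "star_reach ?T idx {2, 5} = {2, 5}"
      "star_reach ?T idx {2, 5} = {2, 5}"
      "{2, 5} \<noteq> ({} :: nat set)"
      "2 * card ({3, 4, 6, 7} :: nat set) = 8"
      "2 * card ({2, 5} :: nat set) = 4"
      unfolding 4 by (simp_all add: reach_simps insert_commute insert_Diff_if del: One_nat_def)
    \<comment> \<open>The common case lemma speaks about \<open>n \<ge> 2\<close>; here
      \<open>J = K\<close>, so the series is stationary one step earlier.\<close>
    have "\<forall>n\<ge>1. lie_lower ?M n = g2_sum {2, 5}"
      using lie_lower_stable[OF lie_lower_1[unfolded r(2)] _ r(5)] by (simp add: idx_def)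
    with two_step_solvable_case[OF r] show ?case by (elim conjE) (intro conjI; assumption)
  next
    case 5
    have r: "idx - \<Union>?T = {3, 4, 5}"
      "star_reach ?T idx idx = {5}"
      "{5} \<noteq> ({} :: nat set)"
      "star_reach ?T idx {5} = {}"
      "2 * card ({3, 4, 5} :: nat set) = 6"
      "2 * card ({5} :: nat set) = 2"
      unfolding 5 by (simp_all add: reach_simps insert_commute insert_Diff_if del: One_nat_def)
    from two_step_nilpotent_case[OF r] show ?case by (elim conjE) (intro conjI; assumption)
  next
    case 6
    interpret line_contraction \<epsilon>
      by unfold_locales (auto simp: 6 doubleton_eq_iff)
    have r: "idx - \<Union>?T = {3, 4, 6, 7}"
      "star_reach ?T idx idx = {1, 2, 5}"
      "star_reach ?T idx {1, 2, 5} = {1, 2, 5}"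
      "star_reach ?T {1, 2, 5} {1, 2, 5} = {1, 2, 5}"
      "{1, 2, 5} \<noteq> ({} :: nat set)"
      "2 * card ({3, 4, 6, 7} :: nat set) = 8"
      unfolding 6 by (simp_all add: reach_simps insert_commute insert_Diff_if del: One_nat_def)
    have center: "lie_center ?M = g2_sum {3, 4, 6, 7}" and der: "lie_derived ?M = g2_sum {1, 2, 5}"
      unfolding lie_center_M lie_derived_M r(1,2) by (rule refl)+
    have "lie_dim ?M (g2_sum {3, 4, 6, 7}) = 8"
      unfolding lie_dim_g2_sum[OF subset_idx(2)] by (rule r(6))
    moreover have "\<forall>n\<ge>1. lie_der ?M n = g2_sum {1, 2, 5}"
      using lie_der_stable[OF lie_der_1[unfolded r(2)] subset_idx(1) r(4)] by blast
    moreover have "\<forall>n\<ge>1. lie_lower ?M n = g2_sum {1, 2, 5}"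
      using lie_lower_stable[OF lie_lower_1[unfolded r(2)] subset_idx(1) r(3)] by blast
    moreover have "\<not> lie_nilpotent ?M"
      by (rule not_nilpotentI[OF r(5) subset_idx(1)]) (simp only: r(3))
    moreover have "\<not> lie_solvable ?M"
      by (rule not_solvableI[OF r(5) subset_idx(1)]) (simp only: r(4))
    \<comment> \<open>Radical and centre coincide for this support, so the uniqueness argument
      applies.\<close>
    moreover have "\<forall>S. levi_subalgebra ?M S \<longleftrightarrow> S = g2_sum {1, 2, 5}"
      using levi_unique[OF _ der] line_levi center lie_radical_line by metis
    ultimately show ?case
      unfolding lie_reductive_def lie_radical_line center der
      using line_isomorphic line_levi_decomposition[unfolded lie_radical_line]
      by - (intro conjI refl; assumption)
  next
    case 7
    have r: "idx - \<Union>?T = {1}"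
      "star_reach ?T idx idx = {1}"
      "{1} \<noteq> ({} :: nat set)"
      "star_reach ?T idx {1} = {}"
      "2 * card ({1} :: nat set) = 2"
      "2 * card ({1} :: nat set) = 2"
      unfolding 7 by (simp_all add: reach_simps insert_commute insert_Diff_if del: One_nat_def)
    from two_step_nilpotent_case[OF r] show ?case by (elim conjE) (intro conjI; assumption)
  next
    case 8
    have r: "idx - \<Union>?T = {5, 6, 7}"
      "star_reach ?T idx idx = {5, 6, 7}"
      "{5, 6, 7} \<noteq> ({} :: nat set)"
      "star_reach ?T idx {5, 6, 7} = {}"
      "2 * card ({5, 6, 7} :: nat set) = 6"
      "2 * card ({5, 6, 7} :: nat set) = 6"
      unfolding 8 by (simp_all add: reach_simps insert_commute insert_Diff_if del: One_nat_def)
    from two_step_nilpotent_case[OF r] show ?case by (elim conjE) (intro conjI; assumption)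
  next
    case 9
    have r: "idx - \<Union>?T = {4, 6, 7}"
      "star_reach ?T idx idx = {2, 5, 6}"
      "{2, 5, 6} \<noteq> ({} :: nat set)"
      "star_reach ?T {2, 5, 6} {2, 5, 6} = {}"
      "star_reach ?T idx {2, 5, 6} = {2, 5}"
      "star_reach ?T idx {2, 5} = {2, 5}"
      "{2, 5} \<noteq> ({} :: nat set)"
      "2 * card ({4, 6, 7} :: nat set) = 6"
      "2 * card ({2, 5, 6} :: nat set) = 6"
      unfolding 9 by (simp_all add: reach_simps insert_commute insert_Diff_if del: One_nat_def)
    from two_step_solvable_case[OF r] show ?case by (elim conjE) (intro conjI; assumption)
  next
    case 10
    have r: "idx - \<Union>?T = {3, 4, 5, 7}"
      "star_reach ?T idx idx = {3, 4, 5}"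
      "{3, 4, 5} \<noteq> ({} :: nat set)"
      "star_reach ?T idx {3, 4, 5} = {}"
      "2 * card ({3, 4, 5, 7} :: nat set) = 8"
      "2 * card ({3, 4, 5} :: nat set) = 6"
      unfolding 10 by (simp_all add: reach_simps insert_commute insert_Diff_if del: One_nat_def)
    from two_step_nilpotent_case[OF r] show ?case by (elim conjE) (intro conjI; assumption)
  next
    case 11
    have r: "idx - \<Union>?T = {3, 4, 5}"
      "star_reach ?T idx idx = {3, 5}"
      "{3, 5} \<noteq> ({} :: nat set)"
      "star_reach ?T idx {3, 5} = {}"
      "2 * card ({3, 4, 5} :: nat set) = 6"
      "2 * card ({3, 5} :: nat set) = 4"
      unfolding 11 by (simp_all add: reach_simps insert_commute insert_Diff_if del: One_nat_def)
    from two_step_nilpotent_case[OF r] show ?case by (elim conjE) (intro conjI; assumption)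
  next
    case 12
    have r: "idx - \<Union>?T = {6, 7}"
      "star_reach ?T idx idx = {2, 5, 6, 7}"
      "{2, 5, 6, 7} \<noteq> ({} :: nat set)"
      "star_reach ?T {2, 5, 6, 7} {2, 5, 6, 7} = {}"
      "star_reach ?T idx {2, 5, 6, 7} = {2, 5}"
      "star_reach ?T idx {2, 5} = {2, 5}"
      "{2, 5} \<noteq> ({} :: nat set)"
      "2 * card ({6, 7} :: nat set) = 4"
      "2 * card ({2, 5, 6, 7} :: nat set) = 8"
      unfolding 12 by (simp_all add: reach_simps insert_commute insert_Diff_if del: One_nat_def)
    from two_step_solvable_case[OF r] show ?case by (elim conjE) (intro conjI; assumption)
  next
    case 13
    have r: "idx - \<Union>?T = {4, 7}"
      "star_reach ?T idx idx = {2, 3, 5, 6}"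
      "{2, 3, 5, 6} \<noteq> ({} :: nat set)"
      "star_reach ?T {2, 3, 5, 6} {2, 3, 5, 6} = {}"
      "star_reach ?T idx {2, 3, 5, 6} = {2, 3, 5, 6}"
      "star_reach ?T idx {2, 3, 5, 6} = {2, 3, 5, 6}"
      "{2, 3, 5, 6} \<noteq> ({} :: nat set)"
      "2 * card ({4, 7} :: nat set) = 4"
      "2 * card ({2, 3, 5, 6} :: nat set) = 8"
      unfolding 13 by (simp_all add: reach_simps insert_commute insert_Diff_if del: One_nat_def)
    \<comment> \<open>Again \<open>J = K\<close>, and the stationary range starts at 1.\<close>
    have "\<forall>n\<ge>1. lie_lower ?M n = g2_sum {2, 3, 5, 6}"
      using lie_lower_stable[OF lie_lower_1[unfolded r(2)] _ r(5)] by (simp add: idx_def)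
    with two_step_solvable_case[OF r] show ?case by (elim conjE) (intro conjI; assumption)
  next
    case 14
    have r: "idx - \<Union>?T = {3, 4, 5}"
      "star_reach ?T idx idx = {3, 4, 5}"
      "{3, 4, 5} \<noteq> ({} :: nat set)"
      "star_reach ?T idx {3, 4, 5} = {}"
      "2 * card ({3, 4, 5} :: nat set) = 6"
      "2 * card ({3, 4, 5} :: nat set) = 6"
      unfolding 14 by (simp_all add: reach_simps insert_commute insert_Diff_if del: One_nat_def)
    from two_step_nilpotent_case[OF r] show ?case by (elim conjE) (intro conjI; assumption)
  next
    case 15
    have r: "idx - \<Union>?T = {3, 4, 5}"
      "star_reach ?T idx idx = {3, 5}"
      "{3, 5} \<noteq> ({} :: nat set)"
      "star_reach ?T idx {3, 5} = {}"
      "2 * card ({3, 4, 5} :: nat set) = 6"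
      "2 * card ({3, 5} :: nat set) = 4"
      unfolding 15 by (simp_all add: reach_simps insert_commute insert_Diff_if del: One_nat_def)
    from two_step_nilpotent_case[OF r] show ?case by (elim conjE) (intro conjI; assumption)
  next
    case 16
    have r: "idx - \<Union>?T = {7}"
      "star_reach ?T idx idx = {2, 3, 5, 6, 7}"
      "{2, 3, 5, 6, 7} \<noteq> ({} :: nat set)"
      "star_reach ?T {2, 3, 5, 6, 7} {2, 3, 5, 6, 7} = {}"
      "star_reach ?T idx {2, 3, 5, 6, 7} = {2, 3, 5, 6}"
      "star_reach ?T idx {2, 3, 5, 6} = {2, 3, 5, 6}"
      "{2, 3, 5, 6} \<noteq> ({} :: nat set)"
      "2 * card ({7} :: nat set) = 2"
      "2 * card ({2, 3, 5, 6, 7} :: nat set) = 10"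
      unfolding 16 by (simp_all add: reach_simps insert_commute insert_Diff_if del: One_nat_def)
    from two_step_solvable_case[OF r] show ?case by (elim conjE) (intro conjI; assumption)
  next
    case 17
    have r: "idx - \<Union>?T = {3, 4, 5}"
      "star_reach ?T idx idx = {3, 4, 5}"
      "{3, 4, 5} \<noteq> ({} :: nat set)"
      "star_reach ?T idx {3, 4, 5} = {}"
      "2 * card ({3, 4, 5} :: nat set) = 6"
      "2 * card ({3, 4, 5} :: nat set) = 6"
      unfolding 17 by (simp_all add: reach_simps insert_commute insert_Diff_if del: One_nat_def)
    from two_step_nilpotent_case[OF r] show ?case by (elim conjE) (intro conjI; assumption)
  next
    case 18
    have r: "idx - \<Union>?T = {1, 2, 5}"
      "star_reach ?T idx idx = {1, 2, 5}"
      "{1, 2, 5} \<noteq> ({} :: nat set)"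
      "star_reach ?T idx {1, 2, 5} = {}"
      "2 * card ({1, 2, 5} :: nat set) = 6"
      "2 * card ({1, 2, 5} :: nat set) = 6"
      unfolding 18 by (simp_all add: reach_simps insert_commute insert_Diff_if del: One_nat_def)
    from two_step_nilpotent_case[OF r] show ?case by (elim conjE) (intro conjI; assumption)
  next
    case 19
    have r: "idx - \<Union>?T = {}"
      "star_reach ?T idx idx = {2, 3, 4, 5, 6, 7}"
      "{2, 3, 4, 5, 6, 7} \<noteq> ({} :: nat set)"
      "star_reach ?T {2, 3, 4, 5, 6, 7} {2, 3, 4, 5, 6, 7} = {}"
      "star_reach ?T idx {2, 3, 4, 5, 6, 7} = {2, 3, 4, 5, 6, 7}"
      "star_reach ?T idx {2, 3, 4, 5, 6, 7} = {2, 3, 4, 5, 6, 7}"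
      "{2, 3, 4, 5, 6, 7} \<noteq> ({} :: nat set)"
      "2 * card ({} :: nat set) = 0"
      "2 * card ({2, 3, 4, 5, 6, 7} :: nat set) = 12"
      unfolding 19 by (simp_all add: reach_simps insert_commute insert_Diff_if del: One_nat_def)
    have d: "lie_derived ?M = g2_sum {2, 3, 4, 5, 6, 7}"
      unfolding lie_derived_M r(2) by (rule refl)
    from two_step_solvable_case[OF r] show ?case
      unfolding d g2_sum_empty by (elim conjE) (intro conjI refl; assumption)
  next
    case 20
    have r: "idx - \<Union>?T = {4}"
      "star_reach ?T idx idx = {4, 5, 6, 7}"
      "{4, 5, 6, 7} \<noteq> ({} :: nat set)"
      "star_reach ?T {4, 5, 6, 7} {4, 5, 6, 7} = {}"
      "star_reach ?T idx {4, 5, 6, 7} = {4}"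
      "{4} \<noteq> ({} :: nat set)"
      "star_reach ?T idx {4} = {}"
      "2 * card ({4} :: nat set) = 2"
      "2 * card ({4, 5, 6, 7} :: nat set) = 8"
      unfolding 20 by (simp_all add: reach_simps insert_commute insert_Diff_if del: One_nat_def)
    have c: "lie_center ?M = g2_sum {4}"
      unfolding lie_center_M r(1) by (rule refl)
    from three_step_nilpotent_case[OF r] show ?case
      unfolding c by (elim conjE) (intro conjI refl; assumption)
  next
    case 21
    have r: "idx - \<Union>?T = {}"
      "star_reach ?T idx idx = {2, 3, 4, 5, 6, 7}"
      "{2, 3, 4, 5, 6, 7} \<noteq> ({} :: nat set)"
      "star_reach ?T idx {2, 3, 4, 5, 6, 7} = {2, 3, 4, 5, 6, 7}"
      "star_reach ?T {2, 3, 4, 5, 6, 7} {2, 3, 4, 5, 6, 7} = {4, 7}"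
      "{4, 7} \<noteq> ({} :: nat set)"
      "star_reach ?T {4, 7} {4, 7} = {}"
      "2 * card ({2, 3, 4, 5, 6, 7} :: nat set) = 12"
      unfolding 21 by (simp_all add: reach_simps insert_commute insert_Diff_if del: One_nat_def)
    from three_step_solvable_case[OF r] show ?case
      unfolding g2_sum_empty by (elim conjE) (intro conjI; assumption)
  next
    case 22
    interpret line_contraction \<epsilon>
    proof
      show "{1, 2} \<in> ?T" "{1, 5} \<in> ?T" "{2, 5} \<in> ?T"
        unfolding 22 line_complement_eq by simp_all
      show "{i, j} \<notin> ?T" if "i \<in> {3, 4, 6, 7}" "j \<in> {3, 4, 6, 7}" for i j
        using that unfolding 22 line_complement_eq
        by (elim insertE emptyE) (simp_all add: doubleton_eq_iff)
    qed
    have r: "idx - \<Union>?T = {}"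
      "star_reach ?T idx idx = idx"
      "2 * card ({3, 4, 6, 7} :: nat set) = 8"
      unfolding 22 line_complement_eq by (simp_all add: reach_simps insert_commute insert_Diff_if del: One_nat_def)
    have idx: "idx \<noteq> {}" by (simp add: idx_def)
    have center: "lie_center ?M = {0}"
      unfolding lie_center_M r(1) by (rule g2_sum_empty)
    \<comment> \<open>Every index is reached by an edge, so the algebra is perfect and both series
      are constant from term 0 on.\<close>
    moreover have "\<forall>n\<ge>1. lie_lower ?M n = lie_carrier ?M" "\<forall>n\<ge>1. lie_der ?M n = lie_carrier ?M"
      using lie_lower_stable[OF _ order_refl r(2), of 0] lie_der_stable[OF _ order_refl r(2), of 0]
      by (simp_all add: g2_sum_idx)
    moreover have "\<not> lie_nilpotent ?M" "\<not> lie_solvable ?M"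
      using not_nilpotentI[OF idx order_refl] not_solvableI[OF idx order_refl] r(2) by simp_all
    moreover have "lie_abelian (lie_restrict ?M (g2_sum {3, 4, 6, 7}))"
      unfolding lie_abelian_def restrict_simps using off_line_abelian by blast
    moreover have "lie_dim ?M (g2_sum {3, 4, 6, 7}) = 8"
      unfolding lie_dim_g2_sum[OF subset_idx(2)] by (rule r(3))
    \<comment> \<open>The centre is zero while the radical is a sum over a nonempty set of
      degrees.\<close>
    moreover have "\<not> lie_reductive ?M"
      unfolding lie_reductive_def center lie_radical_line g2_sum_eq_zero_iff[OF subset_idx(2)] by simp
    ultimately show ?case
      using lie_radical_line off_line_ideal line_isomorphic line_levi line_levi_decomposition
      by - (intro conjI; assumption)
  next
    case 23
    then show ?case by (rule simple_full_support)
  qed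
qed

end
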